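(* Let $\Bbbk$ be an algebraically closed field (of arbitrary characteristic) and let $N \geqslant 3$ be an integer. Fix an integer $m \geqslant 1$ and let $s \geqslant (2m+2)^N$ be an integer. Let $I \subseteq R = \Bbbk[x_0,\dots,x_N]$ be the defining ideal of a general set of $s$ points in $\mathbb{P}^N_{\Bbbk}$. Then $$\widehat{\alpha}(I) \geqslant \dfrac{\alpha(I^{(m)})+N-1}{m+N-1}.$$
   Context: $R=\Bbbk[x_0,\dots,x_N]$ is the homogeneous coordinate ring of $\mathbb{P}^N_{\Bbbk}$. The defining ideal of a set of points is the ideal generated by all homogeneous polynomials vanishing at all of the points. For a nonzero homogeneous ideal $J\subseteq R$, $\alpha(J)$ is the least degree of a nonzero homogeneous polynomial in $J$. For an ideal $I$ and $n \geqslant 1$, the $n$-th symbolic power is $I^{(n)} = \bigcap_{\mathfrak{p}\in \mathrm{Ass}(R/I)} (I^nR_{\mathfrak{p}}\cap R)$. The Waldschmidt constant of a nonzero homogeneous proper ideal $I$ is $\widehat{\alpha}(I)=\lim_{n\to\infty}\alpha(I^{(n)})/n$; this limit exists and equals $\inf_{n\geqslant 1}\alpha(I^{(n)})/n$. A property is said to hold for a general set of $s$ points in $\mathbb{P}^N_{\Bbbk}$ if there is an open dense subset $U$ of the Hilbert scheme of $s$ points in $\mathbb{P}^N_{\Bbbk}$ such that the property holds for every set $\mathbb{X}$ of $s$ distinct points in $\mathbb{P}^N_{\Bbbk}$ with $\mathbb{X}\in U$. Here $U$ may depend on $\Bbbk$, $N$, $m$, $s$. *)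

theory Defs
  imports
    "HOL-Library.Poly_Mapping"
    "HOL-Algebra.Ideal_Product"
    "HOL-Algebra.QuotRing"
    "HOL-Analysis.Abstract_Topology"
    "Jordan_Normal_Form.Determinant"
begin

section \<open>Localization, associated primes and symbolic powers\<close>

definition frac_rel :: "('a, 'b) ring_scheme \<Rightarrow> 'a set \<Rightarrow> (('a \<times> 'a) \<times> ('a \<times> 'a)) set"
  where "frac_rel R p =
    {((a, s), (b, t)). a \<in> carrier R \<and> b \<in> carrier R \<and> s \<in> carrier R - p \<and> t \<in> carrier R - p \<and>
       (\<exists>u\<in>carrier R - p. u \<otimes>\<^bsub>R\<^esub> (a \<otimes>\<^bsub>R\<^esub> t) = u \<otimes>\<^bsub>R\<^esub> (b \<otimes>\<^bsub>R\<^esub> s))}"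

definition fraction :: "('a, 'b) ring_scheme \<Rightarrow> 'a set \<Rightarrow> 'a \<Rightarrow> 'a \<Rightarrow> ('a \<times> 'a) set"
  where "fraction R p a s = frac_rel R p `` {(a, s)}"

text \<open>The localization of \<open>R\<close> at a prime ideal \<open>p\<close>, with classes of fractions as elements.\<close>

definition localization :: "('a, 'b) ring_scheme \<Rightarrow> 'a set \<Rightarrow> ('a \<times> 'a) set ring"
  where "localization R p =
    \<lparr>carrier = (carrier R \<times> (carrier R - p)) // frac_rel R p,
     monoid.mult = (\<lambda>X Y. \<Union>(a, s)\<in>X. \<Union>(b, t)\<in>Y. fraction R p (a \<otimes>\<^bsub>R\<^esub> b) (s \<otimes>\<^bsub>R\<^esub> t)),
     one = fraction R p \<one>\<^bsub>R\<^esub> \<one>\<^bsub>R\<^esub>,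
     zero = fraction R p \<zero>\<^bsub>R\<^esub> \<one>\<^bsub>R\<^esub>,
     add = (\<lambda>X Y. \<Union>(a, s)\<in>X. \<Union>(b, t)\<in>Y.
              fraction R p (a \<otimes>\<^bsub>R\<^esub> t \<oplus>\<^bsub>R\<^esub> b \<otimes>\<^bsub>R\<^esub> s) (s \<otimes>\<^bsub>R\<^esub> t))\<rparr>"

text \<open>\<open>J R\<^sub>p \<inter> R\<close>, the preimage in \<open>R\<close> of the extension of \<open>J\<close> to the localization.\<close>

definition loc_contraction :: "('a, 'b) ring_scheme \<Rightarrow> 'a set \<Rightarrow> 'a set \<Rightarrow> 'a set"
  where "loc_contraction R p J =
    {f \<in> carrier R. fraction R p f \<one>\<^bsub>R\<^esub> \<in> Idl\<^bsub>localization R p\<^esub> ((\<lambda>a. fraction R p a \<one>\<^bsub>R\<^esub>) ` J)}"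

text \<open>\<open>Ass(R/I)\<close>: the primes that are annihilators of elements of the \<open>R\<close>-module \<open>R/I\<close>.\<close>

definition assoc_primes :: "('a, 'b) ring_scheme \<Rightarrow> 'a set \<Rightarrow> 'a set set"
  where "assoc_primes R I =
    {p. primeideal p R \<and>
        (\<exists>x\<in>carrier (R Quot I).
           p = {r \<in> carrier R. (I +>\<^bsub>R\<^esub> r) \<otimes>\<^bsub>R Quot I\<^esub> x = \<zero>\<^bsub>R Quot I\<^esub>})}"

definition symbolic_power :: "('a, 'b) ring_scheme \<Rightarrow> 'a set \<Rightarrow> nat \<Rightarrow> 'a set"
  where "symbolic_power R I n =
    {f \<in> carrier R. \<forall>p\<in>assoc_primes R I. f \<in> loc_contraction R p (I [^]\<^bsub>ideals_set R\<^esub> n)}"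


section \<open>Polynomial rings and graded pieces\<close>

type_synonym 'v monomial = "'v \<Rightarrow>\<^sub>0 nat"
type_synonym ('v, 'k) mpoly = "'v monomial \<Rightarrow>\<^sub>0 'k"

definition mpoly_ring :: "'v set \<Rightarrow> ('v, 'k::comm_ring_1) mpoly ring"
  where "mpoly_ring V =
    \<lparr>carrier = {f. \<forall>t\<in>Poly_Mapping.keys f. Poly_Mapping.keys t \<subseteq> V}, monoid.mult = (*), one = 1, zero = 0, add = (+)\<rparr>"

definition mpoly_eval :: "('v \<Rightarrow> 'k::comm_ring_1) \<Rightarrow> ('v, 'k) mpoly \<Rightarrow> 'k"
  where "mpoly_eval v f = (\<Sum>t\<in>Poly_Mapping.keys f. Poly_Mapping.lookup f t * (\<Prod>i\<in>Poly_Mapping.keys t. v i ^ Poly_Mapping.lookup t i))"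

definition mono_deg :: "'v monomial \<Rightarrow> nat"
  where "mono_deg t = (\<Sum>i\<in>Poly_Mapping.keys t. Poly_Mapping.lookup t i)"

text \<open>The zero polynomial is homogeneous of every degree.\<close>

definition homogeneous :: "nat \<Rightarrow> ('v, 'k::zero) mpoly \<Rightarrow> bool"
  where "homogeneous d f \<longleftrightarrow> (\<forall>t\<in>Poly_Mapping.keys f. mono_deg t = d)"

definition graded_part :: "('v, 'k::zero) mpoly set \<Rightarrow> nat \<Rightarrow> ('v, 'k) mpoly set"
  where "graded_part J d = {f \<in> J. homogeneous d f}"

text \<open>The homogeneous coordinate ring \<open>k[x\<^sub>0, \<dots>, x\<^sub>N]\<close> of \<open>N\<close>-dimensional projective space.\<close>

abbreviation coord_ring :: "nat \<Rightarrow> (nat, 'k::comm_ring_1) mpoly ring"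
  where "coord_ring N \<equiv> mpoly_ring {..N}"

definition initial_degree :: "('v, 'k::zero) mpoly set \<Rightarrow> nat"  (\<open>\<alpha>\<close>)
  where "\<alpha> J = (LEAST d. \<exists>f\<in>J. f \<noteq> 0 \<and> homogeneous d f)"

definition waldschmidt :: "nat \<Rightarrow> (nat, 'k::comm_ring_1) mpoly set \<Rightarrow> real"
  where "waldschmidt N I = lim (\<lambda>n. real (\<alpha> (symbolic_power (coord_ring N) I n)) / real n)"


section \<open>Projective space\<close>

definition nonzero_vectors :: "nat \<Rightarrow> (nat \<Rightarrow> 'k::field) set"
  where "nonzero_vectors N = {v. v \<noteq> (\<lambda>_. 0) \<and> (\<forall>i>N. v i = 0)}"

definition proj_space :: "nat \<Rightarrow> (nat \<Rightarrow> 'k::field) set set"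
  where "proj_space N = nonzero_vectors N //
    {(v, w). v \<in> nonzero_vectors N \<and> w \<in> nonzero_vectors N \<and> (\<exists>c. c \<noteq> 0 \<and> w = (\<lambda>i. c * v i))}"

definition defining_ideal :: "nat \<Rightarrow> (nat \<Rightarrow> 'k::field) set set \<Rightarrow> (nat, 'k) mpoly set"
  where "defining_ideal N X = Idl\<^bsub>coord_ring N\<^esub>
    {f \<in> carrier (coord_ring N). (\<exists>d. homogeneous d f) \<and> (\<forall>P\<in>X. \<forall>v\<in>P. mpoly_eval v f = 0)}"


section \<open>The Hilbert scheme of points\<close>

text \<open>
  Over an algebraically closed field the open subsets of the Hilbert scheme correspond to
  the open subsets of its space of closed points, and density is preserved. A closed point is a
  length \<open>s\<close> closed subscheme of projective space, that is, a saturated homogeneous ideal \<open>J\<close> with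
  constant Hilbert polynomial \<open>s\<close>.

  By Gotzmann's theorem, for each \<open>d \<ge> s\<close> the map \<open>J \<mapsto> J\<^sub>d\<close> is a closed immersion of the Hilbert
  scheme into the Grassmannian of codimension \<open>s\<close> subspaces of the space of forms of degree \<open>d\<close>. The
  Zariski topology is therefore the one induced by the Pluecker coordinates of \<open>J\<^sub>d\<close>, for any
  \<open>d \<ge> s\<close>; below it is generated by the basic open sets coming from all these \<open>d\<close>.
\<close>

definition mpoly_scale :: "'k::comm_ring_1 \<Rightarrow> ('v, 'k) mpoly \<Rightarrow> ('v, 'k) mpoly"
  where "mpoly_scale c f = Poly_Mapping.single 0 c * f"

definition hilbert_function :: "nat \<Rightarrow> (nat, 'k::field) mpoly set \<Rightarrow> nat \<Rightarrow> nat"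
  where "hilbert_function N J d =
    vector_space.dim mpoly_scale (graded_part (carrier (coord_ring N) :: (nat, 'k) mpoly set) d)
      - vector_space.dim mpoly_scale (graded_part J d)"

definition homogeneous_ideal :: "nat \<Rightarrow> (nat, 'k::comm_ring_1) mpoly set \<Rightarrow> bool"
  where "homogeneous_ideal N J \<longleftrightarrow>
    ideal J (coord_ring N) \<and> J = Idl\<^bsub>coord_ring N\<^esub> (\<Union>d. graded_part J d)"

definition saturated :: "nat \<Rightarrow> (nat, 'k::comm_ring_1) mpoly set \<Rightarrow> bool"
  where "saturated N J \<longleftrightarrow>
    (\<forall>f\<in>carrier (coord_ring N).
       (\<forall>i\<le>N. Poly_Mapping.single (Poly_Mapping.single i 1) 1 * f \<in> J) \<longrightarrow> f \<in> J)"

definition hilb :: "nat \<Rightarrow> nat \<Rightarrow> (nat, 'k::field) mpoly set set"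
  where "hilb N s =
    {J. homogeneous_ideal N J \<and> saturated N J \<and> (\<exists>d0. \<forall>d\<ge>d0. hilbert_function N J d = s)}"

definition monomials :: "nat \<Rightarrow> nat \<Rightarrow> nat monomial set"
  where "monomials N d = {t. Poly_Mapping.keys t \<subseteq> {..N} \<and> mono_deg t = d}"

text \<open>
  A linear functional on forms of degree \<open>d\<close> is given by its values on monomials. A frame of \<open>J\<^sub>d\<close> is
  a tuple of \<open>s\<close> functionals that cut out \<open>J\<^sub>d\<close>, where \<open>J\<^sub>d\<close> has codimension \<open>s\<close>; equivalently, it
  is an isomorphism from \<open>R\<^sub>d / J\<^sub>d\<close> to \<open>k\<^sup>s\<close>. The Pluecker coordinates of \<open>J\<^sub>d\<close> are the maximal minors
  of the matrix of the functionals; they are indexed by lists of \<open>s\<close> monomials and another frame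
  changes all of them by the same nonzero factor.
\<close>

definition frame :: "nat \<Rightarrow> nat \<Rightarrow> nat \<Rightarrow> (nat, 'k::field) mpoly set \<Rightarrow> (nat \<Rightarrow> nat monomial \<Rightarrow> 'k) \<Rightarrow> bool"
  where "frame N s d J l \<longleftrightarrow>
    hilbert_function N J d = s \<and>
    graded_part J d = {f \<in> graded_part (carrier (coord_ring N)) d.
                         \<forall>i<s. (\<Sum>t\<in>Poly_Mapping.keys f. Poly_Mapping.lookup f t * l i t) = 0}"

definition pluecker :: "nat \<Rightarrow> (nat \<Rightarrow> nat monomial \<Rightarrow> 'k::field) \<Rightarrow> nat monomial list \<Rightarrow> 'k"
  where "pluecker s l ts = det (mat s s (\<lambda>(i, j). l i (ts ! j)))"

definition pluecker_ring :: "nat \<Rightarrow> nat \<Rightarrow> nat \<Rightarrow> (nat monomial list, 'k::comm_ring_1) mpoly ring"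
  where "pluecker_ring N s d = mpoly_ring {ts. length ts = s \<and> set ts \<subseteq> monomials N d}"

definition hilb_basic_open ::
    "nat \<Rightarrow> nat \<Rightarrow> nat \<Rightarrow> (nat monomial list, 'k::field) mpoly \<Rightarrow> (nat, 'k) mpoly set set"
  where "hilb_basic_open N s d F =
    {J \<in> hilb N s. \<exists>l. frame N s d J l \<and> mpoly_eval (pluecker s l) F \<noteq> 0}"

definition hilb_topology :: "nat \<Rightarrow> nat \<Rightarrow> (nat, 'k::field) mpoly set topology"
  where "hilb_topology N s = topology_generated_by
    {hilb_basic_open N s d F | d F.
       s \<le> d \<and> F \<in> carrier (pluecker_ring N s d) \<and> (\<exists>e. homogeneous e F)}"

text \<open>A set of points corresponds to the point of the Hilbert scheme given by its defining ideal.\<close>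

definition holds_for_general_points ::
    "nat \<Rightarrow> nat \<Rightarrow> ((nat \<Rightarrow> 'k::field) set set \<Rightarrow> bool) \<Rightarrow> bool"
  where "holds_for_general_points N s P \<longleftrightarrow>
    (\<exists>U. openin (hilb_topology N s) U \<and> hilb_topology N s closure_of U = hilb N s \<and>
       (\<forall>X. X \<subseteq> proj_space N \<and> finite X \<and> card X = s \<and> defining_ideal N X \<in> U \<longrightarrow> P X))"

end

theory Submission
  imports Defs
begin

text \<open>
  Let \<open>k\<close> be maximal with \<open>k\<^sup>N \<le> s\<close> and \<open>M = m + N - 1\<close>, so \<open>k \<ge> 2 m + 2\<close>. Counting conditions bounds the right
  hand side from above: \<open>s (M choose N) < (k M choose N)\<close> yields a form of degree \<open>k M - N\<close> in \<open>I\<^sup>(\<^sup>m\<^sup>)\<close>,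
  hence \<open>(\<alpha>(I\<^sup>(\<^sup>m\<^sup>)) + N - 1) / M \<le> k - 1 / M\<close>.

  For the left hand side suppose that forms of degree \<open>D\<close> interpolate arbitrary jets of order \<open>n\<close> at \<open>r\<close> of
  the points. Taking products, forms of degree \<open>T D\<close> interpolate jets of order \<open>T n\<close> for every \<open>T\<close>. If \<open>F\<close>
  has degree \<open>d\<close> and vanishes to order \<open>q\<close> at these points, then multiplication by \<open>F\<close> maps the forms of
  degree \<open>T D - d\<close> vanishing to order \<open>T n - q\<close> into those of degree \<open>T D\<close> vanishing to order \<open>T n\<close>, whose
  dimension is known. As \<open>T \<rightarrow> \<infinity>\<close> a comparison of dimensions gives \<open>d D\<^sup>N\<^sup>-\<^sup>1 \<ge> q r n\<^sup>N\<^sup>-\<^sup>1\<close>. The \<open>k\<^sup>N\<close> points of a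
  grid have this property with \<open>D = k (n + N)\<close>, so for large \<open>n\<close> one obtains the Waldschmidt constant
  \<open>\<ge> k - 1 / M\<close>.

  For fixed \<open>n\<close> and \<open>D\<close> interpolation is the nonvanishing of one determinant, a multihomogeneous function
  of the points. Its product over all orderings of the points is symmetric; multiplied by a Pluecker coordinate
  it becomes a linear form in the Pluecker coordinates of higher degree, so it defines an open subset of the
  Hilbert scheme. A nonempty open set that contains a set of points meets this open subset in a set of points,
  because nonzero multihomogeneous functions have a common point of nonvanishing. So the closure of the sets of
  points that violate the inequality has empty interior.
\<close>

text \<open>The Waldschmidt constant involves all symbolic powers, and one open condition for each
  of them would only reach very general points. The slack 1 / M removes this obstacle. In the limit
  of large n the grid bound would be k, so some fixed n already gives k - 1 / M, for all symbolic
  powers at once; and for a fixed n interpolation is a single open condition. The lower bound on s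
  enters through k >= 2 m + 2, which is what the comparison of the binomial coefficients (k + 1)^N
  (M choose N) and (k M choose N) requires. Derivatives would fail in positive characteristic, so
  orders of vanishing and jets are read off from coefficients after a linear substitution. For N >=
  3 the Hilbert scheme may be reducible, with components in which sets of distinct points are not
  dense. Therefore only the closure of the bad sets of points is removed: an open set without bad
  sets lies in the complement anyway, and only an open set that meets the bad sets has to be shown
  to contain a good one.\<close>

abbreviation "lookup \<equiv> Poly_Mapping.lookup"
abbreviation "keys \<equiv> Poly_Mapping.keys"
abbreviation "single \<equiv> Poly_Mapping.single"

lemma poly_mapping_sum_single: "f = (\<Sum>t\<in>keys f. single t (lookup f t))"
proof (rule poly_mapping_eqI)
  fix k
  have "lookup (\<Sum>t\<in>keys f. single t (lookup f t)) k = (\<Sum>t\<in>keys f. if t = k then lookup f k else 0)"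
    unfolding lookup_sum by (intro sum.cong) (auto simp: lookup_single)
  also have "\<dots> = lookup f k"
    by (simp add: not_in_keys_iff_lookup_eq_zero)
  finally show "lookup f k = lookup (\<Sum>t\<in>keys f. single t (lookup f t)) k" by simp
qed

lemma keys_sum_subset: "keys (sum f A) \<subseteq> (\<Union>a\<in>A. keys (f a))"
proof (induction A rule: infinite_finite_induct)
  case (insert x F)
  then show ?case using keys_add[of "f x" "sum f F"] by auto
qed auto

lemma keys_times: "t \<in> keys (f * g) \<Longrightarrow> \<exists>a\<in>keys f. \<exists>b\<in>keys g. t = a + b"
  using keys_mult[of f g] by blast

section \<open>Monomials and substitution\<close>

text \<open>The values \<open>g i\<close> are field elements for evaluation, polynomials for
  substitution, and univariate polynomials in \<open>mform_line\<close>.\<close>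

definition mev :: "('v \<Rightarrow> 'a::comm_semiring_1) \<Rightarrow> ('v \<Rightarrow>\<^sub>0 nat) \<Rightarrow> 'a"
  where "mev g t = (\<Prod>i\<in>keys t. g i ^ lookup t i)"

lemma mev_superset:
  assumes "finite A" "keys t \<subseteq> A"
  shows "mev g t = (\<Prod>i\<in>A. g i ^ lookup t i)"
  unfolding mev_def using assms
  by (intro prod.mono_neutral_left) (auto simp: not_in_keys_iff_lookup_eq_zero)

lemma mev_0 [simp]: "mev g 0 = 1"
  by (simp add: mev_def)

lemma mev_add: "mev g (s + t) = mev g s * mev g t"
proof -
  let ?A = "keys s \<union> keys t"
  have "mev g (s + t) = (\<Prod>i\<in>?A. g i ^ lookup (s + t) i)"
    using keys_add[of s t] by (intro mev_superset) auto
  also have "\<dots> = (\<Prod>i\<in>?A. g i ^ lookup s i) * (\<Prod>i\<in>?A. g i ^ lookup t i)"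
    by (simp add: lookup_add power_add prod.distrib)
  also have "\<dots> = mev g s * mev g t"
    by (simp add: mev_superset[of ?A])
  finally show ?thesis .
qed

lemma mev_single [simp]: "mev g (single i e) = g i ^ e"
  by (cases "e = 0") (auto simp: mev_def)

lemma mev_cong: "(\<And>i. i \<in> keys t \<Longrightarrow> g i = h i) \<Longrightarrow> mev g t = mev h t"
  by (auto simp: mev_def intro: prod.cong)

lemma mev_scale: "mev (\<lambda>i. c * v i) t = c ^ mono_deg t * mev v t"
  by (simp add: mev_def mono_deg_def power_mult_distrib prod.distrib power_sum)

text \<open>Evaluation with coefficients transported by \<open>h\<close>. The identity gives
  \<open>mpoly_eval\<close> and the embedding \<open>single 0\<close> of constants gives
  \<open>subst\<close>, so both inherit their laws from \<open>comm_ring_hom\<close>.\<close>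

definition ins :: "('k::comm_ring_1 \<Rightarrow> 'b::comm_ring_1) \<Rightarrow> ('v \<Rightarrow> 'b) \<Rightarrow> ('v, 'k) mpoly \<Rightarrow> 'b"
  where "ins h g f = (\<Sum>t\<in>keys f. h (lookup f t) * mev g t)"

lemma mpoly_eval_ins: "mpoly_eval v = ins (\<lambda>c. c) v"
  by (rule ext) (simp add: mpoly_eval_def ins_def mev_def)

context comm_ring_hom
begin

lemma ins_superset:
  assumes "finite A" "keys f \<subseteq> A"
  shows "ins hom g f = (\<Sum>t\<in>A. hom (lookup f t) * mev g t)"
  unfolding ins_def using assms
  by (intro sum.mono_neutral_left) (auto simp: not_in_keys_iff_lookup_eq_zero)

lemma ins_zero [simp]: "ins hom g 0 = 0"
  by (simp add: ins_def)

lemma ins_single [simp]: "ins hom g (single t c) = hom c * mev g t"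
  by (subst ins_superset[of "{t}"]) auto

lemma ins_one [simp]: "ins hom g 1 = 1"
  using ins_single[of g 0 1] by simp

lemma ins_add: "ins hom g (f + f') = ins hom g f + ins hom g f'"
proof -
  let ?A = "keys f \<union> keys f'"
  have "ins hom g (f + f') = (\<Sum>t\<in>?A. hom (lookup (f + f') t) * mev g t)"
    using keys_add[of f f'] by (intro ins_superset) auto
  also have "\<dots> = ins hom g f + ins hom g f'"
    by (simp add: ins_superset[of ?A] lookup_add hom_add sum.distrib distrib_right)
  finally show ?thesis .
qed

lemma ins_sum: "ins hom g (sum f A) = (\<Sum>a\<in>A. ins hom g (f a))"
  by (induction A rule: infinite_finite_induct) (auto simp: ins_add)

lemma ins_mult: "ins hom g (f * f') = ins hom g f * ins hom g f'"
proof -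
  have "f * f' = (\<Sum>a\<in>keys f. \<Sum>b\<in>keys f'. single a (lookup f a) * single b (lookup f' b))"
    by (subst (1) poly_mapping_sum_single[of f], subst (1) poly_mapping_sum_single[of f'])
      (simp add: sum_product)
  then have "ins hom g (f * f') =
      (\<Sum>a\<in>keys f. \<Sum>b\<in>keys f'. ins hom g (single a (lookup f a) * single b (lookup f' b)))"
    by (simp add: ins_sum)
  also have "\<dots> = (\<Sum>a\<in>keys f. \<Sum>b\<in>keys f'. (hom (lookup f a) * mev g a) * (hom (lookup f' b) * mev g b))"
    by (simp add: mult_single mev_add hom_mult algebra_simps)
  also have "\<dots> = ins hom g f * ins hom g f'"
    by (simp add: ins_def sum_product)
  finally show ?thesis .
qed

lemma ins_prod: "ins hom g (prod f A) = (\<Prod>a\<in>A. ins hom g (f a))"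
  by (induction A rule: infinite_finite_induct) (auto simp: ins_mult)

lemma ins_power: "ins hom g (f ^ n) = ins hom g f ^ n"
  by (induction n) (auto simp: ins_mult)

lemma ins_uminus: "ins hom g (- f) = - ins hom g f"
proof -
  have "ins hom g (- f + f) = ins hom g (- f) + ins hom g f" by (rule ins_add)
  then show ?thesis by (simp add: eq_neg_iff_add_eq_0)
qed

lemma ins_diff: "ins hom g (f - f') = ins hom g f - ins hom g f'"
  using ins_add[of g f "- f'"] by (simp add: ins_uminus)

end

lemma comm_ring_hom_id: "comm_ring_hom (\<lambda>c::'a::comm_ring_1. c)"
  by unfold_locales auto

lemma comm_ring_hom_const:
  "comm_ring_hom (\<lambda>c::'a::comm_ring_1. single (0::'v \<Rightarrow>\<^sub>0 nat) c)"
  by unfold_locales (auto simp: mult_single single_add)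

lemmas mpoly_eval_add = comm_ring_hom.ins_add[OF comm_ring_hom_id, folded mpoly_eval_ins]
  and mpoly_eval_mult = comm_ring_hom.ins_mult[OF comm_ring_hom_id, folded mpoly_eval_ins]
  and mpoly_eval_sum = comm_ring_hom.ins_sum[OF comm_ring_hom_id, folded mpoly_eval_ins]
  and mpoly_eval_prod = comm_ring_hom.ins_prod[OF comm_ring_hom_id, folded mpoly_eval_ins]
  and mpoly_eval_power = comm_ring_hom.ins_power[OF comm_ring_hom_id, folded mpoly_eval_ins]
  and mpoly_eval_diff = comm_ring_hom.ins_diff[OF comm_ring_hom_id, folded mpoly_eval_ins]
  and mpoly_eval_single [simp] = comm_ring_hom.ins_single[OF comm_ring_hom_id, folded mpoly_eval_ins]
  and mpoly_eval_one [simp] = comm_ring_hom.ins_one[OF comm_ring_hom_id, folded mpoly_eval_ins]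
  and mpoly_eval_zero [simp] = comm_ring_hom.ins_zero[OF comm_ring_hom_id, folded mpoly_eval_ins]

lemma mpoly_eval_eq: "mpoly_eval v f = (\<Sum>t\<in>keys f. lookup f t * mev v t)"
  by (simp add: mpoly_eval_def mev_def)

definition subst :: "('v \<Rightarrow> ('w, 'k) mpoly) \<Rightarrow> ('v, 'k::comm_ring_1) mpoly \<Rightarrow> ('w, 'k) mpoly"
  where "subst = ins (single 0)"

lemmas subst_simps = comm_ring_hom.ins_single[OF comm_ring_hom_const, folded subst_def] comm_ring_hom.ins_one[OF comm_ring_hom_const, folded subst_def]
  comm_ring_hom.ins_zero[OF comm_ring_hom_const, folded subst_def]
  and subst_add = comm_ring_hom.ins_add[OF comm_ring_hom_const, folded subst_def]
  and subst_sum = comm_ring_hom.ins_sum[OF comm_ring_hom_const, folded subst_def]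
  and subst_mult = comm_ring_hom.ins_mult[OF comm_ring_hom_const, folded subst_def]
  and subst_prod = comm_ring_hom.ins_prod[OF comm_ring_hom_const, folded subst_def]
  and subst_power = comm_ring_hom.ins_power[OF comm_ring_hom_const, folded subst_def]
  and subst_diff = comm_ring_hom.ins_diff[OF comm_ring_hom_const, folded subst_def]

lemma mpoly_eval_mev: "mpoly_eval v (mev g t) = mev (\<lambda>i. mpoly_eval v (g i)) t"
  by (simp add: mev_def mpoly_eval_prod mpoly_eval_power)

lemma subst_mev: "subst v (mev g t) = mev (\<lambda>i. subst v (g i)) t"
  by (simp add: mev_def subst_prod subst_power)

lemma mpoly_eval_subst: "mpoly_eval v (subst g f) = mpoly_eval (\<lambda>i. mpoly_eval v (g i)) f"
  by (simp add: subst_def ins_def mpoly_eval_sum mpoly_eval_mult mpoly_eval_mev mpoly_eval_eq[of _ f])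

lemma subst_eq: "subst g f = (\<Sum>t\<in>keys f. single 0 (lookup f t) * mev g t)"
  by (simp add: subst_def ins_def)

lemma subst_subst: "subst g' (subst g f) = subst (\<lambda>i. subst g' (g i)) f"
  by (simp add: subst_eq[of _ f] subst_sum subst_mult subst_mev subst_simps)

definition var :: "'v \<Rightarrow> ('v, 'k::comm_ring_1) mpoly"
  where "var i = single (single i 1) 1"

lemma mev_var: "mev var t = single t 1"
proof -
  have "prod (\<lambda>i. var i ^ lookup t i) A = (single (\<Sum>i\<in>A. single i (lookup t i)) 1 :: ('a, 'b) mpoly)"
    if "finite A" for A
    using that
  proof induction
    case (insert x F)
    have "var x ^ n = (single (single x n) 1 :: ('a, 'b) mpoly)" for n
      by (induction n) (auto simp: var_def mult_single simp flip: single_add)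
    with insert show ?case by (simp add: mult_single)
  qed auto
  from this[of "keys t"] show ?thesis
    by (simp add: mev_def flip: poly_mapping_sum_single)
qed

lemma subst_var: "subst var f = f"
  by (subst (2) poly_mapping_sum_single) (simp add: subst_def ins_def mev_var mult_single)

section \<open>Degrees and weights\<close>

lemma in_keys_pos: "0 < lookup t i \<longleftrightarrow> i \<in> keys (t :: 'a \<Rightarrow>\<^sub>0 nat)"
  by (metis in_keys_iff neq0_conv)

text \<open>Common source of \<open>mono_deg\<close> (all weights 1) and \<open>wt\<close> (weight 0
  on x_0).\<close>

definition wdeg :: "('v \<Rightarrow> nat) \<Rightarrow> ('v \<Rightarrow>\<^sub>0 nat) \<Rightarrow> nat"
  where "wdeg u t = (\<Sum>i\<in>keys t. u i * lookup t i)"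

lemma wdeg_superset:
  assumes "finite A" "keys t \<subseteq> A"
  shows "wdeg u t = (\<Sum>i\<in>A. u i * lookup t i)"
  unfolding wdeg_def using assms
  by (intro sum.mono_neutral_left) (auto simp: not_in_keys_iff_lookup_eq_zero)

lemma wdeg_0 [simp]: "wdeg u 0 = 0"
  by (simp add: wdeg_def)

lemma wdeg_add: "wdeg u (s + t) = wdeg u s + wdeg u t"
proof -
  let ?A = "keys s \<union> keys t"
  have "wdeg u (s + t) = (\<Sum>i\<in>?A. u i * lookup (s + t) i)"
    using keys_add[of s t] by (intro wdeg_superset) auto
  then show ?thesis
    by (simp add: lookup_add distrib_left sum.distrib wdeg_superset[of ?A])
qed

lemma wdeg_single [simp]: "wdeg u (single i e) = u i * e"
  by (cases "e = 0") (auto simp: wdeg_def)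

lemma mono_deg_wdeg: "mono_deg = wdeg (\<lambda>_. 1)"
  by (auto simp: fun_eq_iff mono_deg_def wdeg_def)

lemma mono_deg_add: "mono_deg (s + t) = mono_deg s + mono_deg t"
  and mono_deg_0 [simp]: "mono_deg 0 = 0"
  and mono_deg_single [simp]: "mono_deg (single i e) = e"
  by (simp_all add: mono_deg_wdeg wdeg_add)

definition wt :: "nat monomial \<Rightarrow> nat"
  where "wt = wdeg (\<lambda>i. if i = 0 then 0 else 1)"

lemma wt_add: "wt (s + t) = wt s + wt t"
  and wt_0 [simp]: "wt 0 = 0"
  and wt_single [simp]: "wt (single i e) = (if i = 0 then 0 else e)"
  by (simp_all add: wt_def wdeg_add)

lemma mono_deg_wt: "mono_deg t = lookup t 0 + wt t"
proof -
  let ?A = "insert 0 (keys t)"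
  have "mono_deg t = (\<Sum>i\<in>?A. 1 * lookup t i)" "wt t = (\<Sum>i\<in>?A. (if i = 0 then 0 else 1) * lookup t i)"
    unfolding mono_deg_wdeg wt_def by (rule wdeg_superset; auto)+
  moreover have "(\<Sum>i\<in>?A. 1 * lookup t i) =
      (\<Sum>i\<in>?A. (if i = 0 then lookup t 0 else 0) + (if i = 0 then 0 else 1) * lookup t i)"
    by (intro sum.cong) auto
  moreover have "(\<Sum>i\<in>?A. if i = 0 then lookup t 0 else 0) = lookup t 0"
    by simp
  ultimately show ?thesis by (metis (no_types) sum.distrib)
qed

lemma wt_0_iff: "wt t = 0 \<longleftrightarrow> t = single 0 (mono_deg t)"
proof
  assume "wt t = 0"
  then have *: "lookup t i = 0" if "i \<noteq> 0" for i
    using that not_in_keys_iff_lookup_eq_zero[of i t]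
    by (force simp: wt_def wdeg_def)
  have "mono_deg t = lookup t 0"
    using \<open>wt t = 0\<close> by (simp add: mono_deg_wt)
  with * show "t = single 0 (mono_deg t)"
    by (intro poly_mapping_eqI) (auto simp: lookup_single when_def)
next
  assume "t = single 0 (mono_deg t)"
  then obtain n where "t = single 0 n" by (rule that)
  then show "wt t = 0" by simp
qed

lemma wt_pos_obtain:
  assumes "wt t > 0"
  obtains i where "i \<in> keys t" "i \<noteq> 0"
proof -
  have "\<exists>i\<in>keys t. i \<noteq> 0"
  proof (rule ccontr)
    assume "\<not> (\<exists>i\<in>keys t. i \<noteq> 0)"
    then have "wt t = 0" by (simp add: wt_def wdeg_def)
    with assms show False by simp
  qed
  with that show thesis by blast
qed

text \<open>Membership in the q-th power of the ideal generated by all variables except x_0, that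
  is, vanishing to order \<open>q\<close> at (1, 0, ..., 0). No derivatives occur, so this is the
  right notion in every characteristic.\<close>

definition ordw :: "nat \<Rightarrow> (nat, 'k::zero) mpoly \<Rightarrow> bool"
  where "ordw q f \<longleftrightarrow> (\<forall>t\<in>keys f. q \<le> wt t)"

lemma ordw_zero [simp]: "ordw q 0"
  by (simp add: ordw_def)

lemma ordw_0 [simp]: "ordw 0 f"
  by (simp add: ordw_def)

lemma ordw_mono: "ordw q f \<Longrightarrow> p \<le> q \<Longrightarrow> ordw p f"
  by (force simp: ordw_def)

lemma ordw_add: "ordw q f \<Longrightarrow> ordw q g \<Longrightarrow> ordw q (f + g)"
  using keys_add[of f g] by (auto simp: ordw_def)

lemma ordw_uminus: "ordw q f \<Longrightarrow> ordw q (- f :: (nat, 'k::ab_group_add) mpoly)"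
  by (auto simp: ordw_def in_keys_iff)

lemma ordw_diff: "ordw q f \<Longrightarrow> ordw q g \<Longrightarrow> ordw q (f - g :: (nat, 'k::ab_group_add) mpoly)"
  using ordw_add[of q f "- g"] ordw_uminus[of q g] by simp

lemma ordw_mult:
  fixes f g :: "(nat, 'k::comm_ring_1) mpoly"
  shows "ordw p f \<Longrightarrow> ordw q g \<Longrightarrow> ordw (p + q) (f * g)"
  unfolding ordw_def by (auto dest!: keys_times simp: wt_add intro!: add_mono)

lemma ordw_mult_right: "ordw q g \<Longrightarrow> ordw q (f * g :: (nat, 'k::comm_ring_1) mpoly)"
  using ordw_mult[of 0 f q g] by simp

lemma ordw_single: "ordw q (single t c) \<longleftrightarrow> c = 0 \<or> q \<le> wt t"
  by (auto simp: ordw_def)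

lemma poly_mapping_split:
  fixes f :: "'a \<Rightarrow>\<^sub>0 'b::ab_group_add"
  obtains g h where "f = g + h" "keys g = {t \<in> keys f. P t}" "keys h = {t \<in> keys f. \<not> P t}"
proof -
  have *: "keys (\<Sum>t\<in>{t \<in> keys f. Q t}. single t (lookup f t)) = {t \<in> keys f. Q t}" for Q
  proof -
    have "lookup (\<Sum>t\<in>{t \<in> keys f. Q t}. single t (lookup f t)) k = (if k \<in> keys f \<and> Q k then lookup f k else 0)" for k
    proof -
      have "lookup (\<Sum>t\<in>{t \<in> keys f. Q t}. single t (lookup f t)) k =
          (\<Sum>t\<in>{t \<in> keys f. Q t}. if t = k then lookup f k else 0)"
        unfolding lookup_sum by (intro sum.cong) (auto simp: lookup_single)
      then show ?thesis by simp
    qed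
    then show ?thesis by (auto simp: in_keys_iff split: if_splits)
  qed
  have K: "keys f = {t \<in> keys f. P t} \<union> {t \<in> keys f. \<not> P t}" by blast
  have "f = (\<Sum>t\<in>{t \<in> keys f. P t} \<union> {t \<in> keys f. \<not> P t}. single t (lookup f t))"
    unfolding K[symmetric] by (rule poly_mapping_sum_single)
  also have "\<dots> = (\<Sum>t\<in>{t \<in> keys f. P t}. single t (lookup f t)) + (\<Sum>t\<in>{t \<in> keys f. \<not> P t}. single t (lookup f t))"
    by (rule sum.union_disjoint) auto
  finally show thesis by (rule that[OF _ * *])
qed

text \<open>The parts of lowest weight multiply to the part of lowest weight of the product.\<close>

lemma ordw_cancel:
  fixes u f :: "(nat, 'k::idom) mpoly"
  assumes "ordw q (u * f)" "\<not> ordw 1 u"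
  shows "ordw q f"
proof (rule ccontr)
  assume "\<not> ordw q f"
  then have ex: "\<exists>n. \<exists>t\<in>keys f. wt t = n" and ex': "\<exists>t\<in>keys f. wt t < q"
    by (force simp: ordw_def)+
  define a where "a = (LEAST n. \<exists>t\<in>keys f. wt t = n)"
  have a: "\<exists>t\<in>keys f. wt t = a"
    unfolding a_def by (rule LeastI_ex[OF ex])
  have a_le: "a \<le> wt t" if "t \<in> keys f" for t
    unfolding a_def by (rule Least_le) (use that in auto)
  have "a < q" using ex' a_le by force
  obtain u0 u1 where u: "u = u0 + u1" "keys u0 = {t \<in> keys u. wt t = 0}" "keys u1 = {t \<in> keys u. wt t \<noteq> 0}"
    using poly_mapping_split[of u "\<lambda>t. wt t = 0"] by blast
  obtain f0 f1 where f: "f = f0 + f1" "keys f0 = {t \<in> keys f. wt t = a}" "keys f1 = {t \<in> keys f. wt t \<noteq> a}"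
    using poly_mapping_split[of f "\<lambda>t. wt t = a"] by blast
  have "u0 \<noteq> 0" using assms(2) u(2) by (force simp: ordw_def)
  moreover have "f0 \<noteq> 0" using a f(2) by auto
  ultimately have nz: "u0 * f0 \<noteq> 0" by simp
  have "ordw (Suc a) f1" "ordw 1 u1" "ordw a f"
    using f(3) u(3) a_le by (force simp: ordw_def)+
  \<comment> \<open>All terms on the right have order above \<open>a\<close>, whereas the nonzero
    left side has only terms of weight \<open>a\<close>.\<close>
  have eq: "u0 * f0 = u * f - (u0 * f1 + u1 * f)"
    using u(1) f(1) by (simp add: algebra_simps)
  have "ordw (Suc a) (u0 * f0)"
    unfolding eq
  proof (intro ordw_diff ordw_add)
    show "ordw (Suc a) (u * f)" using assms(1) \<open>a < q\<close> by (auto intro: ordw_mono)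
    show "ordw (Suc a) (u0 * f1)" by (rule ordw_mult_right) fact
    show "ordw (Suc a) (u1 * f)" using ordw_mult[OF \<open>ordw 1 u1\<close> \<open>ordw a f\<close>] by simp
  qed
  moreover obtain t where t: "t \<in> keys (u0 * f0)" using nz by force
  moreover have "wt t = a" using keys_times[OF t] u(2) f(2) by (auto simp: wt_add)
  ultimately show False by (force simp: ordw_def)
qed

section \<open>Homogeneous polynomials\<close>

lemma homogeneous_zero [simp]: "homogeneous d 0"
  by (simp add: homogeneous_def)

lemma homogeneous_add: "homogeneous d f \<Longrightarrow> homogeneous d g \<Longrightarrow> homogeneous d (f + g)"
  using keys_add[of f g] by (auto simp: homogeneous_def)

lemma homogeneous_sum: "(\<And>a. a \<in> A \<Longrightarrow> homogeneous d (f a)) \<Longrightarrow> homogeneous d (sum f A)"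
  by (induction A rule: infinite_finite_induct) (auto intro: homogeneous_add)

lemma homogeneous_uminus: "homogeneous d f \<Longrightarrow> homogeneous d (- f :: ('v, 'k::ab_group_add) mpoly)"
  by (auto simp: homogeneous_def in_keys_iff)

lemma homogeneous_diff:
  "homogeneous d f \<Longrightarrow> homogeneous d g \<Longrightarrow> homogeneous d (f - g :: ('v, 'k::ab_group_add) mpoly)"
  using homogeneous_add[of d f "- g"] homogeneous_uminus[of d g] by simp

lemma homogeneous_mult:
  fixes f g :: "('v, 'k::comm_ring_1) mpoly"
  shows "homogeneous d f \<Longrightarrow> homogeneous e g \<Longrightarrow> homogeneous (d + e) (f * g)"
  unfolding homogeneous_def by (auto dest!: keys_times simp: mono_deg_add)

lemma homogeneous_single: "homogeneous d (single t c) \<longleftrightarrow> c = 0 \<or> mono_deg t = d"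
  by (auto simp: homogeneous_def)

lemma homogeneous_const_mult: "homogeneous d f \<Longrightarrow> homogeneous d (single 0 c * f :: ('v, 'k::comm_ring_1) mpoly)"
  using homogeneous_mult[of 0 "single 0 c" d f] by (simp add: homogeneous_single)

lemma homogeneous_one: "homogeneous 0 (1 :: ('v, 'k::comm_ring_1) mpoly)"
  by (simp add: homogeneous_def)

lemma homogeneous_power:
  "homogeneous d (f :: ('v, 'k::comm_ring_1) mpoly) \<Longrightarrow> homogeneous (n * d) (f ^ n)"
  by (induction n) (auto simp: homogeneous_one intro: homogeneous_mult)

lemma homogeneous_prod:
  "(\<And>a. a \<in> A \<Longrightarrow> homogeneous (d a) (f a :: ('v, 'k::comm_ring_1) mpoly)) \<Longrightarrow>
    homogeneous (sum d A) (prod f A)"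
  by (induction A rule: infinite_finite_induct) (auto simp: homogeneous_one intro: homogeneous_mult)

lemma homogeneous_mev:
  fixes g :: "'v \<Rightarrow> ('w, 'k::comm_ring_1) mpoly"
  assumes "\<And>i. i \<in> keys t \<Longrightarrow> homogeneous 1 (g i)"
  shows "homogeneous (mono_deg t) (mev g t)"
  unfolding mev_def mono_deg_def
  by (rule homogeneous_prod) (use homogeneous_power[OF assms] in auto)

lemma mpoly_eval_scale: "homogeneous d f \<Longrightarrow> mpoly_eval (\<lambda>i. c * v i) f = c ^ d * mpoly_eval v f"
  unfolding mpoly_eval_eq sum_distrib_left
  by (intro sum.cong) (auto simp: mev_scale homogeneous_def)

section \<open>The coordinate ring and its forms\<close>

abbreviation carr :: "nat \<Rightarrow> (nat, 'k::comm_ring_1) mpoly set"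
  where "carr N \<equiv> carrier (coord_ring N)"

lemma carr_iff: "f \<in> carr N \<longleftrightarrow> (\<forall>t\<in>keys f. keys t \<subseteq> {..N})"
  by (simp add: mpoly_ring_def)

lemma carr_zero [simp]: "0 \<in> carr N"
  and carr_one [simp]: "1 \<in> carr N"
  by (simp_all add: carr_iff)

lemma carr_add: "f \<in> carr N \<Longrightarrow> g \<in> carr N \<Longrightarrow> f + g \<in> carr N"
  using keys_add[of f g] by (auto simp: carr_iff)

lemma carr_sum: "(\<And>a. a \<in> A \<Longrightarrow> f a \<in> carr N) \<Longrightarrow> sum f A \<in> carr N"
  by (induction A rule: infinite_finite_induct) (auto intro: carr_add)

lemma carr_uminus: "f \<in> carr N \<Longrightarrow> - f \<in> carr N"
  by (auto simp: carr_iff in_keys_iff)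

lemma carr_diff: "f \<in> carr N \<Longrightarrow> g \<in> carr N \<Longrightarrow> f - g \<in> carr N"
  using carr_add[of f N "- g"] carr_uminus[of g N] by simp

lemma carr_mult: "f \<in> carr N \<Longrightarrow> g \<in> carr N \<Longrightarrow> f * g \<in> carr N"
  unfolding carr_iff
proof
  fix t assume f: "\<forall>t\<in>keys f. keys t \<subseteq> {..N}" and g: "\<forall>t\<in>keys g. keys t \<subseteq> {..N}" and "t \<in> keys (f * g)"
  then obtain a b where "a \<in> keys f" "b \<in> keys g" "t = a + b" by (blast dest: keys_times)
  then show "keys t \<subseteq> {..N}" using f g keys_add[of a b] by blast
qed

lemma carr_prod: "(\<And>a. a \<in> A \<Longrightarrow> f a \<in> carr N) \<Longrightarrow> prod f A \<in> carr N"
  by (induction A rule: infinite_finite_induct) (auto intro: carr_mult)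

lemma carr_power: "f \<in> carr N \<Longrightarrow> f ^ n \<in> carr N"
  by (induction n) (auto intro: carr_mult)

lemma carr_single: "single t c \<in> carr N \<longleftrightarrow> c = 0 \<or> keys t \<subseteq> {..N}"
  by (auto simp: carr_iff)

lemma carr_const [simp]: "single 0 c \<in> carr N"
  by (simp add: carr_single)

lemma carr_var: "i \<le> N \<Longrightarrow> var i \<in> carr N"
  by (simp add: carr_single var_def)

lemma carr_mev: "(\<And>i. i \<in> keys t \<Longrightarrow> g i \<in> carr N) \<Longrightarrow> mev g t \<in> carr N"
  unfolding mev_def by (intro carr_prod carr_power)

abbreviation forms :: "nat \<Rightarrow> nat \<Rightarrow> (nat, 'k::comm_ring_1) mpoly set"
  where "forms N d \<equiv> graded_part (carr N) d"

lemma forms_iff: "f \<in> forms N d \<longleftrightarrow> f \<in> carr N \<and> homogeneous d f"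
  by (simp add: graded_part_def)

lemma forms_iff_keys: "f \<in> forms N d \<longleftrightarrow> keys f \<subseteq> monomials N d"
  by (auto simp: graded_part_def carr_iff homogeneous_def monomials_def)

lemma forms_zero [simp]: "0 \<in> forms N d"
  by (simp add: forms_iff)

lemma forms_add: "f \<in> forms N d \<Longrightarrow> g \<in> forms N d \<Longrightarrow> f + g \<in> forms N d"
  by (simp add: forms_iff carr_add homogeneous_add)

lemma forms_diff: "f \<in> forms N d \<Longrightarrow> g \<in> forms N d \<Longrightarrow> f - g \<in> forms N d"
  by (simp add: forms_iff carr_diff homogeneous_diff)

lemma forms_sum: "(\<And>a. a \<in> A \<Longrightarrow> f a \<in> forms N d) \<Longrightarrow> sum f A \<in> forms N d"
  by (simp add: forms_iff carr_sum homogeneous_sum)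

lemma forms_mult: "f \<in> forms N d \<Longrightarrow> g \<in> forms N e \<Longrightarrow> f * g \<in> forms N (d + e)"
  by (simp add: forms_iff carr_mult homogeneous_mult)

lemma forms_const_mult: "f \<in> forms N d \<Longrightarrow> single 0 c * f \<in> forms N d"
  by (simp add: forms_iff carr_mult homogeneous_const_mult)

lemma forms_prod: "(\<And>a. a \<in> A \<Longrightarrow> f a \<in> forms N (d a)) \<Longrightarrow> prod f A \<in> forms N (sum d A)"
  by (simp add: forms_iff carr_prod homogeneous_prod)

lemma forms_power: "f \<in> forms N d \<Longrightarrow> f ^ n \<in> forms N (n * d)"
  by (simp add: forms_iff carr_power homogeneous_power)

lemma forms_var: "i \<le> N \<Longrightarrow> var i \<in> forms N 1"
  by (simp add: forms_iff carr_var) (simp add: var_def homogeneous_single)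

lemma forms_single: "t \<in> monomials N d \<Longrightarrow> single t c \<in> forms N d"
  by (auto simp: forms_iff_keys)

lemma lookup_const_mult: "lookup (single 0 c * f) t = c * lookup (f :: ('v, 'k::comm_ring_1) mpoly) t"
proof -
  have "single 0 c * f = (\<Sum>t\<in>keys f. single t (c * lookup f t))"
    by (subst poly_mapping_sum_single[of f]) (simp add: sum_distrib_left mult_single)
  then have "lookup (single 0 c * f) t = (\<Sum>a\<in>keys f. if a = t then c * lookup f t else 0)"
    by (auto simp: lookup_sum lookup_single when_def intro!: sum.cong)
  then show ?thesis by (simp add: not_in_keys_iff_lookup_eq_zero)
qed

section \<open>Taylor expansion along the line through a point\<close>

text \<open>
  The substitution \<open>x\<^sub>0 \<mapsto> v\<^sub>0 x\<^sub>0\<close>, \<open>x\<^sub>i \<mapsto> x\<^sub>i + v\<^sub>i x\<^sub>0\<close> moves the point \<open>(1, 0, \<dots>, 0)\<close> to \<open>v\<close>. So for \<open>v\<^sub>0 \<noteq> 0\<close> the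
  condition \<open>ordw q (tay v f)\<close> says that \<open>f\<close> vanishes to order \<open>q\<close> along the line through \<open>v\<close>.
\<close>

definition tay_gen :: "(nat \<Rightarrow> 'k) \<Rightarrow> nat \<Rightarrow> (nat, 'k::comm_ring_1) mpoly"
  where "tay_gen v i = single (single 0 1) (v i) + (if i = 0 then 0 else var i)"

definition tay :: "(nat \<Rightarrow> 'k) \<Rightarrow> (nat, 'k::comm_ring_1) mpoly \<Rightarrow> (nat, 'k) mpoly"
  where "tay v = subst (tay_gen v)"

lemma tay_add: "tay v (f + g) = tay v f + tay v g"
  and tay_diff: "tay v (f - g) = tay v f - tay v g"
  and tay_mult: "tay v (f * g) = tay v f * tay v g"
  and tay_sum: "tay v (sum h A) = (\<Sum>a\<in>A. tay v (h a))"
  and tay_prod: "tay v (prod h A) = (\<Prod>a\<in>A. tay v (h a))"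
  and tay_power: "tay v (f ^ n) = tay v f ^ n"
  and tay_0 [simp]: "tay v 0 = 0"
  and tay_1 [simp]: "tay v 1 = 1"
  and tay_const [simp]: "tay v (single 0 c) = single 0 c"
  by (simp_all add: tay_def subst_add subst_diff subst_mult subst_sum subst_prod subst_power subst_simps)

lemma tay_single: "tay v (single t c) = single 0 c * mev (tay_gen v) t"
  by (simp add: tay_def subst_simps)

lemma tay_var: "tay v (var i) = tay_gen v i"
  by (simp add: tay_single var_def)

lemma tay_gen_forms:
  assumes "i \<le> N"
  shows "tay_gen v i \<in> forms N 1"
proof -
  have "single (single 0 1) (v i) \<in> forms N 1"
    by (rule forms_single) (simp add: monomials_def)
  then show ?thesis
    unfolding tay_gen_def using forms_var[OF assms] by (auto intro: forms_add simp del: One_nat_def)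
qed

lemma tay_carr:
  assumes "f \<in> carr N"
  shows "tay v f \<in> carr N"
proof -
  have "tay_gen v i \<in> carr N" if "t \<in> keys f" "i \<in> keys t" for t i
    using that assms tay_gen_forms[of i N v] by (auto simp: carr_iff[of f] forms_iff)
  then show ?thesis
    unfolding tay_def subst_eq by (intro carr_sum carr_mult carr_mev) auto
qed

lemma homogeneous_tay_gen: "homogeneous 1 (tay_gen v i)"
  by (auto simp: tay_gen_def var_def homogeneous_single intro!: homogeneous_add)

lemma homogeneous_tay: "homogeneous d f \<Longrightarrow> homogeneous d (tay v f)"
  unfolding tay_def subst_eq homogeneous_def[of d f]
  by (intro homogeneous_sum homogeneous_const_mult)
    (metis homogeneous_mev homogeneous_tay_gen)

lemma tay_forms: "f \<in> forms N d \<Longrightarrow> tay v f \<in> forms N d"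
  by (simp add: forms_iff tay_carr homogeneous_tay)

text \<open>Putting x_0 = 1 and all other variables 0 into \<open>tay v f\<close> evaluates
  \<open>f\<close> at \<open>v\<close>; of a form it keeps only the coefficient of the power of
  x_0.\<close>

lemma lookup_tay_0:
  assumes "homogeneous d f"
  shows "lookup (tay v f) (single 0 d) = mpoly_eval v f"
proof -
  let ?e = "\<lambda>i::nat. if i = 0 then 1 else (0 :: 'a)"
  have mev: "mev ?e t = (if wt t = 0 then 1 else 0)" for t
  proof (cases "wt t = 0")
    case True
    obtain n where "t = single 0 n" by (rule that[OF iffD1[OF wt_0_iff True]])
    then show ?thesis by simp
  next
    case False
    then have "wt t > 0" by simp
    then obtain i where "i \<in> keys t" "i \<noteq> 0" by (rule wt_pos_obtain)
    then obtain n where n: "lookup t i = Suc n" by (metis in_keys_iff not0_implies_Suc)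
    then have "?e i ^ lookup t i = 0" using \<open>i \<noteq> 0\<close> by simp
    then have "mev ?e t = 0"
      unfolding mev_def by (intro prod_zero finite_keys bexI[OF _ \<open>i \<in> keys t\<close>])
    then show ?thesis using False by (simp only: if_False)
  qed
  have "mpoly_eval v f = mpoly_eval (\<lambda>i. mpoly_eval ?e (tay_gen v i)) f"
    by (intro arg_cong2[where f = mpoly_eval]) (auto simp: tay_gen_def mpoly_eval_add var_def fun_eq_iff)
  also have "\<dots> = mpoly_eval ?e (tay v f)"
    by (simp add: tay_def mpoly_eval_subst)
  also have "\<dots> = (\<Sum>t\<in>keys (tay v f). if t = single 0 d then lookup (tay v f) (single 0 d) else 0)"
    unfolding mpoly_eval_eq mev
    using homogeneous_tay[OF assms, of v]
    by (intro sum.cong) (auto simp: homogeneous_def wt_0_iff)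
  also have "\<dots> = lookup (tay v f) (single 0 d)"
    by (simp add: not_in_keys_iff_lookup_eq_zero)
  finally show ?thesis by simp
qed

lemma ordw_1_tay:
  assumes "homogeneous d f"
  shows "ordw 1 (tay v f) \<longleftrightarrow> mpoly_eval v f = 0"
proof
  assume "ordw 1 (tay v f)"
  then have "single 0 d \<notin> keys (tay v f)" by (force simp: ordw_def)
  then show "mpoly_eval v f = 0"
    using lookup_tay_0[OF assms, of v] by (simp add: in_keys_iff)
next
  assume "mpoly_eval v f = 0"
  then have 0: "single 0 d \<notin> keys (tay v f)"
    using lookup_tay_0[OF assms, of v] by (simp add: not_in_keys_iff_lookup_eq_zero)
  show "ordw 1 (tay v f)"
    unfolding ordw_def
  proof
    fix t assume t: "t \<in> keys (tay v f)"
    then have "mono_deg t = d" using homogeneous_tay[OF assms] by (auto simp: homogeneous_def)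
    then have "wt t \<noteq> 0" using t 0 wt_0_iff[of t] by auto
    then show "1 \<le> wt t" by simp
  qed
qed

section \<open>Ideals and localizations of the coordinate ring\<close>

lemma (in cring) ideal_of_closed:
  assumes sub: "K \<subseteq> carrier R" and zero: "\<zero> \<in> K"
    and add: "\<And>a b. a \<in> K \<Longrightarrow> b \<in> K \<Longrightarrow> a \<oplus> b \<in> K"
    and mult: "\<And>r a. r \<in> carrier R \<Longrightarrow> a \<in> K \<Longrightarrow> r \<otimes> a \<in> K"
  shows "ideal K R"
proof (rule idealI)
  show "ring R" by (rule ring_axioms)
  have "\<ominus> x \<in> K" if "x \<in> K" for x
    using mult[of "\<ominus> \<one>" x] that sub by (auto simp: l_minus)
  then show "subgroup K (add_monoid R)"
    unfolding subgroup_def using assms(1,2,3) by (auto simp: a_inv_def)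
  show "x \<otimes> a \<in> K" "a \<otimes> x \<in> K" if "a \<in> K" "x \<in> carrier R" for a x
    using mult[OF that(2,1)] that sub m_comm[of a x] by auto
qed

lemma coord_ring_simps [simp]:
  "f \<otimes>\<^bsub>coord_ring N\<^esub> g = f * g" "f \<oplus>\<^bsub>coord_ring N\<^esub> g = f + g"
  "\<one>\<^bsub>coord_ring N\<^esub> = 1" "\<zero>\<^bsub>coord_ring N\<^esub> = 0"
  by (simp_all add: mpoly_ring_def)

lemma cring_coord_ring: "cring (coord_ring N :: (nat, 'k::comm_ring_1) mpoly ring)"
proof (rule cringI)
  show "abelian_group (coord_ring N :: (nat, 'k) mpoly ring)"
  proof (rule abelian_groupI)
    fix f :: "(nat, 'k) mpoly"
    assume "f \<in> carr N"
    then show "\<exists>g\<in>carr N. g \<oplus>\<^bsub>coord_ring N\<^esub> f = \<zero>\<^bsub>coord_ring N\<^esub>"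
      by (intro bexI[of _ "- f"]) (simp_all add: carr_uminus)
  qed (simp_all add: carr_add add.assoc add.commute)
  show "comm_monoid (coord_ring N :: (nat, 'k) mpoly ring)"
    by (rule comm_monoidI) (simp_all add: carr_mult mult.assoc mult.commute)
qed (simp add: distrib_right)

lemma coord_ideal_of_closed:
  assumes "K \<subseteq> carr N" "0 \<in> K"
    and "\<And>a b. a \<in> K \<Longrightarrow> b \<in> K \<Longrightarrow> a + b \<in> K"
    and "\<And>r a. r \<in> carr N \<Longrightarrow> a \<in> K \<Longrightarrow> r * a \<in> K"
  shows "ideal K (coord_ring N)"
  using cring.ideal_of_closed[OF cring_coord_ring, of K N] assms by simp

lemma coord_ideal_closed:
  assumes "ideal K (coord_ring N)"
  shows "K \<subseteq> carr N" "0 \<in> K"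
    and "a \<in> K \<Longrightarrow> b \<in> K \<Longrightarrow> a + b \<in> K"
    and "r \<in> carr N \<Longrightarrow> a \<in> K \<Longrightarrow> r * a \<in> K"
    and "r \<in> carr N \<Longrightarrow> a \<in> K \<Longrightarrow> a * r \<in> K"
proof -
  interpret ideal K "coord_ring N" by (rule assms)
  show "K \<subseteq> carr N" "0 \<in> K"
    using a_subset additive_subgroup.zero_closed[OF additive_subgroup_axioms] by auto
  show "a \<in> K \<Longrightarrow> b \<in> K \<Longrightarrow> a + b \<in> K"
    using additive_subgroup.a_closed[OF additive_subgroup_axioms, of a b] by simp
  show "r \<in> carr N \<Longrightarrow> a \<in> K \<Longrightarrow> r * a \<in> K" using I_l_closed[of a r] by simp
  show "r \<in> carr N \<Longrightarrow> a \<in> K \<Longrightarrow> a * r \<in> K" using I_r_closed[of a r] by simp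
qed

lemma coord_ideal_sum:
  assumes "ideal K (coord_ring N)" "\<And>a. a \<in> A \<Longrightarrow> f a \<in> K"
  shows "sum f A \<in> K"
  using assms(2) by (induction A rule: infinite_finite_induct) (auto intro: coord_ideal_closed[OF assms(1)])

section \<open>Localization at a prime of the coordinate ring\<close>

definition den :: "nat \<Rightarrow> (nat, 'k::comm_ring_1) mpoly set \<Rightarrow> (nat, 'k) mpoly set"
  where "den N p = carr N - p"

declare carr_mult [simp] carr_add [simp] carr_uminus [simp]

context
  fixes N :: nat and p :: "(nat, 'k::field) mpoly set"
  assumes prime: "primeideal p (coord_ring N)"
begin

lemma prime_ideal: "ideal p (coord_ring N)"
  using prime by (rule primeideal.axioms)

lemma one_notin_prime: "1 \<notin> p"
  using ideal.one_imp_carrier[OF prime_ideal] primeideal.I_notcarr[OF prime] by auto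

lemma den_carr [simp]: "a \<in> den N p \<Longrightarrow> a \<in> carr N"
  by (simp add: den_def)

lemma den_mult [simp]: "a \<in> den N p \<Longrightarrow> b \<in> den N p \<Longrightarrow> a * b \<in> den N p"
  using primeideal.I_prime[OF prime, of a b] by (auto simp: den_def)

lemma den_one [simp]: "1 \<in> den N p"
  using one_notin_prime by (simp add: den_def)

lemma den_nonzero: "a \<in> den N p \<Longrightarrow> a \<noteq> 0"
  using coord_ideal_closed(2)[OF prime_ideal] by (auto simp: den_def)

text \<open>The coordinate ring is a domain and elements outside \<open>p\<close> are nonzero, so
  the auxiliary factor \<open>u\<close> of \<open>frac_rel\<close> cancels.\<close>

lemma frac_rel_iff:
  "((a, s), (b, t)) \<in> frac_rel (coord_ring N) p \<longleftrightarrow>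
    a \<in> carr N \<and> b \<in> carr N \<and> s \<in> den N p \<and> t \<in> den N p \<and> a * t = b * s"
proof -
  have "(\<exists>u\<in>den N p. u * (a * t) = u * (b * s)) \<longleftrightarrow> a * t = b * s"
    using den_one den_nonzero mult_left_cancel by metis
  then show ?thesis unfolding frac_rel_def den_def[symmetric] by simp
qed

abbreviation "frc \<equiv> fraction (coord_ring N) p"
abbreviation "loc \<equiv> localization (coord_ring N) p"

lemma mem_fraction:
  assumes "a \<in> carr N" "s \<in> den N p"
  shows "X \<in> frc a s \<longleftrightarrow> (\<exists>b\<in>carr N. \<exists>t\<in>den N p. X = (b, t) \<and> a * t = b * s)"
  using assms unfolding fraction_def by (cases X) (auto simp: frac_rel_iff)

lemma fraction_eq_iff:
  assumes "a \<in> carr N" "s \<in> den N p" "b \<in> carr N" "t \<in> den N p"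
  shows "frc a s = frc b t \<longleftrightarrow> a * t = b * s"
proof
  assume eq: "frc a s = frc b t"
  have "(b, t) \<in> frc a s" unfolding eq using assms by (auto simp: mem_fraction)
  then show "a * t = b * s" using assms by (auto simp: mem_fraction)
next
  assume eq: "a * t = b * s"
  have *: "frc a s \<subseteq> frc b t"
    if *: "a \<in> carr N" "s \<in> den N p" "b \<in> carr N" "t \<in> den N p" "a * t = b * s" for a s b t
  proof
    fix X assume "X \<in> frc a s"
    then obtain c u where X: "c \<in> carr N" "u \<in> den N p" "X = (c, u)" "a * u = c * s"
      using * by (auto simp: mem_fraction)
    have "s * (b * u) = (b * s) * u" by (simp only: ac_simps)
    also have "\<dots> = (a * u) * t" unfolding *(5)[symmetric] by (simp only: ac_simps)
    also have "\<dots> = s * (c * t)" unfolding X(4) by (simp only: ac_simps)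
    finally have "s * (b * u) = s * (c * t)" .
    then have "b * u = c * t" using den_nonzero[OF *(2)] by simp
    then show "X \<in> frc b t" using X * by (auto simp: mem_fraction)
  qed
  show "frc a s = frc b t"
    using *[OF assms eq] *[OF assms(3,4,1,2) eq[symmetric]] by blast
qed

lemma carrier_loc: "carrier loc = {frc a s | a s. a \<in> carr N \<and> s \<in> den N p}"
  unfolding localization_def fraction_def quotient_def den_def by auto

lemma frc_carrier: "a \<in> carr N \<Longrightarrow> s \<in> den N p \<Longrightarrow> frc a s \<in> carrier loc"
  unfolding carrier_loc by blast

text \<open>The operations of \<open>localization\<close> are unions over all representatives. Such
  a union is a single class as soon as the class of the result does not depend on the
  representatives.\<close>

lemma UN_fraction:
  assumes "a \<in> carr N" "s \<in> den N p" "b \<in> carr N" "t \<in> den N p"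
    and "\<And>a' s' b' t'. a' \<in> carr N \<Longrightarrow> s' \<in> den N p \<Longrightarrow> b' \<in> carr N \<Longrightarrow> t' \<in> den N p \<Longrightarrow>
      a * s' = a' * s \<Longrightarrow> b * t' = b' * t \<Longrightarrow> h a' s' b' t' = Z"
  shows "(\<Union>(a', s')\<in>frc a s. \<Union>(b', t')\<in>frc b t. h a' s' b' t') = Z"
proof -
  have in_frc: "(a, s) \<in> frc a s" "(b, t) \<in> frc b t"
    using assms(1-4) by (auto simp: mem_fraction)
  have "h a' s' b' t' = Z" if "(a', s') \<in> frc a s" "(b', t') \<in> frc b t" for a' s' b' t'
    using that assms by (auto simp: mem_fraction)
  then show ?thesis using in_frc by fast
qed

lemma loc_mult:
  assumes "a \<in> carr N" "s \<in> den N p" "b \<in> carr N" "t \<in> den N p"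
  shows "frc a s \<otimes>\<^bsub>loc\<^esub> frc b t = frc (a * b) (s * t)"
proof -
  have "frc a s \<otimes>\<^bsub>loc\<^esub> frc b t = (\<Union>(a', s')\<in>frc a s. \<Union>(b', t')\<in>frc b t. frc (a' * b') (s' * t'))"
    by (simp add: localization_def)
  also have "\<dots> = frc (a * b) (s * t)"
  proof (rule UN_fraction[OF assms])
    fix a' s' b' t'
    assume *: "a' \<in> carr N" "s' \<in> den N p" "b' \<in> carr N" "t' \<in> den N p" "a * s' = a' * s" "b * t' = b' * t"
    have "(a' * s) * (b' * t) = (a * s') * (b * t')" by (simp add: *)
    then have "a' * b' * (s * t) = a * b * (s' * t')" by (simp add: ac_simps)
    then show "frc (a' * b') (s' * t') = frc (a * b) (s * t)"
      using * assms by (subst fraction_eq_iff) simp_all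
  qed
  finally show ?thesis .
qed

lemma loc_add:
  assumes "a \<in> carr N" "s \<in> den N p" "b \<in> carr N" "t \<in> den N p"
  shows "frc a s \<oplus>\<^bsub>loc\<^esub> frc b t = frc (a * t + b * s) (s * t)"
proof -
  have "frc a s \<oplus>\<^bsub>loc\<^esub> frc b t = (\<Union>(a', s')\<in>frc a s. \<Union>(b', t')\<in>frc b t. frc (a' * t' + b' * s') (s' * t'))"
    by (simp add: localization_def)
  also have "\<dots> = frc (a * t + b * s) (s * t)"
  proof (rule UN_fraction[OF assms])
    fix a' s' b' t'
    assume *: "a' \<in> carr N" "s' \<in> den N p" "b' \<in> carr N" "t' \<in> den N p" "a * s' = a' * s" "b * t' = b' * t"
    have "(a' * s) * (t * t') + (b' * t) * (s * s') = (a * s') * (t * t') + (b * t') * (s * s')" by (simp add: *)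
    then have "(a' * t' + b' * s') * (s * t) = (a * t + b * s) * (s' * t')" by (simp add: algebra_simps)
    then show "frc (a' * t' + b' * s') (s' * t') = frc (a * t + b * s) (s * t)"
      using * assms by (subst fraction_eq_iff) simp_all
  qed
  finally show ?thesis .
qed

lemma loc_one: "\<one>\<^bsub>loc\<^esub> = frc 1 1" and loc_zero: "\<zero>\<^bsub>loc\<^esub> = frc 0 1"
  by (simp_all add: localization_def)

lemma loc_cases:
  assumes "X \<in> carrier loc"
  obtains a s where "a \<in> carr N" "s \<in> den N p" "X = frc a s"
  using assms by (auto simp: carrier_loc)

lemma cring_loc: "cring loc"
proof (rule cringI)
  show "abelian_group loc"
  proof (rule abelian_groupI)
    fix X Y assume "X \<in> carrier loc" "Y \<in> carrier loc"
    then obtain a s b t where *: "a \<in> carr N" "s \<in> den N p" "X = frc a s" "b \<in> carr N" "t \<in> den N p" "Y = frc b t"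
      by (metis loc_cases)
    show "X \<oplus>\<^bsub>loc\<^esub> Y \<in> carrier loc"
      using * by (simp add: loc_add frc_carrier)
    show "X \<oplus>\<^bsub>loc\<^esub> Y = Y \<oplus>\<^bsub>loc\<^esub> X"
      using * by (simp add: loc_add add.commute mult.commute)
  next
    show "\<zero>\<^bsub>loc\<^esub> \<in> carrier loc" unfolding loc_zero by (simp add: frc_carrier)
  next
    fix X Y Z assume "X \<in> carrier loc" "Y \<in> carrier loc" "Z \<in> carrier loc"
    then obtain a s b t c u where *: "a \<in> carr N" "s \<in> den N p" "X = frc a s" "b \<in> carr N" "t \<in> den N p" "Y = frc b t"
        "c \<in> carr N" "u \<in> den N p" "Z = frc c u"
      by (metis loc_cases)
    have "X \<oplus>\<^bsub>loc\<^esub> Y \<oplus>\<^bsub>loc\<^esub> Z = frc ((a * t + b * s) * u + c * (s * t)) (s * t * u)"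
      unfolding * by (subst loc_add, use * in simp_all) (subst loc_add, use * in simp_all)
    moreover have "X \<oplus>\<^bsub>loc\<^esub> (Y \<oplus>\<^bsub>loc\<^esub> Z) = frc (a * (t * u) + (b * u + c * t) * s) (s * (t * u))"
      unfolding * by (subst loc_add[of b t c u], use * in simp_all) (subst loc_add, use * in simp_all)
    ultimately show "X \<oplus>\<^bsub>loc\<^esub> Y \<oplus>\<^bsub>loc\<^esub> Z = X \<oplus>\<^bsub>loc\<^esub> (Y \<oplus>\<^bsub>loc\<^esub> Z)"
      by (simp add: algebra_simps)
  next
    fix X assume "X \<in> carrier loc"
    then obtain a s where *: "a \<in> carr N" "s \<in> den N p" "X = frc a s"
      by (metis loc_cases)
    show "\<zero>\<^bsub>loc\<^esub> \<oplus>\<^bsub>loc\<^esub> X = X"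
      unfolding * loc_zero by (subst loc_add) (use * in simp_all)
    have "frc (- a) s \<oplus>\<^bsub>loc\<^esub> X = frc ((- a) * s + a * s) (s * s)"
      unfolding * by (rule loc_add) (use * in simp_all)
    also have "\<dots> = \<zero>\<^bsub>loc\<^esub>"
      unfolding loc_zero by (subst fraction_eq_iff) (use * in simp_all)
    finally show "\<exists>Y\<in>carrier loc. Y \<oplus>\<^bsub>loc\<^esub> X = \<zero>\<^bsub>loc\<^esub>"
      by (rule bexI) (use * in \<open>simp add: frc_carrier\<close>)
  qed
  show "comm_monoid loc"
  proof (rule comm_monoidI)
    fix X Y assume "X \<in> carrier loc" "Y \<in> carrier loc"
    then obtain a s b t where *: "a \<in> carr N" "s \<in> den N p" "X = frc a s" "b \<in> carr N" "t \<in> den N p" "Y = frc b t"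
      by (metis loc_cases)
    show "X \<otimes>\<^bsub>loc\<^esub> Y \<in> carrier loc"
      using * by (simp add: loc_mult frc_carrier)
    show "X \<otimes>\<^bsub>loc\<^esub> Y = Y \<otimes>\<^bsub>loc\<^esub> X"
      using * by (simp add: loc_mult mult.commute)
  next
    show "\<one>\<^bsub>loc\<^esub> \<in> carrier loc" unfolding loc_one by (simp add: frc_carrier)
  next
    fix X Y Z assume "X \<in> carrier loc" "Y \<in> carrier loc" "Z \<in> carrier loc"
    then obtain a s b t c u where *: "a \<in> carr N" "s \<in> den N p" "X = frc a s" "b \<in> carr N" "t \<in> den N p" "Y = frc b t"
        "c \<in> carr N" "u \<in> den N p" "Z = frc c u"
      by (metis loc_cases)
    have "X \<otimes>\<^bsub>loc\<^esub> Y \<otimes>\<^bsub>loc\<^esub> Z = frc (a * b * c) (s * t * u)"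
      unfolding * by (subst loc_mult, use * in simp_all) (subst loc_mult, use * in simp_all)
    moreover have "X \<otimes>\<^bsub>loc\<^esub> (Y \<otimes>\<^bsub>loc\<^esub> Z) = frc (a * (b * c)) (s * (t * u))"
      unfolding * by (subst loc_mult[of b t c u], use * in simp_all) (subst loc_mult, use * in simp_all)
    ultimately show "X \<otimes>\<^bsub>loc\<^esub> Y \<otimes>\<^bsub>loc\<^esub> Z = X \<otimes>\<^bsub>loc\<^esub> (Y \<otimes>\<^bsub>loc\<^esub> Z)"
      by (simp add: mult.assoc)
  next
    fix X assume "X \<in> carrier loc"
    then obtain a s where *: "a \<in> carr N" "s \<in> den N p" "X = frc a s"
      by (metis loc_cases)
    show "\<one>\<^bsub>loc\<^esub> \<otimes>\<^bsub>loc\<^esub> X = X"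
      unfolding * loc_one by (subst loc_mult) (use * in simp_all)
  qed
  fix X Y Z assume "X \<in> carrier loc" "Y \<in> carrier loc" "Z \<in> carrier loc"
  then obtain a s b t c u where *: "a \<in> carr N" "s \<in> den N p" "X = frc a s" "b \<in> carr N" "t \<in> den N p" "Y = frc b t"
      "c \<in> carr N" "u \<in> den N p" "Z = frc c u"
    by (metis loc_cases)
  have 1: "(X \<oplus>\<^bsub>loc\<^esub> Y) \<otimes>\<^bsub>loc\<^esub> Z = frc ((a * t + b * s) * c) (s * t * u)"
    unfolding * by (subst loc_add, use * in simp_all) (subst loc_mult, use * in simp_all)
  have "X \<otimes>\<^bsub>loc\<^esub> Z \<oplus>\<^bsub>loc\<^esub> Y \<otimes>\<^bsub>loc\<^esub> Z = frc (a * c) (s * u) \<oplus>\<^bsub>loc\<^esub> frc (b * c) (t * u)"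
    using * by (simp add: loc_mult)
  also have "\<dots> = frc (a * c * (t * u) + b * c * (s * u)) (s * u * (t * u))"
    by (rule loc_add) (use * in simp_all)
  also have "\<dots> = frc ((a * t + b * s) * c) (s * t * u)"
    by (subst fraction_eq_iff) (use * in \<open>simp_all add: algebra_simps\<close>)
  finally show "(X \<oplus>\<^bsub>loc\<^esub> Y) \<otimes>\<^bsub>loc\<^esub> Z = X \<otimes>\<^bsub>loc\<^esub> Z \<oplus>\<^bsub>loc\<^esub> Y \<otimes>\<^bsub>loc\<^esub> Z"
    using 1 by simp
qed

text \<open>The fractions with numerator in \<open>J\<close> already form an ideal, hence exhaust
  the extension of \<open>J\<close>. Clearing denominators then replaces the localization by a
  multiplier outside \<open>p\<close>.\<close>

lemma loc_contraction_iff: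
  assumes J: "ideal J (coord_ring N)"
  shows "f \<in> loc_contraction (coord_ring N) p J \<longleftrightarrow> f \<in> carr N \<and> (\<exists>u\<in>carr N - p. u * f \<in> J)"
proof -
  note J_closed = coord_ideal_closed[OF J]
  have DJ: "a \<in> carr N" if "a \<in> J" for a using that J_closed by blast
  define K where "K = {frc a s | a s. a \<in> J \<and> s \<in> den N p}"
  have "ideal K loc"
  proof (rule cring.ideal_of_closed[OF cring_loc])
    show "K \<subseteq> carrier loc" unfolding K_def using frc_carrier DJ by blast
    show "\<zero>\<^bsub>loc\<^esub> \<in> K" unfolding K_def loc_zero using J_closed(2) den_one by blast
  next
    fix X Y assume "X \<in> K" "Y \<in> K"
    then obtain a s b t where *: "a \<in> J" "s \<in> den N p" "X = frc a s" "b \<in> J" "t \<in> den N p" "Y = frc b t"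
      unfolding K_def by blast
    have "X \<oplus>\<^bsub>loc\<^esub> Y = frc (a * t + b * s) (s * t)"
      unfolding * by (rule loc_add) (use * DJ in simp_all)
    moreover have "a * t + b * s \<in> J"
      using * by (intro J_closed) auto
    moreover have "s * t \<in> den N p" using * by simp
    ultimately show "X \<oplus>\<^bsub>loc\<^esub> Y \<in> K" unfolding K_def by blast
  next
    fix X Y assume "X \<in> carrier loc" "Y \<in> K"
    then obtain b t where "b \<in> J" "t \<in> den N p" "Y = frc b t"
      unfolding K_def by blast
    moreover obtain a s where "a \<in> carr N" "s \<in> den N p" "X = frc a s"
      using \<open>X \<in> carrier loc\<close> by (rule loc_cases)
    ultimately have *: "a \<in> carr N" "s \<in> den N p" "X = frc a s" "b \<in> J" "t \<in> den N p" "Y = frc b t"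
      by simp_all
    have "X \<otimes>\<^bsub>loc\<^esub> Y = frc (a * b) (s * t)"
      unfolding * by (rule loc_mult) (use * DJ in simp_all)
    moreover have "a * b \<in> J"
      using * by (intro J_closed) auto
    moreover have "s * t \<in> den N p" using * by simp
    ultimately show "X \<otimes>\<^bsub>loc\<^esub> Y \<in> K" unfolding K_def by blast
  qed
  moreover have "(\<lambda>a. frc a 1) ` J \<subseteq> K"
    unfolding K_def using den_one by blast
  ultimately have "Idl\<^bsub>loc\<^esub> ((\<lambda>a. frc a 1) ` J) \<subseteq> K"
    by (intro ring.genideal_minimal[OF cring.axioms(1)[OF cring_loc]])
  then have 1: "\<exists>u\<in>den N p. u * f \<in> J" if f: "f \<in> carr N" "frc f 1 \<in> Idl\<^bsub>loc\<^esub> ((\<lambda>a. frc a 1) ` J)"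
  proof -
    obtain a s where as: "a \<in> J" "s \<in> den N p" "frc f 1 = frc a s"
      using \<open>Idl\<^bsub>loc\<^esub> ((\<lambda>a. frc a 1) ` J) \<subseteq> K\<close> f unfolding K_def by blast
    then have "f * s = a * 1"
      by (subst (asm) fraction_eq_iff) (use as f DJ in simp_all)
    then have "s * f \<in> J" using as by (simp add: mult.commute)
    then show ?thesis using as by blast
  qed
  have 2: "frc f 1 \<in> Idl\<^bsub>loc\<^esub> ((\<lambda>a. frc a 1) ` J)" if "f \<in> carr N" "u \<in> den N p" "u * f \<in> J" for u
    unfolding genideal_def
  proof (intro InterI, clarify)
    fix L assume L: "ideal L loc" "(\<lambda>a. frc a 1) ` J \<subseteq> L"
    have "frc 1 u \<otimes>\<^bsub>loc\<^esub> frc (u * f) 1 \<in> L"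
      using L that by (intro ideal.I_l_closed[OF L(1)] frc_carrier) auto
    moreover have "frc 1 u \<otimes>\<^bsub>loc\<^esub> frc (u * f) 1 = frc (1 * (u * f)) (u * 1)"
      by (rule loc_mult) (use that den_one in simp_all)
    moreover have "frc (1 * (u * f)) (u * 1) = frc f 1"
      by (subst fraction_eq_iff) (use that den_one in simp_all)
    ultimately show "frc f 1 \<in> L" by simp
  qed
  show ?thesis unfolding loc_contraction_def den_def[symmetric] using 1 2 by auto
qed

end

text \<open>Every element of the quotient is the coset of some \<open>g\<close>, so annihilators
  become colon ideals of \<open>I\<close>.\<close>

lemma assoc_primes_iff:
  assumes I: "ideal I (coord_ring N)"
  shows "p \<in> assoc_primes (coord_ring N) I \<longleftrightarrow>
    primeideal p (coord_ring N) \<and> (\<exists>g\<in>carr N. p = {r \<in> carr N. r * g \<in> I})"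
proof -
  interpret cring "coord_ring N :: (nat, 'a) mpoly ring" by (rule cring_coord_ring)
  have key: "(I +>\<^bsub>coord_ring N\<^esub> r) \<otimes>\<^bsub>coord_ring N Quot I\<^esub> (I +>\<^bsub>coord_ring N\<^esub> g) = \<zero>\<^bsub>coord_ring N Quot I\<^esub> \<longleftrightarrow> r * g \<in> I"
    if "r \<in> carr N" "g \<in> carr N" for r g
  proof -
    have "(I +>\<^bsub>coord_ring N\<^esub> r) \<otimes>\<^bsub>coord_ring N Quot I\<^esub> (I +>\<^bsub>coord_ring N\<^esub> g) = I +>\<^bsub>coord_ring N\<^esub> (r * g)"
      using ideal.rcoset_mult_add[OF I, of r g] that by (simp add: FactRing_def)
    moreover have "I +>\<^bsub>coord_ring N\<^esub> (r * g) = I \<longleftrightarrow> r * g \<in> I"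
      using ideal.rcos_const_imp_mem[OF I, of "r * g"] a_rcos_zero[OF I, of "r * g"] that
      by (auto simp: carr_mult)
    ultimately show ?thesis by (simp add: FactRing_def)
  qed
  have carrier: "carrier (coord_ring N Quot I) = (\<lambda>g. I +>\<^bsub>coord_ring N\<^esub> g) ` carr N"
    by (auto simp: FactRing_def A_RCOSETS_def')
  have "{r \<in> carr N. (I +>\<^bsub>coord_ring N\<^esub> r) \<otimes>\<^bsub>coord_ring N Quot I\<^esub> (I +>\<^bsub>coord_ring N\<^esub> g) = \<zero>\<^bsub>coord_ring N Quot I\<^esub>} =
      {r \<in> carr N. r * g \<in> I}" if "g \<in> carr N" for g
    using key that by blast
  then show ?thesis
    unfolding assoc_primes_def carrier mem_Collect_eq bex_simps(7) by (metis (no_types, lifting))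
qed

lemma ideal_pow:
  assumes I: "ideal I (coord_ring N)"
  shows "ideal (I [^]\<^bsub>ideals_set (coord_ring N)\<^esub> (n::nat)) (coord_ring N)"
proof (induction n)
  case 0
  have "ideal (carr N) (coord_ring N)"
    by (rule coord_ideal_of_closed) (auto intro: carr_add carr_mult)
  then show ?case by (simp add: ideals_set_def)
next
  case (Suc n)
  then show ?case
    using ring.ideal_prod_is_ideal[OF cring.axioms(1)[OF cring_coord_ring] Suc I]
    by (simp add: ideals_set_def)
qed

lemma ideal_pow_0: "I [^]\<^bsub>ideals_set (coord_ring N)\<^esub> (0::nat) = carr N"
  by (simp add: ideals_set_def)

lemma ideal_pow_Suc:
  "I [^]\<^bsub>ideals_set (coord_ring N)\<^esub> Suc n =
    ideal_prod (coord_ring N) (I [^]\<^bsub>ideals_set (coord_ring N)\<^esub> n) I"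
  by (simp add: ideals_set_def)

section \<open>Ideals of points and their symbolic powers\<close>

definition hcomp :: "nat \<Rightarrow> ('v, 'k::comm_ring_1) mpoly \<Rightarrow> ('v, 'k) mpoly"
  where "hcomp d f = (\<Sum>t\<in>{t \<in> keys f. mono_deg t = d}. single t (lookup f t))"

lemma lookup_hcomp: "lookup (hcomp d f) t = (if mono_deg t = d then lookup f t else 0)"
proof -
  have "lookup (hcomp d f) t = (\<Sum>a\<in>{t \<in> keys f. mono_deg t = d}. if a = t then lookup f t else 0)"
    unfolding hcomp_def lookup_sum by (intro sum.cong) (auto simp: lookup_single when_def)
  also have "\<dots> = (if mono_deg t = d then lookup f t else 0)"
    by (simp add: not_in_keys_iff_lookup_eq_zero)
  finally show ?thesis .
qed

lemma keys_hcomp: "keys (hcomp d f) = {t \<in> keys f. mono_deg t = d}"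
  by (auto simp only: in_keys_iff lookup_hcomp mem_Collect_eq split: if_splits)

lemma homogeneous_hcomp: "homogeneous d (hcomp d f)"
  by (simp add: homogeneous_def keys_hcomp)

lemma hcomp_carr: "f \<in> carr N \<Longrightarrow> hcomp d f \<in> carr N"
  by (auto simp: carr_iff keys_hcomp)

lemma sum_hcomp:
  assumes "finite A" "mono_deg ` keys f \<subseteq> A"
  shows "f = (\<Sum>d\<in>A. hcomp d f)"
proof (rule poly_mapping_eqI)
  fix t
  have "lookup (\<Sum>d\<in>A. hcomp d f) t = (if mono_deg t \<in> A then lookup f t else 0)"
    using assms(1) by (simp add: lookup_sum lookup_hcomp)
  also have "\<dots> = lookup f t"
    using assms(2) not_in_keys_iff_lookup_eq_zero[of t f] by auto
  finally show "lookup f t = lookup (\<Sum>d\<in>A. hcomp d f) t" by simp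
qed

text \<open>All \<open>tay_gen v i\<close> are homogeneous of degree 1, so the substitution
  preserves degrees.\<close>

lemma hcomp_tay: "hcomp d (tay v f) = tay v (hcomp d f)"
proof (rule poly_mapping_eqI)
  fix t
  let ?A = "insert d (mono_deg ` keys f)"
  have *: "lookup (tay v (hcomp e f)) t = (if mono_deg t = e then lookup (tay v (hcomp e f)) t else 0)" for e
    using homogeneous_tay[OF homogeneous_hcomp[of e f], where v = v]
      not_in_keys_iff_lookup_eq_zero[of t "tay v (hcomp e f)"]
    unfolding homogeneous_def by auto
  have "tay v f = tay v (\<Sum>e\<in>?A. hcomp e f)"
    by (rule arg_cong[OF sum_hcomp]) auto
  then have "lookup (tay v f) t = (\<Sum>e\<in>?A. lookup (tay v (hcomp e f)) t)"
    by (simp only: tay_sum lookup_sum)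
  also have "\<dots> = (\<Sum>e\<in>?A. if mono_deg t = e then lookup (tay v (hcomp e f)) t else 0)"
    using * by (intro sum.cong) auto
  also have "\<dots> = (if mono_deg t \<in> ?A then lookup (tay v (hcomp (mono_deg t) f)) t else 0)"
    by (simp only: sum.delta' finite_insert finite_imageI finite_keys)
  finally have "lookup (tay v f) t = (if mono_deg t \<in> ?A then lookup (tay v (hcomp (mono_deg t) f)) t else 0)" .
  then show "lookup (hcomp d (tay v f)) t = lookup (tay v (hcomp d f)) t"
    using *[of d] by (cases "mono_deg t = d") (simp_all add: lookup_hcomp)
qed

lemma ordw_hcomp: "ordw q f \<Longrightarrow> ordw q (hcomp d f)"
  by (simp add: ordw_def keys_hcomp)

text \<open>These are the polynomials all of whose homogeneous components vanish at
  \<open>v\<close>. Described by order, their primality is the case of order 1 of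
  \<open>ordw_cancel\<close>.\<close>

definition point_prime :: "nat \<Rightarrow> (nat \<Rightarrow> 'k::field) \<Rightarrow> (nat, 'k) mpoly set"
  where "point_prime N v = {f \<in> carr N. ordw 1 (tay v f)}"

lemma primeideal_point: "primeideal (point_prime N v) (coord_ring N)"
proof (rule primeidealI)
  show "ideal (point_prime N v) (coord_ring N)"
    by (rule coord_ideal_of_closed)
      (auto simp: point_prime_def tay_add tay_mult simp del: One_nat_def intro: ordw_add ordw_mult_right)
  show "cring (coord_ring N :: (nat, 'a) mpoly ring)" by (rule cring_coord_ring)
  have "\<not> ordw 1 (1 :: (nat, 'a) mpoly)" by (simp add: ordw_def)
  then have "1 \<notin> point_prime N v" by (simp add: point_prime_def)
  then show "carr N \<noteq> point_prime N v" using carr_one by blast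
next
  fix a b assume "a \<in> carr N" "b \<in> carr N" "a \<otimes>\<^bsub>coord_ring N\<^esub> b \<in> point_prime N v"
  then show "a \<in> point_prime N v \<or> b \<in> point_prime N v"
    using ordw_cancel[of 1 "tay v a" "tay v b"] by (auto simp: point_prime_def tay_mult)
qed

text \<open>\<open>defining_ideal\<close> for a tuple of representative vectors, which makes the
  ideal depend on coordinates, so that polynomial conditions on the points can be stated.\<close>

definition van_ideal :: "nat \<Rightarrow> nat \<Rightarrow> (nat \<Rightarrow> nat \<Rightarrow> 'k::field) \<Rightarrow> (nat, 'k) mpoly set"
  where "van_ideal N s v = Idl\<^bsub>coord_ring N\<^esub>
    {f \<in> carr N. (\<exists>d. homogeneous d f) \<and> (\<forall>i<s. mpoly_eval (v i) f = 0)}"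

lemma ideal_van_ideal: "ideal (van_ideal N s v) (coord_ring N)"
  unfolding van_ideal_def
  by (intro ring.genideal_ideal[OF cring.axioms(1)[OF cring_coord_ring]]) auto

lemma van_ideal_gen:
  "f \<in> carr N \<Longrightarrow> homogeneous d f \<Longrightarrow> (\<And>i. i < s \<Longrightarrow> mpoly_eval (v i) f = 0) \<Longrightarrow> f \<in> van_ideal N s v"
  unfolding van_ideal_def
  by (rule subsetD[OF ring.genideal_self[OF cring.axioms(1)[OF cring_coord_ring]]]) auto

text \<open>The order condition passes to homogeneous components, each of which is then one of the
  generators. Conversely, the right side is an ideal that contains the generators.\<close>

lemma van_ideal_eq: "van_ideal N s v = {f \<in> carr N. \<forall>i<s. f \<in> point_prime N (v i)}"
proof
  have "ideal {f \<in> carr N. \<forall>i<s. f \<in> point_prime N (v i)} (coord_ring N)"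
    using coord_ideal_closed[OF primeideal.axioms(1)[OF primeideal_point[of N "v _"]]]
    by (intro coord_ideal_of_closed) auto
  then show "van_ideal N s v \<subseteq> {f \<in> carr N. \<forall>i<s. f \<in> point_prime N (v i)}"
    unfolding van_ideal_def
    by (intro ring.genideal_minimal[OF cring.axioms(1)[OF cring_coord_ring]])
      (auto simp: point_prime_def ordw_1_tay simp del: One_nat_def)
next
  show "{f \<in> carr N. \<forall>i<s. f \<in> point_prime N (v i)} \<subseteq> van_ideal N s v"
  proof clarify
    fix f assume f: "f \<in> carr N" "\<forall>i<s. f \<in> point_prime N (v i)"
    have "hcomp d f \<in> van_ideal N s v" for d
    proof (rule van_ideal_gen)
      fix i assume "i < s"
      then have "ordw 1 (hcomp d (tay (v i) f))"
        using f(2) by (auto simp: point_prime_def intro: ordw_hcomp)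
      then show "mpoly_eval (v i) (hcomp d f) = 0"
        by (simp only: hcomp_tay ordw_1_tay[OF homogeneous_hcomp])
    qed (use f in \<open>auto intro: hcomp_carr homogeneous_hcomp\<close>)
    then have "(\<Sum>d\<in>mono_deg ` keys f. hcomp d f) \<in> van_ideal N s v"
      by (intro coord_ideal_sum[OF ideal_van_ideal])
    then show "f \<in> van_ideal N s v"
      using sum_hcomp[of "mono_deg ` keys f" f] by simp
  qed
qed

lemma van_ideal_eval: "f \<in> van_ideal N s v \<Longrightarrow> homogeneous d f \<Longrightarrow> i < s \<Longrightarrow> mpoly_eval (v i) f = 0"
  using ordw_1_tay[of d f "v i"] by (simp add: van_ideal_eq point_prime_def)

lemma tay_x0: "tay u (single (single 0 1) c) = single (single 0 1) (c * u 0)"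
  by (simp add: tay_single tay_gen_def mult_single)

text \<open>For \<open>w 0 = 1\<close> the substitution fixes x_0 and adds w_i x_0 to x_i; the
  negative coordinates undo it.\<close>

lemma tay_inverse:
  assumes "w 0 = 1"
  shows "tay (\<lambda>i. if i = 0 then 1 else - w i) (tay w f) = f"
proof -
  have gen: "tay (\<lambda>i. if i = 0 then 1 else - w i) (tay_gen w i) = var i" for i
  proof (cases "i = 0")
    case True
    then show ?thesis using assms tay_x0[of "\<lambda>i. if i = 0 then 1 else - w i" 1]
      by (simp add: tay_gen_def[of w]) (simp add: var_def)
  next
    case False
    then have "tay (\<lambda>i. if i = 0 then 1 else - w i) (tay_gen w i) =
        single (single 0 1) (w i) + tay_gen (\<lambda>i. if i = 0 then 1 else - w i) i"
      by (simp only: tay_gen_def[of w] if_False tay_add tay_x0 tay_var) simp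
    also have "\<dots> = var i"
      using False by (simp add: tay_gen_def single_uminus)
    finally show ?thesis .
  qed
  show ?thesis
    using gen unfolding tay_def subst_subst by (simp add: subst_var)
qed

lemma monomial_factor:
  assumes "keys t \<subseteq> {..N}" "wt t > 0"
  obtains j t' where "0 < j" "j \<le> N" "t = single j 1 + t'" "keys t' \<subseteq> {..N}" "wt t = Suc (wt t')"
proof -
  obtain j where j: "j \<in> keys t" "j \<noteq> 0"
    by (rule wt_pos_obtain[OF assms(2)])
  then have "lookup t j \<ge> 1" by (simp add: Suc_le_eq in_keys_pos)
  then have t: "t = single j 1 + (t - single j 1)"
    by (intro poly_mapping_eqI) (auto simp: lookup_add lookup_minus lookup_single when_def)
  have "wt t = wt (single j 1) + wt (t - single j 1)"
    using arg_cong[OF t, of wt] by (simp only: wt_add)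
  then have wt: "wt t = Suc (wt (t - single j 1))" using j by simp
  have "i \<in> keys t" if "i \<in> keys (t - single j 1)" for i
    using that by (simp add: in_keys_pos[symmetric] lookup_minus)
  with assms(1) have "keys (t - single j 1) \<subseteq> {..N}" by blast
  then show thesis
    using that[OF _ _ t _ wt] j assms(1) by auto
qed

text \<open>\<open>norm\<close> makes \<open>tay (v i)\<close> an invertible change of coordinates.
  A separator \<open>G\<close> singles out the prime of its point among the associated primes and
  later serves as a denominator in the localization there.\<close>

locale separated_points =
  fixes N s :: nat and v :: "nat \<Rightarrow> nat \<Rightarrow> 'k::field"
  assumes norm: "\<And>i. i < s \<Longrightarrow> v i 0 = 1"
    and separated: "\<And>i. i < s \<Longrightarrow> \<exists>G\<in>carr N. G \<notin> point_prime N (v i) \<and>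
      (\<forall>j<s. j \<noteq> i \<longrightarrow> G \<in> point_prime N (v j))"
begin

abbreviation "vI \<equiv> van_ideal N s v"

lemma separator:
  obtains G where "\<And>i. i < s \<Longrightarrow> G i \<in> carr N" "\<And>i. i < s \<Longrightarrow> G i \<notin> point_prime N (v i)"
    "\<And>i j. i < s \<Longrightarrow> j < s \<Longrightarrow> j \<noteq> i \<Longrightarrow> G i \<in> point_prime N (v j)"
  using separated by metis

lemma point_prime_mult: "f \<in> point_prime N w \<Longrightarrow> g \<in> carr N \<Longrightarrow> g * f \<in> point_prime N w"
  by (rule coord_ideal_closed(4)[OF primeideal.axioms(1)[OF primeideal_point]])

lemma point_prime_cancel: "f * g \<in> point_prime N w \<Longrightarrow> f \<in> carr N \<Longrightarrow> g \<in> carr N \<Longrightarrow> f \<notin> point_prime N w \<Longrightarrow> g \<in> point_prime N w"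
  using primeideal.I_prime[OF primeideal_point, of f N g w] by auto

text \<open>The class of a separator \<open>G\<close> of the point is annihilated exactly by its
  prime, since \<open>G\<close> already vanishes at all other points.\<close>

lemma assoc_point_prime:
  assumes "i < s"
  shows "point_prime N (v i) \<in> assoc_primes (coord_ring N) vI"
proof -
  obtain G where G: "G \<in> carr N" "G \<notin> point_prime N (v i)" "\<forall>j<s. j \<noteq> i \<longrightarrow> G \<in> point_prime N (v j)"
    using separated[OF assms] by blast
  have "point_prime N (v i) = {r \<in> carr N. r * G \<in> vI}"
  proof (intro Set.set_eqI iffI)
    fix r assume r: "r \<in> point_prime N (v i)"
    then have rc: "r \<in> carr N" by (simp add: point_prime_def)
    have "r * G \<in> point_prime N (v j)" if "j < s" for j
      using point_prime_mult[of r "v j" G] point_prime_mult[of G "v j" r] r rc G that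
      by (cases "j = i") (auto simp: mult.commute)
    then show "r \<in> {r \<in> carr N. r * G \<in> vI}"
      using rc G by (simp add: van_ideal_eq)
  next
    fix r assume "r \<in> {r \<in> carr N. r * G \<in> vI}"
    then have "r \<in> carr N" "G * r \<in> point_prime N (v i)"
      using assms by (auto simp: van_ideal_eq mult.commute)
    then show "r \<in> point_prime N (v i)"
      using point_prime_cancel G by blast
  qed
  then show ?thesis
    using assoc_primes_iff[OF ideal_van_ideal] primeideal_point G by blast
qed

text \<open>The colon ideal by \<open>g\<close> consists of what vanishes at the points where
  \<open>g\<close> does not. If there were two such points, the product of their separators would
  lie in it although neither factor does, against primality.\<close>

lemma assoc_primes_point:
  assumes "p \<in> assoc_primes (coord_ring N) vI"
  obtains i where "i < s" "p = point_prime N (v i)"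
proof -
  obtain g where p: "primeideal p (coord_ring N)" and g: "g \<in> carr N" and p_eq: "p = {r \<in> carr N. r * g \<in> vI}"
    using assms unfolding assoc_primes_iff[OF ideal_van_ideal] by blast
  have p_mem: "r \<in> p \<longleftrightarrow> r \<in> carr N \<and> (\<forall>i<s. g \<notin> point_prime N (v i) \<longrightarrow> r \<in> point_prime N (v i))" for r
  proof -
    have "r * g \<in> point_prime N (v i) \<longleftrightarrow> (g \<notin> point_prime N (v i) \<longrightarrow> r \<in> point_prime N (v i))" if "r \<in> carr N" for i
    proof (cases "g \<in> point_prime N (v i)")
      case True
      then show ?thesis using point_prime_mult[OF True that] by simp
    next
      case False
      have "g * r \<in> point_prime N (v i) \<longleftrightarrow> r \<in> point_prime N (v i)"
        using point_prime_cancel[OF _ g that False] point_prime_mult[OF _ g] by blast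
      then show ?thesis using False by (simp only: mult.commute[of r g]) simp
    qed
    then show ?thesis using g carr_mult[of r N g] unfolding p_eq van_ideal_eq by blast
  qed
  obtain G where G: "\<And>i. i < s \<Longrightarrow> G i \<in> carr N" "\<And>i. i < s \<Longrightarrow> G i \<notin> point_prime N (v i)"
    "\<And>i j. i < s \<Longrightarrow> j < s \<Longrightarrow> j \<noteq> i \<Longrightarrow> G i \<in> point_prime N (v j)"
    using separator by blast
  have "\<exists>i<s. g \<notin> point_prime N (v i)"
  proof (rule ccontr)
    assume "\<not> (\<exists>i<s. g \<notin> point_prime N (v i))"
    then have "p = carr N" using p_mem by auto
    then show False using primeideal.I_notcarr[OF p] by simp
  qed
  then obtain i where i: "i < s" "g \<notin> point_prime N (v i)" by blast
  have uniq: "j = i" if j: "j < s" "g \<notin> point_prime N (v j)" for j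
  proof (rule ccontr)
    assume "j \<noteq> i"
    have "G i * G j \<in> point_prime N (v l)" if "l < s" for l
      using G i(1) j(1) that \<open>j \<noteq> i\<close> point_prime_mult[of "G i" "v l" "G j"] point_prime_mult[of "G j" "v l" "G i"]
      unfolding mult.commute[of "G j" "G i"] by blast
    then have "G i * G j \<in> p" using p_mem G i j by auto
    then have "G i \<in> p \<or> G j \<in> p"
      using primeideal.I_prime[OF p, of "G i" "G j"] G i j by simp
    then show False using p_mem G(2) i j by blast
  qed
  have "r \<in> p \<longleftrightarrow> r \<in> point_prime N (v i)" for r
  proof -
    have "r \<in> carr N" if "r \<in> point_prime N (v i)" using that by (simp add: point_prime_def)
    then show ?thesis using p_mem[of r] i uniq by metis
  qed
  then have "p = point_prime N (v i)" by blast
  then show thesis by (rule that[OF i(1)])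
qed

lemma ordw_ideal_pow:
  assumes "f \<in> vI [^]\<^bsub>ideals_set (coord_ring N)\<^esub> (q::nat)" "i < s"
  shows "ordw q (tay (v i) f)"
  using assms(1)
proof (induction q arbitrary: f)
  case (Suc q)
  have "f \<in> ideal_prod (coord_ring N) (vI [^]\<^bsub>ideals_set (coord_ring N)\<^esub> q) vI"
    using Suc.prems by (simp only: ideal_pow_Suc)
  then show ?case
  proof induction
    case (prod a b)
    have "ordw 1 (tay (v i) b)" using prod(2) assms(2) by (simp add: van_ideal_eq point_prime_def)
    from ordw_mult[OF Suc.IH[OF prod(1)] this] show ?case by (simp add: tay_mult)
  next
    case (sum a b)
    then show ?case by (simp add: tay_add ordw_add)
  qed
qed simp

text \<open>Expanded in x_0 and the linear forms x_j - v_ij x_0, every term of \<open>f\<close>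
  contains at least \<open>m\<close> of these linear forms. Pairing each of \<open>m\<close> of them
  with one factor \<open>G\<close> gives \<open>m\<close> elements of the ideal of the
  points.\<close>

lemma power_separator_mult:
  assumes i: "i < s" and G: "G \<in> carr N" "\<And>j. j < s \<Longrightarrow> j \<noteq> i \<Longrightarrow> G \<in> point_prime N (v j)"
    and f: "f \<in> carr N" "ordw m (tay (v i) f)"
  shows "G ^ m * f \<in> vI [^]\<^bsub>ideals_set (coord_ring N)\<^esub> m"
proof -
  let ?u = "\<lambda>k. if k = 0 then 1 else - v i k"
  let ?I = "\<lambda>m. vI [^]\<^bsub>ideals_set (coord_ring N)\<^esub> (m::nat)"
  \<comment> \<open>\<open>tay ?u (var j)\<close> is x_j - v_ij x_0; it vanishes at
    \<open>v i\<close>, and \<open>G\<close> vanishes at the other points.\<close>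
  have lin: "G * tay ?u (var j) \<in> vI" if j: "0 < j" "j \<le> N" for j
  proof -
    have y: "tay ?u (var j) \<in> carr N" using j by (intro tay_carr carr_var)
    have "tay (v i) (tay ?u (var j)) = single (single 0 1) (- v i j * v i 0) + tay_gen (v i) j"
      using j by (simp only: tay_var tay_gen_def[of ?u] if_False tay_add tay_x0) (simp add: tay_var)
    also have "\<dots> = var j"
      using j norm[OF i] by (simp add: tay_gen_def single_uminus)
    finally have "ordw 1 (tay (v i) (tay ?u (var j)))"
      using j by (simp add: var_def ordw_single)
    with y have "tay ?u (var j) \<in> point_prime N (v i)" by (simp add: point_prime_def)
    then have "G * tay ?u (var j) \<in> point_prime N (v l)" if "l < s" for l
      using point_prime_mult[of "tay ?u (var j)" "v l" G] point_prime_mult[of G "v l" "tay ?u (var j)"] G y that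
      unfolding mult.commute[of "tay ?u (var j)" G] by (cases "l = i") auto
    then show ?thesis using G y by (simp add: van_ideal_eq)
  qed
  have mono: "G ^ m * tay ?u (single t c) \<in> ?I m" if "keys t \<subseteq> {..N}" "m \<le> wt t" for t c m
    using that
  proof (induction m arbitrary: t)
    case 0
    then have "tay ?u (single t c) \<in> carr N" by (intro tay_carr) (simp add: carr_single)
    then show ?case by (simp only: ideal_pow_0 power_0 mult_1)
  next
    case (Suc m)
    then have "wt t > 0" by simp
    then obtain j t' where t: "0 < j" "j \<le> N" "t = single j 1 + t'" "keys t' \<subseteq> {..N}" "wt t = Suc (wt t')"
      by (rule monomial_factor[OF Suc.prems(1)])
    have "single t c = single t' c * var j"
      by (simp add: t(3) var_def mult_single add.commute)
    then have "G ^ Suc m * tay ?u (single t c) =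
        (G ^ m * tay ?u (single t' c)) \<otimes>\<^bsub>coord_ring N\<^esub> (G * tay ?u (var j))"
      by (simp only: tay_mult coord_ring_simps) (simp only: power_Suc ac_simps)
    also have "\<dots> \<in> ?I (Suc m)"
      unfolding ideal_pow_Suc
      by (rule ideal_prod.prod) (use Suc t lin in auto)
    finally show ?case .
  qed
  let ?h = "tay (v i) f"
  \<comment> \<open>Expanding at the point and substituting back writes \<open>f\<close> as a sum of
    terms to which \<open>mono\<close> applies.\<close>
  have "f = tay ?u ?h" using tay_inverse[of "v i" f] norm[OF i] by simp
  also have "\<dots> = (\<Sum>t\<in>keys ?h. tay ?u (single t (lookup ?h t)))"
    by (simp only: poly_mapping_sum_single[of ?h, symmetric] flip: tay_sum)
  finally have "G ^ m * f = (\<Sum>t\<in>keys ?h. G ^ m * tay ?u (single t (lookup ?h t)))"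
    by (simp only: flip: sum_distrib_left)
  also have "\<dots> \<in> ?I m"
    using f tay_carr[OF f(1), of "v i"]
    by (intro coord_ideal_sum[OF ideal_pow[OF ideal_van_ideal]] mono) (auto simp: ordw_def carr_iff)
  finally show ?thesis .
qed

text \<open>A multiplier outside the prime of \<open>v i\<close> has order 0 there, so
  \<open>ordw_cancel\<close> removes it. Conversely, the q-th power of a separator is a suitable
  multiplier by \<open>power_separator_mult\<close>.\<close>

theorem symbolic_power_eq:
  "symbolic_power (coord_ring N) vI q = {f \<in> carr N. \<forall>i<s. ordw q (tay (v i) f)}"
proof (intro Set.set_eqI iffI)
  note iff = loc_contraction_iff[OF _ ideal_pow[OF ideal_van_ideal]]
  fix f assume f: "f \<in> symbolic_power (coord_ring N) vI q"
  have "ordw q (tay (v i) f)" if i: "i < s" for i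
  proof -
    have "f \<in> loc_contraction (coord_ring N) (point_prime N (v i)) (vI [^]\<^bsub>ideals_set (coord_ring N)\<^esub> q)"
      using f assoc_point_prime[OF i] by (simp add: symbolic_power_def)
    then obtain u where u: "u \<in> carr N" "u \<notin> point_prime N (v i)" "u * f \<in> vI [^]\<^bsub>ideals_set (coord_ring N)\<^esub> q"
      unfolding iff[OF primeideal_point] by blast
    have "ordw q (tay (v i) u * tay (v i) f)"
      using ordw_ideal_pow[OF u(3) i] by (simp add: tay_mult)
    then show ?thesis
      by (rule ordw_cancel) (use u in \<open>simp add: point_prime_def\<close>)
  qed
  then show "f \<in> {f \<in> carr N. \<forall>i<s. ordw q (tay (v i) f)}"
    using f by (simp add: symbolic_power_def)
next
  note iff = loc_contraction_iff[OF _ ideal_pow[OF ideal_van_ideal]]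
  fix f assume f: "f \<in> {f \<in> carr N. \<forall>i<s. ordw q (tay (v i) f)}"
  have "f \<in> loc_contraction (coord_ring N) p (vI [^]\<^bsub>ideals_set (coord_ring N)\<^esub> q)"
    if p: "p \<in> assoc_primes (coord_ring N) vI" for p
  proof -
    obtain i where i: "i < s" "p = point_prime N (v i)" by (rule assoc_primes_point[OF p])
    obtain G where G: "G \<in> carr N" "G \<notin> point_prime N (v i)" "\<forall>j<s. j \<noteq> i \<longrightarrow> G \<in> point_prime N (v j)"
      using separated[OF i(1)] by blast
    have "G ^ q \<notin> point_prime N (v i)"
    proof (induction q)
      case 0
      then show ?case using one_notin_prime[OF primeideal_point] by simp
    next
      case (Suc q)
      then show ?case using point_prime_cancel[of G "G ^ q" "v i"] G(1,2) carr_power[OF G(1)] by auto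
    qed
    moreover have "G ^ q * f \<in> vI [^]\<^bsub>ideals_set (coord_ring N)\<^esub> q"
      by (rule power_separator_mult[OF i(1)]) (use G f i in auto)
    ultimately show ?thesis
      unfolding i(2) iff[OF primeideal_point] using f carr_power[OF G(1), of q] by blast
  qed
  then show "f \<in> symbolic_power (coord_ring N) vI q"
    using f by (simp add: symbolic_power_def)
qed

end

section \<open>Linear systems and counting monomials\<close>

lemma linear_system_solution:
  fixes a :: "'e \<Rightarrow> 't \<Rightarrow> 'k::field"
  assumes "finite E" "finite T" "card E < card T"
  shows "\<exists>c. (\<exists>t\<in>T. c t \<noteq> 0) \<and> (\<forall>e\<in>E. (\<Sum>t\<in>T. a e t * c t) = 0)"
  using assms
proof (induction E arbitrary: T a)
    case empty
    then have "T \<noteq> {}" by auto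
    then show ?case by (intro exI[of _ "\<lambda>_. 1"]) auto
  next
    case (insert e0 E)
    show ?case
    proof (cases "\<forall>t\<in>T. a e0 t = 0")
      case True
      obtain c where c: "\<exists>t\<in>T. c t \<noteq> 0" "\<forall>e\<in>E. (\<Sum>t\<in>T. a e t * c t) = 0"
        using insert.IH[of T a] insert.prems insert.hyps by auto
      have "(\<Sum>t\<in>T. a e0 t * c t) = 0"
        using True by (intro sum.neutral) auto
      with c show ?thesis by (intro exI[of _ c]) auto
    next
      case False
      \<comment> \<open>Gaussian elimination: the equation \<open>e0\<close> determines the unknown
        \<open>t0\<close>, which is eliminated from the other equations.\<close>
      then obtain t0 where t0: "t0 \<in> T" "a e0 t0 \<noteq> 0" by auto
      define T' where "T' = T - {t0}"
      have T': "finite T'" "card E < card T'" "t0 \<notin> T'" "T = insert t0 T'"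
        using insert.prems insert.hyps t0 by (auto simp: T'_def)
      obtain c where c: "\<exists>t\<in>T'. c t \<noteq> 0"
        "\<forall>e\<in>E. (\<Sum>t\<in>T'. (a e t - a e t0 * a e0 t / a e0 t0) * c t) = 0"
        using insert.IH[of T' "\<lambda>e t. a e t - a e t0 * a e0 t / a e0 t0"] T' by auto
      define c' where "c' = c(t0 := - (\<Sum>t\<in>T'. a e0 t * c t) / a e0 t0)"
      have sum: "(\<Sum>t\<in>T. a e t * c' t) = (\<Sum>t\<in>T'. a e t * c t) - a e t0 * (\<Sum>t\<in>T'. a e0 t * c t) / a e0 t0" for e
      proof -
        have "(\<Sum>t\<in>T'. a e t * c' t) = (\<Sum>t\<in>T'. a e t * c t)"
          using T' by (intro sum.cong) (auto simp: c'_def)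
        then show ?thesis using T' by (simp add: c'_def)
      qed
      have "(\<Sum>t\<in>T. a e t * c' t) = 0" if "e \<in> E" for e
      proof -
        have "0 = (\<Sum>t\<in>T'. (a e t - a e t0 * a e0 t / a e0 t0) * c t)"
          using c that by simp
        also have "\<dots> = (\<Sum>t\<in>T'. a e t * c t) - a e t0 * (\<Sum>t\<in>T'. a e0 t * c t) / a e0 t0"
          by (simp add: left_diff_distrib sum_subtractf sum_distrib_left sum_divide_distrib mult.assoc)
        finally show ?thesis using sum by simp
      qed
      moreover have "(\<Sum>t\<in>T. a e0 t * c' t) = 0"
        using t0 by (simp add: sum)
      moreover have "\<exists>t\<in>T. c' t \<noteq> 0"
        using c(1) T' by (auto simp: c'_def)
      ultimately show ?thesis by (intro exI[of _ c']) auto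
    qed
  qed

section \<open>Counting monomials\<close>

lemma mono_deg_monomial: "keys t \<subseteq> {..N} \<Longrightarrow> mono_deg t = (\<Sum>i\<le>N. lookup t i)" for t :: "nat monomial"
  unfolding mono_deg_wdeg by (subst wdeg_superset[of "{..N}"]) auto

lemma bij_betw_monomials:
  "bij_betw (\<lambda>t. map (lookup t) [0..<Suc N]) (monomials N d) {l. length l = Suc N \<and> sum_list l = d}"
proof (rule bij_betwI[where g = "\<lambda>l. \<Sum>i\<le>N. single i (l ! i)"])
  show "(\<lambda>t. map (lookup t) [0..<Suc N]) \<in> monomials N d \<rightarrow> {l. length l = Suc N \<and> sum_list l = d}"
    by (auto simp: monomials_def mono_deg_monomial interv_sum_list_conv_sum_set_nat atLeast0AtMost
      atLeastLessThanSuc_atLeastAtMost simp del: upt_Suc)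
  have lookup: "lookup (\<Sum>i\<le>N. single i (l ! i)) k = (if k \<le> N then l ! k else 0)" for l :: "nat list" and k
    by (simp add: lookup_sum lookup_single when_def)
  have keys: "keys (\<Sum>i\<le>N. single i (l ! i)) \<subseteq> {..N}" for l :: "nat list"
    using keys_sum_subset[of "\<lambda>i. single i (l ! i)" "{..N}"] by (auto split: if_splits)
  show "(\<lambda>l. \<Sum>i\<le>N. single i (l ! i)) \<in> {l. length l = Suc N \<and> sum_list l = d} \<rightarrow> monomials N d"
    using keys
    by (auto simp: monomials_def mono_deg_monomial[OF keys] lookup sum_list_sum_nth atLeast0AtMost
      atLeastLessThanSuc_atLeastAtMost)
  show "(\<Sum>i\<le>N. single i (map (lookup t) [0..<Suc N] ! i)) = t" if "t \<in> monomials N d" for t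
  proof (rule poly_mapping_eqI)
    fix k
    have "lookup t k = 0" if "\<not> k \<le> N"
      using that \<open>t \<in> monomials N d\<close> not_in_keys_iff_lookup_eq_zero[of k t] by (auto simp: monomials_def)
    then show "lookup (\<Sum>i\<le>N. single i (map (lookup t) [0..<Suc N] ! i)) k = lookup t k"
      unfolding lookup by (simp del: upt_Suc)
  qed
  show "map (lookup (\<Sum>i\<le>N. single i (l ! i))) [0..<Suc N] = l" if "l \<in> {l. length l = Suc N \<and> sum_list l = d}" for l
    using that by (intro nth_equalityI) (auto simp: lookup simp del: upt_Suc)
qed

lemma card_monomials: "card (monomials N d) = (N + d) choose N"
proof -
  have "card (monomials N d) = (d + N) choose d"
    using bij_betw_same_card[OF bij_betw_monomials[of N d]] card_length_sum_list[of "Suc N" d] by simp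
  also have "\<dots> = (N + d) choose N"
    by (metis add.commute add_diff_cancel_left' binomial_symmetric le_add1)
  finally show ?thesis .
qed

lemma finite_monomials [simp]: "finite (monomials N d)"
proof (rule card_ge_0_finite)
  show "0 < card (monomials N d)" unfolding card_monomials by simp
qed

text \<open>The degree \<open>d\<close> determines the exponent of x_0, so these monomials index the
  Taylor coefficients up to order \<open>n\<close> in x_1, ..., x_N.\<close>

definition jets :: "nat \<Rightarrow> nat \<Rightarrow> nat \<Rightarrow> nat monomial set"
  where "jets N d n = {t \<in> monomials N d. wt t \<le> n}"

lemma finite_jets [simp]: "finite (jets N d n)"
  by (simp add: jets_def)

text \<open>Changes the degree to \<open>n\<close> through the exponent of x_0, provided
  \<open>wt t \<le> n\<close>; otherwise the subtraction truncates. It identifies jets that live in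
  different degrees.\<close>

definition set_x0 :: "nat \<Rightarrow> nat monomial \<Rightarrow> nat monomial"
  where "set_x0 n t = (t - single 0 (lookup t 0)) + single 0 (n - wt t)"

lemma lookup_set_x0: "lookup (set_x0 n t) i = (if i = 0 then n - wt t else lookup t i)"
  by (simp add: set_x0_def lookup_add lookup_minus lookup_single)

lemma wt_set_x0 [simp]: "wt (set_x0 n t) = wt t"
proof -
  have "wt (single 0 (lookup t 0) + (t - single 0 (lookup t 0))) = wt (t - single 0 (lookup t 0))"
    by (simp add: wt_add)
  moreover have "single 0 (lookup t 0) + (t - single 0 (lookup t 0)) = t"
    by (rule poly_mapping_eqI) (simp add: lookup_add lookup_minus lookup_single when_def)
  ultimately show ?thesis by (simp add: set_x0_def wt_add)
qed

lemma keys_set_x0: "keys t \<subseteq> {..N} \<Longrightarrow> keys (set_x0 n t) \<subseteq> {..N}"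
  by (auto simp: lookup_set_x0 subset_iff simp flip: in_keys_pos split: if_splits)

lemma set_x0_monomials: "keys t \<subseteq> {..N} \<Longrightarrow> wt t \<le> n \<Longrightarrow> set_x0 n t \<in> monomials N n"
  by (simp add: monomials_def keys_set_x0 mono_deg_wt lookup_set_x0)

lemma set_x0_id: "mono_deg t = d \<Longrightarrow> set_x0 d (set_x0 n t) = t"
  by (intro poly_mapping_eqI) (auto simp: lookup_set_x0 mono_deg_wt)

lemma card_jets_le: "card (jets N d n) \<le> (N + n) choose N"
  unfolding card_monomials[symmetric]
proof (rule card_inj_on_le)
  show "inj_on (set_x0 n) (jets N d n)"
    by (rule inj_on_inverseI[of _ "set_x0 d"]) (simp add: jets_def monomials_def set_x0_id)
  show "set_x0 n ` jets N d n \<subseteq> monomials N n"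
    by (auto simp: jets_def monomials_def[of N d] intro: set_x0_monomials)
qed simp

lemma card_jets:
  assumes "n \<le> d"
  shows "card (jets N d n) = (N + n) choose N"
proof (rule antisym[OF card_jets_le])
  have "wt t \<le> n" if "t \<in> monomials N n" for t
    using that by (auto simp: monomials_def mono_deg_wt)
  then show "(N + n) choose N \<le> card (jets N d n)"
    unfolding card_monomials[symmetric] using assms
    by (intro card_inj_on_le[of "set_x0 d"] inj_on_inverseI[of _ "set_x0 n"])
      (force simp: jets_def monomials_def[of N n] set_x0_id intro!: set_x0_monomials)+
qed

section \<open>Interpolation of jets\<close>

text \<open>Only leading terms are prescribed, with errors of weight above \<open>wt t\<close> and
  not above \<open>n\<close>. This triangular condition suffices for linear independence, and unlike
  exact interpolation up to order \<open>n\<close> it is stable under products.\<close>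

definition jet_interpolator ::
    "nat \<Rightarrow> nat \<Rightarrow> (nat \<Rightarrow> nat \<Rightarrow> 'k::field) \<Rightarrow> nat \<Rightarrow> nat \<Rightarrow> (nat \<Rightarrow> nat monomial \<Rightarrow> (nat, 'k) mpoly) \<Rightarrow> bool"
  where "jet_interpolator N r v D n H \<longleftrightarrow> (\<forall>i<r. \<forall>t\<in>jets N D n. H i t \<in> forms N D \<and>
    ordw (Suc (wt t)) (tay (v i) (H i t) - single t 1) \<and>
    (\<forall>j<r. j \<noteq> i \<longrightarrow> ordw (Suc (wt t)) (tay (v j) (H i t))))"

lemma ordw_lookup: "ordw q f \<Longrightarrow> wt t < q \<Longrightarrow> lookup f t = 0"
  using not_in_keys_iff_lookup_eq_zero[of t f] by (force simp: ordw_def)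

lemma jet_interpolator_independent:
  assumes H: "jet_interpolator N r v D n H"
    and S: "\<And>i. i < r \<Longrightarrow> ordw (Suc n) (tay (v i) (\<Sum>(j, t)\<in>{..<r} \<times> jets N D n. single 0 (c j t) * H j t))"
    and "i < r" "t \<in> jets N D n"
  shows "c i t = 0"
proof (rule ccontr)
  assume "c i t \<noteq> 0"
  define P where "P w \<longleftrightarrow> (\<exists>i<r. \<exists>t\<in>jets N D n. c i t \<noteq> 0 \<and> wt t = w)" for w
  have "P (wt t)" using assms \<open>c i t \<noteq> 0\<close> by (auto simp: P_def)
  \<comment> \<open>For a nonzero coefficient of least weight, no other summand contributes to its
    monomial at its own point.\<close>
  define w where "w = (LEAST w. P w)"
  have "P w" unfolding w_def using \<open>P (wt t)\<close> by (rule LeastI)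
  then obtain k u where ku: "k < r" "u \<in> jets N D n" "c k u \<noteq> 0" "wt u = w" by (auto simp: P_def)
  have w_le: "w \<le> wt t" if "j < r" "t \<in> jets N D n" "c j t \<noteq> 0" for j t
    unfolding w_def by (rule Least_le) (use that in \<open>auto simp: P_def\<close>)
  have coeff: "c j t * lookup (tay (v k) (H j t)) u = (if (j, t) = (k, u) then c k u else 0)"
    if jt: "j < r" "t \<in> jets N D n" for j t
  proof (cases "c j t = 0")
    case True
    then show ?thesis using ku by auto
  next
    case False
    then have "wt u < Suc (wt t)" using w_le[OF jt] ku by simp
    note zero = ordw_lookup[OF _ this]
    show ?thesis
    proof (cases "j = k")
      case True
      have "lookup (tay (v k) (H k t) - single t 1) u = 0"
        using zero H jt True by (auto simp: jet_interpolator_def)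
      then show ?thesis using True by (auto simp: lookup_minus lookup_single when_def)
    next
      case False
      then have "lookup (tay (v k) (H j t)) u = 0"
        using zero H jt ku(1) by (auto simp: jet_interpolator_def)
      then show ?thesis using False by simp
    qed
  qed
  have "lookup (tay (v k) (\<Sum>(j, t)\<in>{..<r} \<times> jets N D n. single 0 (c j t) * H j t)) u =
      (\<Sum>(j, t)\<in>{..<r} \<times> jets N D n. c j t * lookup (tay (v k) (H j t)) u)"
    by (simp add: tay_sum lookup_sum split_def tay_mult lookup_const_mult)
  also have "\<dots> = (\<Sum>p\<in>{..<r} \<times> jets N D n. if p = (k, u) then c k u else 0)"
  proof (intro sum.cong refl)
    fix p assume "p \<in> {..<r} \<times> jets N D n"
    then show "(case p of (j, t) \<Rightarrow> c j t * lookup (tay (v k) (H j t)) u) = (if p = (k, u) then c k u else 0)"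
      using coeff by (cases p) auto
  qed
  also have "\<dots> = c k u"
    using ku by simp
  finally have "c k u = 0"
    using ordw_lookup[OF S[OF ku(1)], of u] ku by (auto simp: jets_def)
  with ku show False by simp
qed

lemma monomial_split:
  assumes "keys t \<subseteq> {..N}" "a \<le> wt t"
  shows "\<exists>e f. t = e + f \<and> wt e = a \<and> mono_deg e = a \<and> keys e \<subseteq> {..N} \<and> keys f \<subseteq> {..N}"
  using assms(2)
proof (induction a)
  case 0
  then show ?case using assms(1) by (intro exI[of _ 0] exI[of _ t]) auto
next
  case (Suc a)
  then obtain e f where ef: "t = e + f" "wt e = a" "mono_deg e = a" "keys e \<subseteq> {..N}" "keys f \<subseteq> {..N}" by auto
  then have "wt f > 0" using Suc.prems by (simp add: wt_add)
  obtain j f' where j: "0 < j" "j \<le> N" "f = single j 1 + f'" "keys f' \<subseteq> {..N}" "wt f = Suc (wt f')"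
    by (rule monomial_factor[OF ef(5) \<open>wt f > 0\<close>])
  have "keys (e + single j 1) \<subseteq> {..N}"
    using keys_add[of e "single j 1"] ef(4) j(2) by auto
  then show ?case
    using ef j by (intro exI[of _ "e + single j 1"] exI[of _ f']) (auto simp: wt_add mono_deg_add ac_simps)
qed

text \<open>The first factor takes as many of the variables x_1, ..., x_N in \<open>t\<close> as
  \<open>n\<close> allows and is filled up to degree \<open>D\<close> with x_0. The bounds
  \<open>n \<le> D\<close> and \<open>n' \<le> D'\<close> ensure that \<open>t\<close> contains
  enough factors x_0.\<close>

lemma jets_split:
  assumes t: "t \<in> jets N (D + D') (n + n')" and "n \<le> D" "n' \<le> D'"
  obtains a b where "t = a + b" "a \<in> jets N D n" "b \<in> jets N D' n'"
proof -
  have t': "keys t \<subseteq> {..N}" "mono_deg t = D + D'" "wt t \<le> n + n'"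
    using t by (auto simp: jets_def monomials_def)
  define w where "w = min n (wt t)"
  obtain e f where ef: "t = e + f" "wt e = w" "mono_deg e = w" "keys e \<subseteq> {..N}" "keys f \<subseteq> {..N}"
    using monomial_split[OF t'(1), of w] by (auto simp: w_def)
  define b where "b = f - single 0 (D - w)"
  have "lookup e 0 = 0" using ef(2,3) mono_deg_wt[of e] by simp
  then have "lookup f 0 = D + D' - wt t"
    using ef(1) t'(2) mono_deg_wt[of t] by (simp add: lookup_add)
  then have "D - w \<le> lookup f 0"
    using t'(3) assms(2,3) by (auto simp: w_def min_def)
  then have f: "f = single 0 (D - w) + b"
    unfolding b_def by (intro poly_mapping_eqI) (auto simp: lookup_add lookup_minus lookup_single when_def)
  have wD: "w \<le> D" using assms(2) by (simp add: w_def)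
  have "keys (e + single 0 (D - w)) \<subseteq> {..N}"
    using keys_add[of e "single 0 (D - w)"] ef(4) by (auto split: if_splits)
  moreover have "mono_deg (e + single 0 (D - w)) = D"
    using ef(3) wD by (simp add: mono_deg_add)
  moreover have "wt (e + single 0 (D - w)) \<le> n"
    using ef(2) by (simp add: wt_add w_def)
  ultimately have 1: "e + single 0 (D - w) \<in> jets N D n"
    by (simp add: jets_def monomials_def)
  have teq: "t = (e + single 0 (D - w)) + b" using ef(1) f by (simp add: ac_simps)
  have "i \<in> keys f" if "i \<in> keys b" for i
    using that by (simp add: b_def in_keys_pos[symmetric] lookup_minus)
  then have "keys b \<subseteq> {..N}" using ef(5) by blast
  moreover have "mono_deg b = D'"
    using arg_cong[OF teq, of mono_deg] t'(2) ef(3) wD by (simp add: mono_deg_add)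
  moreover have "wt b \<le> n'"
    using arg_cong[OF teq, of wt] t'(3) ef(2) by (simp add: wt_add w_def min_def split: if_splits)
  ultimately have 2: "b \<in> jets N D' n'"
    by (simp add: jets_def monomials_def)
  show thesis by (rule that[OF teq 1 2])
qed

text \<open>For \<open>t = a + b\<close> the product of the forms for \<open>a\<close> and
  \<open>b\<close> works: leading terms multiply, and at the other points the orders add up.\<close>

lemma jet_interpolator_add:
  assumes H: "jet_interpolator N r v D n H" "n \<le> D" and H': "jet_interpolator N r v D' n' H'" "n' \<le> D'"
  shows "\<exists>K. jet_interpolator N r v (D + D') (n + n') K"
proof -
  have "\<exists>K. i < r \<longrightarrow> t \<in> jets N (D + D') (n + n') \<longrightarrow> K \<in> forms N (D + D') \<and>
    ordw (Suc (wt t)) (tay (v i) K - single t 1) \<and> (\<forall>j<r. j \<noteq> i \<longrightarrow> ordw (Suc (wt t)) (tay (v j) K))" for i t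
  proof (cases "i < r \<and> t \<in> jets N (D + D') (n + n')")
    case True
    then have i: "i < r" and t: "t \<in> jets N (D + D') (n + n')" by auto
    obtain a b where ab: "t = a + b" "a \<in> jets N D n" "b \<in> jets N D' n'"
      by (rule jets_split[OF t H(2) H'(2)])
    let ?A = "H i a" and ?B = "H' i b"
    have A: "?A \<in> forms N D" "ordw (Suc (wt a)) (tay (v i) ?A - single a 1)"
        "\<And>j. j < r \<Longrightarrow> j \<noteq> i \<Longrightarrow> ordw (Suc (wt a)) (tay (v j) ?A)"
      using H(1) i ab(2) by (auto simp: jet_interpolator_def)
    have B: "?B \<in> forms N D'" "ordw (Suc (wt b)) (tay (v i) ?B - single b 1)"
        "\<And>j. j < r \<Longrightarrow> j \<noteq> i \<Longrightarrow> ordw (Suc (wt b)) (tay (v j) ?B)"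
      using H'(1) i ab(3) by (auto simp: jet_interpolator_def)
    have "ordw (wt b) (tay (v i) ?B - single b 1)"
      by (rule ordw_mono[OF B(2)]) simp
    moreover have "ordw (wt b) (single b 1 :: (nat, 'a) mpoly)" "ordw (wt a) (single a 1 :: (nat, 'a) mpoly)"
      by (auto simp: ordw_single)
    ultimately have Bb: "ordw (wt b) (tay (v i) ?B)"
      using ordw_add[of "wt b" "tay (v i) ?B - single b 1" "single b 1"] by simp
    have "tay (v i) (?A * ?B) - single t 1 =
        (tay (v i) ?A - single a 1) * tay (v i) ?B + single a 1 * (tay (v i) ?B - single b 1)"
      using ab(1) by (simp add: tay_mult algebra_simps mult_single)
    moreover have "ordw (Suc (wt t)) ((tay (v i) ?A - single a 1) * tay (v i) ?B)"
      using ordw_mult[OF A(2) Bb] ab(1) by (simp add: wt_add)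
    moreover have "ordw (Suc (wt t)) (single a 1 * (tay (v i) ?B - single b 1))"
      using ordw_mult[OF \<open>ordw (wt a) (single a 1)\<close> B(2)] ab(1) by (simp add: wt_add)
    ultimately have "ordw (Suc (wt t)) (tay (v i) (?A * ?B) - single t 1)"
      by (simp add: ordw_add)
    moreover have "ordw (Suc (wt t)) (tay (v j) (?A * ?B))" if "j < r" "j \<noteq> i" for j
      using ordw_mono[OF ordw_mult[OF A(3)[OF that] B(3)[OF that]], of "Suc (wt t)"] ab(1)
      by (simp add: tay_mult wt_add)
    ultimately show ?thesis
      using forms_mult[OF A(1) B(1)] by (intro exI[of _ "?A * ?B"]) auto
  qed auto
  then obtain K where "\<forall>i t. i < r \<longrightarrow> t \<in> jets N (D + D') (n + n') \<longrightarrow> K i t \<in> forms N (D + D') \<and>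
    ordw (Suc (wt t)) (tay (v i) (K i t) - single t 1) \<and> (\<forall>j<r. j \<noteq> i \<longrightarrow> ordw (Suc (wt t)) (tay (v j) (K i t)))"
    by metis
  then show ?thesis unfolding jet_interpolator_def by blast
qed

lemma jet_interpolator_multiple:
  assumes "jet_interpolator N r v D n H" "n \<le> D" "T > 0"
  shows "\<exists>K. jet_interpolator N r v (T * D) (T * n) K"
  using assms(3)
proof (induction T rule: nat_induct_non_zero)
  case 1
  then show ?case using assms(1) by auto
next
  case (Suc T)
  then obtain K where "jet_interpolator N r v (T * D) (T * n) K" by auto
  from jet_interpolator_add[OF assms(1,2) this] show ?case using assms(2) by simp
qed

text \<open>Multiplication by \<open>F\<close> embeds the forms of degree \<open>D - d\<close> with vanishing jets of order \<open>n - q\<close> into the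
  forms of degree \<open>D\<close> with vanishing jets of order \<open>n\<close>. The interpolating forms span a complement of the latter.\<close>

lemma jet_interpolator_count:
  assumes H: "jet_interpolator N r v D n H" "n \<le> D"
    and F: "F \<in> forms N d" "F \<noteq> 0" "\<And>i. i < r \<Longrightarrow> ordw q (tay (v i) F)"
    and "d \<le> D" "q \<le> n"
  shows "((N + (D - d)) choose N) + r * ((N + n) choose N) \<le>
    r * ((N + (n - q)) choose N) + ((N + D) choose N)"
proof (rule ccontr)
  assume neg: "\<not> ?thesis"
  \<comment> \<open>Unknowns are the coefficients of a form \<open>g\<close> of degree
    \<open>D - d\<close> and of a combination \<open>S\<close> of the interpolating forms. The
    equations \<open>E\<close> say that the jets of \<open>g\<close> up to order
    \<open>n - q\<close> vanish at the points and that \<open>F * g + S = 0\<close>. If the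
    inequality failed, there would be a nontrivial solution.\<close>
  define T where "T = monomials N (D - d) <+> ({..<r} \<times> jets N D n)"
  define E where "E = ({..<r} \<times> jets N (D - d) (n - q)) <+> monomials N D"
  define A :: "(nat \<times> nat monomial) + nat monomial \<Rightarrow> nat monomial + (nat \<times> nat monomial) \<Rightarrow> 'a"
    where "A e x = (case e of
      Inl p \<Rightarrow> (case x of Inl u \<Rightarrow> lookup (tay (v (fst p)) (single u 1)) (snd p) | Inr _ \<Rightarrow> 0)
    | Inr t \<Rightarrow> (case x of Inl u \<Rightarrow> lookup (F * single u 1) t | Inr p \<Rightarrow> lookup (H (fst p) (snd p)) t))" for e x
  have "card E \<le> r * ((N + (n - q)) choose N) + ((N + D) choose N)"
    unfolding E_def by (simp add: card_Plus card_cartesian_product card_monomials card_jets_le)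
  also have "\<dots> < card T"
    using neg unfolding T_def by (simp add: card_Plus card_cartesian_product card_monomials card_jets[OF H(2)])
  finally have cards: "card E < card T" .
  have fin: "finite E" "finite T" by (auto simp: E_def T_def)
  obtain c where c: "\<exists>x\<in>T. c x \<noteq> 0" "\<And>e. e \<in> E \<Longrightarrow> (\<Sum>x\<in>T. A e x * c x) = 0"
    using linear_system_solution[OF fin cards, of A] by auto
  have sum_T: "(\<Sum>x\<in>T. f x) = (\<Sum>u\<in>monomials N (D - d). f (Inl u)) + (\<Sum>p\<in>{..<r} \<times> jets N D n. f (Inr p))"
    for f :: "nat monomial + (nat \<times> nat monomial) \<Rightarrow> 'a"
    unfolding T_def by (subst sum.Plus) (auto simp: comp_def)
  define g where "g = (\<Sum>u\<in>monomials N (D - d). single 0 (c (Inl u)) * single u 1)"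
  define S where "S = (\<Sum>(j, t)\<in>{..<r} \<times> jets N D n. single 0 (c (Inr (j, t))) * H j t)"
  have g_forms: "g \<in> forms N (D - d)"
    unfolding g_def by (intro forms_sum forms_const_mult forms_single)
  have S_forms: "S \<in> forms N D"
    unfolding S_def using H(1) by (intro forms_sum) (auto simp: jet_interpolator_def intro!: forms_const_mult)
  have ord_g: "ordw (Suc (n - q)) (tay (v i) g)" if i: "i < r" for i
    unfolding ordw_def
  proof
    fix t assume t: "t \<in> keys (tay (v i) g)"
    then have tm: "t \<in> monomials N (D - d)"
      using tay_forms[OF g_forms, of "v i"] by (auto simp: forms_iff_keys)
    show "Suc (n - q) \<le> wt t"
    proof (rule ccontr)
      assume "\<not> Suc (n - q) \<le> wt t"
      then have "Inl (i, t) \<in> E" using i tm by (auto simp: E_def jets_def)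
      from c(2)[OF this] have "(\<Sum>u\<in>monomials N (D - d). lookup (tay (v i) (single u 1)) t * c (Inl u)) = 0"
        by (simp add: sum_T A_def)
      then have "lookup (tay (v i) g) t = 0"
        by (simp add: g_def tay_sum tay_mult lookup_sum lookup_const_mult mult.commute)
      with t show False by (simp add: in_keys_iff)
    qed
  qed
  have FgS: "F * g + S = 0"
  proof (rule poly_mapping_eqI)
    fix t
    show "lookup (F * g + S) t = lookup 0 t"
    proof (cases "t \<in> monomials N D")
      case True
      then have "Inr t \<in> E" by (auto simp: E_def)
      from c(2)[OF this] have "(\<Sum>u\<in>monomials N (D - d). c (Inl u) * lookup (F * single u 1) t) +
          (\<Sum>p\<in>{..<r} \<times> jets N D n. c (Inr p) * lookup (H (fst p) (snd p)) t) = 0"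
        by (simp add: sum_T A_def mult.commute)
      moreover have "F * g = (\<Sum>u\<in>monomials N (D - d). single 0 (c (Inl u)) * (F * single u 1))"
        by (simp add: g_def sum_distrib_left ac_simps)
      ultimately show ?thesis
        by (simp add: S_def lookup_add lookup_sum lookup_const_mult split_def)
    next
      case False
      have "F * g + S \<in> forms N D"
        using forms_mult[OF F(1) g_forms] S_forms assms(6) by (simp add: forms_add)
      then show ?thesis
        using False not_in_keys_iff_lookup_eq_zero[of t "F * g + S"] by (auto simp: forms_iff_keys)
    qed
  qed
  then have S: "S = - (F * g)" by (simp add: eq_neg_iff_add_eq_0 add.commute)
  have "ordw (Suc n) (tay (v i) S)" if "i < r" for i
  proof -
    have "ordw (Suc n) (tay (v i) F * tay (v i) g)"
      using ordw_mult[OF F(3)[OF that] ord_g[OF that]] assms(7) by simp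
    moreover have "tay (v i) S = - (tay (v i) F * tay (v i) g)"
      using tay_diff[of "v i" 0 "F * g"] by (simp add: S tay_mult)
    ultimately show ?thesis by (simp add: ordw_uminus)
  qed
  \<comment> \<open>\<open>S\<close> is the negative of \<open>F * g\<close> and hence vanishes to
    order above \<open>n\<close> at all points, so its coefficients are zero; then \<open>g\<close>
    is zero because the ring is a domain.\<close>
  then have cr: "c (Inr (i, t)) = 0" if "i < r" "t \<in> jets N D n" for i t
    using jet_interpolator_independent[OF H(1), of "\<lambda>j t. c (Inr (j, t))"] that unfolding S_def by blast
  then have "S = 0" unfolding S_def by (intro sum.neutral) auto
  then have "F * g = 0" using FgS by simp
  then have "g = 0" using F(2) by simp
  have "c (Inl u) = 0" if "u \<in> monomials N (D - d)" for u
  proof -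
    have "lookup g u = (\<Sum>x\<in>monomials N (D - d). if x = u then c (Inl u) else 0)"
      unfolding g_def lookup_sum lookup_const_mult lookup_single by (intro sum.cong) (auto simp: when_def)
    then show ?thesis using that \<open>g = 0\<close> by simp
  qed
  then show False using c(1) cr by (auto simp: T_def)
qed

text \<open>Pascal's rule applied \<open>d\<close> times, with each increment bounded from above by
  its value at \<open>x + d\<close>; \<open>choose_add_ge\<close> bounds it from below by its value
  at \<open>x\<close>.\<close>

lemma choose_add_le: "N > 0 \<Longrightarrow> (x + d) choose N \<le> (x choose N) + d * ((x + d) choose (N - 1))"
proof (induction d)
  case (Suc d)
  have "(x + Suc d) choose N = ((x + d) choose N) + ((x + d) choose (N - 1))"
    using Suc.prems by (cases N) auto
  also have "\<dots> \<le> (x choose N) + d * ((x + d) choose (N - 1)) + ((x + d) choose (N - 1))"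
    using Suc by simp
  also have "\<dots> = (x choose N) + Suc d * ((x + d) choose (N - 1))" by simp
  also have "\<dots> \<le> (x choose N) + Suc d * ((x + Suc d) choose (N - 1))"
    by (intro add_left_mono mult_left_mono binomial_right_mono) auto
  finally show ?case .
qed simp

lemma choose_add_ge: "N > 0 \<Longrightarrow> (x choose N) + d * (x choose (N - 1)) \<le> (x + d) choose N"
proof (induction d)
  case (Suc d)
  have "(x choose N) + Suc d * (x choose (N - 1)) \<le> ((x + d) choose N) + ((x + d) choose (N - 1))"
    using Suc binomial_right_mono[of x "x + d" "N - 1"] by simp
  also have "\<dots> = (x + Suc d) choose N"
    using Suc.prems by (cases N) auto
  finally show ?case .
qed simp

text \<open>The binomial coefficient is a polynomial in \<open>T\<close> whose coefficient at T^k is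
  n^k / k!.\<close>

lemma choose_linear_limit:
  "(\<lambda>T. real ((a + T * n) choose k) / real T ^ k) \<longlonglongrightarrow> real n ^ k / fact k"
proof -
  have lim: "(\<lambda>T. (real (a + T * n) - real i) / real T) \<longlonglongrightarrow> real n" for i
  proof -
    have "(\<lambda>T. real n + (real a - real i) / real T) \<longlonglongrightarrow> real n + 0"
      by (intro tendsto_intros lim_const_over_n)
    moreover have "eventually (\<lambda>T. real n + (real a - real i) / real T = (real (a + T * n) - real i) / real T) sequentially"
      using eventually_gt_at_top[of 0] by eventually_elim (simp add: field_simps)
    ultimately have "(\<lambda>T. (real (a + T * n) - real i) / real T) \<longlonglongrightarrow> real n + 0"
      by (rule Lim_transform_eventually)
    then show ?thesis by simp
  qed
  have "(\<lambda>T. (\<Prod>i<k. (real (a + T * n) - real i) / real T) / fact k) \<longlonglongrightarrow> (\<Prod>i<k. real n) / fact k"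
    by (intro tendsto_divide tendsto_prod lim tendsto_const) auto
  moreover have "(\<Prod>i<k. (real (a + T * n) - real i) / real T) / fact k = real ((a + T * n) choose k) / real T ^ k" for T
    by (simp add: binomial_gbinomial gbinomial_prod_rev prod_dividef atLeast0LessThan)
  ultimately show ?thesis by simp
qed

text \<open>In \<open>jet_interpolator_count\<close> for the multiples \<open>T * D\<close> and
  \<open>T * n\<close> the terms of order T^N cancel. What remains has order T^(N - 1), and its
  leading coefficients give the bound.\<close>

theorem jet_interpolator_bound:
  assumes H: "jet_interpolator N r v D n H" "n \<le> D"
    and F: "F \<in> forms N d" "F \<noteq> 0" "\<And>i. i < r \<Longrightarrow> ordw q (tay (v i) F)"
    and "N > 0" "n > 0"
  shows "r * q * n ^ (N - 1) \<le> d * D ^ (N - 1)"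
proof -
  have ineq: "r * (q * ((N + (T * n - q)) choose (N - 1))) \<le> d * ((N + T * D) choose (N - 1))"
    if T: "T \<ge> d + q" "T > 0" for T
  proof -
    have "T \<le> T * n" using assms(7) by simp
    then have "q \<le> T * n" "d \<le> T * n" using T(1) by linarith+
    moreover have "T * n \<le> T * D" using H(2) by simp
    ultimately have "d \<le> T * D" "q \<le> T * n" "T * n \<le> T * D" by linarith+
    obtain K where K: "jet_interpolator N r v (T * D) (T * n) K"
      using jet_interpolator_multiple[OF H T(2)] by blast
    have "((N + (T * D - d)) choose N) + r * ((N + T * n) choose N) \<le>
        r * ((N + (T * n - q)) choose N) + ((N + T * D) choose N)"
      using jet_interpolator_count[OF K \<open>T * n \<le> T * D\<close> F \<open>d \<le> T * D\<close> \<open>q \<le> T * n\<close>] by simp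
    moreover have "((N + T * D) choose N) \<le> ((N + (T * D - d)) choose N) + d * ((N + T * D) choose (N - 1))"
      using choose_add_le[OF assms(6), of "N + (T * D - d)" d] \<open>d \<le> T * D\<close> by simp
    moreover have "r * ((N + (T * n - q)) choose N) + r * (q * ((N + (T * n - q)) choose (N - 1))) \<le> r * ((N + T * n) choose N)"
      using mult_left_mono[OF choose_add_ge[OF assms(6), of "N + (T * n - q)" q], of r] \<open>q \<le> T * n\<close>
      by (simp add: distrib_left)
    ultimately show ?thesis by linarith
  qed
  let ?k = "N - 1"
  have "(\<lambda>T. real ((N + (T * n - q)) choose ?k) / real T ^ ?k) \<longlonglongrightarrow> real n ^ ?k / fact ?k"
  proof -
    \<comment> \<open>Shifting \<open>T\<close> by \<open>q\<close> turns the truncated difference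
      \<open>(T + q) * n - q\<close> into \<open>(n * q - q) + T * n\<close>, which is linear in
      \<open>T\<close>.\<close>
    have "(\<lambda>T. real ((N + (n * q - q) + T * n) choose ?k) / real T ^ ?k * (real T / real (T + q)) ^ ?k) \<longlonglongrightarrow> real n ^ ?k / fact ?k * 1 ^ ?k"
    proof (intro tendsto_mult choose_linear_limit tendsto_power)
      have "(\<lambda>T. 1 - real q / real (T + q)) \<longlonglongrightarrow> 1 - 0"
        by (intro tendsto_intros LIMSEQ_ignore_initial_segment[OF lim_const_over_n])
      moreover have "eventually (\<lambda>T. 1 - real q / real (T + q) = real T / real (T + q)) sequentially"
        using eventually_gt_at_top[of 0] by eventually_elim (simp add: field_simps)
      ultimately have "(\<lambda>T. real T / real (T + q)) \<longlonglongrightarrow> 1 - 0"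
        by (rule Lim_transform_eventually)
      then show "(\<lambda>T. real T / real (T + q)) \<longlonglongrightarrow> 1" by simp
    qed
    moreover have "eventually (\<lambda>T. real ((N + (n * q - q) + T * n) choose ?k) / real T ^ ?k * (real T / real (T + q)) ^ ?k =
        real ((N + ((T + q) * n - q)) choose ?k) / real (T + q) ^ ?k) sequentially"
      using eventually_gt_at_top[of 0]
    proof eventually_elim
      case (elim T)
      obtain n' where "n = Suc n'" using assms(7) by (cases n) auto
      then have eq: "N + (n * q - q) + T * n = N + ((T + q) * n - q)" by (simp add: algebra_simps)
      show ?case unfolding eq using elim by (simp add: power_divide)
    qed
    ultimately have "(\<lambda>T. real ((N + ((T + q) * n - q)) choose ?k) / real (T + q) ^ ?k) \<longlonglongrightarrow> real n ^ ?k / fact ?k * 1 ^ ?k"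
      by (rule Lim_transform_eventually)
    from LIMSEQ_offset[OF this] show ?thesis by simp
  qed
  then have "(\<lambda>T. real r * (real q * (real ((N + (T * n - q)) choose ?k) / real T ^ ?k))) \<longlonglongrightarrow>
      real r * (real q * (real n ^ ?k / fact ?k))"
    by (intro tendsto_mult_left)
  moreover have "(\<lambda>T. real d * (real ((N + T * D) choose ?k) / real T ^ ?k)) \<longlonglongrightarrow> real d * (real D ^ ?k / fact ?k)"
    by (intro tendsto_mult_left choose_linear_limit)
  moreover have "\<exists>M. \<forall>T\<ge>M. real r * (real q * (real ((N + (T * n - q)) choose ?k) / real T ^ ?k)) \<le>
      real d * (real ((N + T * D) choose ?k) / real T ^ ?k)"
  proof (intro exI[of _ "Suc (d + q)"] allI impI)
    fix T assume "T \<ge> Suc (d + q)"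
    then have "real (r * (q * ((N + (T * n - q)) choose ?k))) \<le> real (d * ((N + T * D) choose ?k))"
      by (intro of_nat_mono ineq) auto
    then have "real (r * (q * ((N + (T * n - q)) choose ?k))) / real T ^ ?k \<le> real (d * ((N + T * D) choose ?k)) / real T ^ ?k"
      by (rule divide_right_mono) simp
    then show "real r * (real q * (real ((N + (T * n - q)) choose ?k) / real T ^ ?k)) \<le>
      real d * (real ((N + T * D) choose ?k) / real T ^ ?k)" by simp
  qed
  ultimately have "real r * (real q * (real n ^ ?k / fact ?k)) \<le> real d * (real D ^ ?k / fact ?k)"
    by (rule LIMSEQ_le)
  then have "real (r * q * n ^ ?k) \<le> real (d * D ^ ?k)"
    by (simp add: field_simps)
  then show ?thesis by (simp only: of_nat_le_iff)
qed

section \<open>Multihomogeneous functions of tuples of points\<close>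

text \<open>Multihomogeneous polynomials of degree \<open>\<delta> i\<close> in the coordinates of
  the i-th point, represented by the functions they define. Only values matter below, and closure
  properties follow by induction.\<close>

inductive mform :: "nat \<Rightarrow> nat \<Rightarrow> (nat \<Rightarrow> nat) \<Rightarrow> ((nat \<Rightarrow> nat \<Rightarrow> 'k::comm_ring_1) \<Rightarrow> 'k) \<Rightarrow> bool"
  for N s \<delta> where
  mform_zero: "mform N s \<delta> (\<lambda>_. 0)"
| mform_monomial: "(\<And>i. i < s \<Longrightarrow> T i \<in> monomials N (\<delta> i)) \<Longrightarrow> mform N s \<delta> (\<lambda>v. c * (\<Prod>i<s. mev (v i) (T i)))"
| mform_add: "mform N s \<delta> f \<Longrightarrow> mform N s \<delta> g \<Longrightarrow> mform N s \<delta> (\<lambda>v. f v + g v)"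

lemma monomials_0 [simp]: "0 \<in> monomials N 0"
  by (simp add: monomials_def)

lemma monomials_add: "a \<in> monomials N d \<Longrightarrow> b \<in> monomials N e \<Longrightarrow> a + b \<in> monomials N (d + e)"
  using keys_add[of a b] by (auto simp: monomials_def mono_deg_add)

lemma mform_const: "mform N s (\<lambda>_. 0) (\<lambda>_. c)"
  using mform_monomial[of s "\<lambda>_. 0" N "\<lambda>_. 0" c] by simp

lemma mform_cong: "mform N s \<delta> f \<Longrightarrow> (\<And>i. i < s \<Longrightarrow> \<delta> i = \<epsilon> i) \<Longrightarrow> mform N s \<epsilon> f"
proof (induction rule: mform.induct)
  case (mform_monomial T c)
  then show ?case by (intro mform.mform_monomial) auto
qed (auto intro: mform.intros)

lemma mform_mult_monomial:
  assumes "mform N s \<delta> f" "\<And>i. i < s \<Longrightarrow> T i \<in> monomials N (\<epsilon> i)"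
  shows "mform N s (\<lambda>i. \<delta> i + \<epsilon> i) (\<lambda>v. f v * (c * (\<Prod>i<s. mev (v i) (T i))))"
  using assms(1)
proof (induction rule: mform.induct)
  case mform_zero
  then show ?case by (simp add: mform.mform_zero)
next
  case (mform_monomial T' c')
  have "mform N s (\<lambda>i. \<delta> i + \<epsilon> i) (\<lambda>v. (c' * c) * (\<Prod>i<s. mev (v i) (T' i + T i)))"
    by (rule mform.mform_monomial) (use mform_monomial assms(2) in \<open>auto intro: monomials_add\<close>)
  then show ?case by (simp add: mev_add prod.distrib ac_simps)
next
  case (mform_add f g)
  then show ?case by (simp add: distrib_right mform.mform_add)
qed

lemma mform_mult:
  assumes "mform N s \<delta> f" "mform N s \<epsilon> g"
  shows "mform N s (\<lambda>i. \<delta> i + \<epsilon> i) (\<lambda>v. f v * g v)"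
  using assms(2)
proof (induction rule: mform.induct)
  case mform_zero
  then show ?case by (simp add: mform.mform_zero)
next
  case (mform_monomial T c)
  then show ?case by (intro mform_mult_monomial assms(1))
next
  case (mform_add g h)
  then show ?case by (simp add: distrib_left mform.mform_add)
qed

lemma mform_scale: "mform N s \<delta> f \<Longrightarrow> mform N s \<delta> (\<lambda>v. c * f v)"
  using mform_mult[OF mform_const] by fastforce

lemma mform_sum: "(\<And>a. a \<in> A \<Longrightarrow> mform N s \<delta> (f a)) \<Longrightarrow> mform N s \<delta> (\<lambda>v. \<Sum>a\<in>A. f a v)"
  by (induction A rule: infinite_finite_induct) (auto intro: mform.intros)

lemma mform_prod:
  "(\<And>a. a \<in> A \<Longrightarrow> mform N s (\<delta> a) (f a)) \<Longrightarrow> mform N s (\<lambda>i. \<Sum>a\<in>A. \<delta> a i) (\<lambda>v. \<Prod>a\<in>A. f a v)"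
  by (induction A rule: infinite_finite_induct) (auto intro: mform_const mform_mult)

lemma mform_power: "mform N s \<delta> f \<Longrightarrow> mform N s (\<lambda>i. n * \<delta> i) (\<lambda>v. f v ^ n)"
  by (induction n) (auto intro: mform_const mform_mult)

lemma mform_mev:
  assumes "i < s" "t \<in> monomials N e"
  shows "mform N s (\<lambda>k. if k = i then e else 0) (\<lambda>v. mev (v i) t)"
proof -
  have "(\<Prod>k<s. mev (v k) (if k = i then t else 0)) = mev (v i) t" for v :: "nat \<Rightarrow> nat \<Rightarrow> 'a"
  proof -
    have "(\<Prod>k<s. mev (v k) (if k = i then t else 0)) = (\<Prod>k<s. if k = i then mev (v i) t else 1)"
      by (intro prod.cong) auto
    then show ?thesis using assms(1) by simp
  qed
  then show ?thesis
    using mform_monomial[of s "\<lambda>k. if k = i then t else 0" N "\<lambda>k. if k = i then e else 0" "1::'a"] assms(2) by simp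
qed

text \<open>Relabelling the points permutes the degrees, hence the restriction to equal
  degrees.\<close>

lemma mform_permute:
  assumes "mform N s (\<lambda>_. e) f" "\<sigma> permutes {..<s}"
  shows "mform N s (\<lambda>_. e) (\<lambda>v. f (\<lambda>i. v (\<sigma> i)))"
  using assms(1)
proof (induction rule: mform.induct)
  case (mform_monomial T c)
  have "(\<Prod>i<s. mev (v (\<sigma> i)) (T i)) = (\<Prod>i<s. mev (v i) (T (Hilbert_Choice.inv \<sigma> i)))" for v :: "nat \<Rightarrow> nat \<Rightarrow> 'a"
    using prod.permute[OF assms(2), of "\<lambda>i. mev (v i) (T (Hilbert_Choice.inv \<sigma> i))"] permutes_inverses(2)[OF assms(2)]
    by (simp add: comp_def)
  moreover have "mform N s (\<lambda>_. e) (\<lambda>v. c * (\<Prod>i<s. mev (v i) (T (Hilbert_Choice.inv \<sigma> i))))"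
    using mform_monomial permutes_in_image[OF permutes_inv[OF assms(2)]]
    by (intro mform.mform_monomial) auto
  ultimately show ?case by simp
qed (auto intro: mform.intros)

lemma mform_scale_points:
  assumes "mform N s \<delta> f"
  shows "f (\<lambda>i j. c i * v i j) = (\<Prod>i<s. c i ^ \<delta> i) * f v"
  using assms
proof (induction rule: mform.induct)
  case (mform_monomial T a)
  have "(\<Prod>i<s. mev (\<lambda>j. c i * v i j) (T i)) = (\<Prod>i<s. c i ^ \<delta> i * mev (v i) (T i))"
    using mform_monomial by (intro prod.cong) (auto simp: mev_scale monomials_def)
  then show ?case by (simp add: prod.distrib ac_simps)
qed (auto simp: distrib_left)

lemma mform_line:
  assumes "mform N s \<delta> f"
  shows "\<exists>p. \<forall>x. poly p x = f (\<lambda>i j. v i j + x * (w i j - v i j))"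
  using assms
proof (induction rule: mform.induct)
  case mform_zero
  then show ?case by (intro exI[of _ 0]) simp
next
  case (mform_monomial T c)
  have "poly (mev (\<lambda>j. [:v i j, w i j - v i j:]) t) x = mev (\<lambda>j. v i j + x * (w i j - v i j)) t" for i t x
    by (simp add: mev_def poly_prod)
  then show ?case
    by (intro exI[of _ "smult c (\<Prod>i<s. mev (\<lambda>j. [:v i j, w i j - v i j:]) (T i))"]) (simp add: poly_prod)
next
  case (mform_add f g)
  then obtain p q where "\<forall>x. poly p x = f (\<lambda>i j. v i j + x * (w i j - v i j))"
      "\<forall>x. poly q x = g (\<lambda>i j. v i j + x * (w i j - v i j))" by blast
  then show ?case by (intro exI[of _ "p + q"]) simp
qed

text \<open>On the line through \<open>v\<close> and \<open>w\<close> both functions are univariate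
  polynomials, nonzero at the parameters 0 and 1 respectively, so their product has only finitely
  many roots.\<close>

lemma mform_common_nonzero:
  fixes f g :: "(nat \<Rightarrow> nat \<Rightarrow> 'k::field) \<Rightarrow> 'k"
  assumes "infinite (UNIV :: 'k set)" "mform N s \<delta> f" "mform N s \<epsilon> g" "f v \<noteq> 0" "g w \<noteq> 0"
  obtains x where "f (\<lambda>i j. v i j + x * (w i j - v i j)) \<noteq> 0" "g (\<lambda>i j. v i j + x * (w i j - v i j)) \<noteq> 0"
proof -
  obtain p where p: "\<forall>x. poly p x = f (\<lambda>i j. v i j + x * (w i j - v i j))" using mform_line[OF assms(2)] by blast
  obtain q where q: "\<forall>x. poly q x = g (\<lambda>i j. v i j + x * (w i j - v i j))" using mform_line[OF assms(3)] by blast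
  have "poly p 0 \<noteq> 0" "poly q 1 \<noteq> 0" using p q assms(4,5) by simp_all
  then have "p * q \<noteq> 0" by auto
  then have "finite {x. poly (p * q) x = 0}" by (rule poly_roots_finite)
  then obtain x where "poly (p * q) x \<noteq> 0" using assms(1) by (metis (mono_tags, lifting) UNIV_eq_I mem_Collect_eq)
  then show thesis using p q that[of x] by simp
qed

lemma mform_prod_nonzero:
  fixes f :: "'a \<Rightarrow> (nat \<Rightarrow> nat \<Rightarrow> 'k::field) \<Rightarrow> 'k"
  assumes "infinite (UNIV :: 'k set)" "finite A" "\<And>a. a \<in> A \<Longrightarrow> mform N s (\<delta> a) (f a)" "\<And>a. a \<in> A \<Longrightarrow> \<exists>v. f a v \<noteq> 0"
  shows "\<exists>v. (\<Prod>a\<in>A. f a v) \<noteq> 0"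
  using assms(2-4)
proof (induction A)
  case (insert a A)
  then obtain v where "(\<Prod>a\<in>A. f a v) \<noteq> 0" by auto
  moreover obtain w where "f a w \<noteq> 0" using insert.prems by auto
  moreover have "mform N s (\<lambda>i. \<Sum>a\<in>A. \<delta> a i) (\<lambda>v. \<Prod>a\<in>A. f a v)"
    using insert.prems by (intro mform_prod) auto
  ultimately obtain x where
    "(\<Prod>a\<in>A. f a (\<lambda>i j. v i j + x * (w i j - v i j))) \<noteq> 0" "f a (\<lambda>i j. v i j + x * (w i j - v i j)) \<noteq> 0"
    using mform_common_nonzero[OF assms(1), of N s _ "\<lambda>v. \<Prod>a\<in>A. f a v" "\<delta> a" "f a" v w] insert.prems(1)[of a]
    by auto
  then show ?case using insert.hyps by (intro exI[of _ "\<lambda>i j. v i j + x * (w i j - v i j)"]) simp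
qed auto

section \<open>Taylor coefficients as functions of the point\<close>

lemma finite_add_decompositions: "finite {(a, b). a + b = (t :: nat monomial)}"
proof -
  define n where "n = Max (insert 0 (keys t))"
  have n: "keys t \<subseteq> {..n}" by (auto simp: n_def)
  have "{(a, b). a + b = t} \<subseteq> (\<Union>d\<le>mono_deg t. monomials n d) \<times> (\<Union>d\<le>mono_deg t. monomials n d)"
  proof clarify
    fix a b assume t: "t = a + b"
    have "keys a \<subseteq> keys t" "keys b \<subseteq> keys t"
      by (auto simp: t in_keys_pos[symmetric] lookup_add)
    then show "a \<in> (\<Union>d\<le>mono_deg (a + b). monomials n d) \<and> b \<in> (\<Union>d\<le>mono_deg (a + b). monomials n d)"
      using n by (auto simp: monomials_def mono_deg_add)
  qed
  then show ?thesis by (rule finite_subset) auto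
qed

text \<open>The index set depends on \<open>t\<close> and not on the supports of the factors, so the
  same formula holds while \<open>f\<close> and \<open>g\<close> vary with the points.\<close>

lemma lookup_times:
  fixes f g :: "(nat, 'k::comm_ring_1) mpoly"
  shows "lookup (f * g) t = (\<Sum>(a, b)\<in>{(a, b). a + b = t}. lookup f a * lookup g b)"
proof -
  let ?h = "\<lambda>(a, b). lookup f a * lookup g b"
  have "f * g = (\<Sum>a\<in>keys f. \<Sum>b\<in>keys g. single (a + b) (lookup f a * lookup g b))"
    by (subst poly_mapping_sum_single[of f], subst poly_mapping_sum_single[of g])
      (simp add: sum_product mult_single)
  also have "\<dots> = (\<Sum>(a, b)\<in>keys f \<times> keys g. single (a + b) (lookup f a * lookup g b))"
    by (simp add: sum.cartesian_product)
  finally have "lookup (f * g) t = (\<Sum>(a, b)\<in>keys f \<times> keys g. lookup (single (a + b) (lookup f a * lookup g b)) t)"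
    by (simp add: lookup_sum split_def)
  also have "\<dots> = (\<Sum>p\<in>keys f \<times> keys g. if fst p + snd p = t then ?h p else 0)"
    by (intro sum.cong) (auto simp: lookup_single when_def)
  also have "\<dots> = sum ?h ((keys f \<times> keys g) \<inter> {(a, b). a + b = t})"
    by (subst sum.inter_restrict) (auto intro!: sum.cong)
  also have "\<dots> = sum ?h {(a, b). a + b = t}"
    using finite_add_decompositions[of t]
    by (intro sum.mono_neutral_left) (auto dest!: mult_not_zero simp: in_keys_iff)
  finally show ?thesis .
qed

text \<open>In \<open>tay_gen\<close> each coordinate of the point comes with one factor x_0. The
  coefficient at \<open>t\<close> therefore has degree \<open>lookup t 0\<close> in the point, which
  is additive under products.\<close>

lemma mform_lookup_times:
  fixes F G :: "(nat \<Rightarrow> nat \<Rightarrow> 'k) \<Rightarrow> (nat, 'k::comm_ring_1) mpoly"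
  assumes "\<And>t. mform N s (\<lambda>k. if k = i then lookup t 0 else 0) (\<lambda>v. lookup (F v) t)"
    and "\<And>t. mform N s (\<lambda>k. if k = i then lookup t 0 else 0) (\<lambda>v. lookup (G v) t)"
  shows "mform N s (\<lambda>k. if k = i then lookup t 0 else 0) (\<lambda>v. lookup (F v * G v) t)"
proof -
  have "mform N s (\<lambda>k. if k = i then lookup t 0 else 0)
      (\<lambda>v. \<Sum>p\<in>{(a, b). a + b = t}. lookup (F v) (fst p) * lookup (G v) (snd p))"
  proof (rule mform_sum)
    fix p assume "p \<in> {(a, b). a + b = t}"
    then have t: "t = fst p + snd p" by auto
    show "mform N s (\<lambda>k. if k = i then lookup t 0 else 0) (\<lambda>v. lookup (F v) (fst p) * lookup (G v) (snd p))"
      by (rule mform_cong[OF mform_mult[OF assms(1)[of "fst p"] assms(2)[of "snd p"]]]) (simp add: t lookup_add)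
  qed
  then show ?thesis by (simp add: lookup_times split_def)
qed

lemma mform_lookup_const:
  fixes c :: "(nat, 'k::comm_ring_1) mpoly"
  assumes "\<And>t. lookup c t \<noteq> 0 \<Longrightarrow> lookup t 0 = 0"
  shows "mform N s (\<lambda>k. if k = i then lookup t 0 else 0) (\<lambda>v. lookup c t)"
proof (cases "lookup c t = 0")
  case True
  then show ?thesis by (simp add: mform_zero)
next
  case False
  then have "lookup t 0 = 0" by (rule assms)
  then show ?thesis by (intro mform_cong[OF mform_const]) auto
qed

lemma mform_lookup_tay:
  fixes f :: "(nat, 'k::comm_ring_1) mpoly"
  assumes "i < s" "f \<in> carr N"
  shows "mform N s (\<lambda>k. if k = i then lookup t 0 else 0) (\<lambda>v. lookup (tay (v i) f) t)"
proof -
  let ?\<delta> = "\<lambda>(t :: nat monomial) k. if k = i then lookup t 0 else 0"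
  have var: "mform N s (?\<delta> t) (\<lambda>v :: nat \<Rightarrow> nat \<Rightarrow> 'k. lookup (tay_gen (v i) j) t)" if "j \<le> N" for j t
  proof -
    have "mform N s (?\<delta> t) (\<lambda>v :: nat \<Rightarrow> nat \<Rightarrow> 'k. lookup (single (single 0 1) (v i j)) t)"
    proof (cases "t = single 0 1")
      case True
      have "mform N s (\<lambda>k. if k = i then 1 else 0) (\<lambda>v :: nat \<Rightarrow> nat \<Rightarrow> 'k. mev (v i) (single j 1))"
        by (rule mform_mev[OF assms(1)]) (use that in \<open>simp add: monomials_def\<close>)
      then have "mform N s (?\<delta> t) (\<lambda>v :: nat \<Rightarrow> nat \<Rightarrow> 'k. mev (v i) (single j 1))"
        by (rule mform_cong) (simp add: True)
      then show ?thesis by (simp add: True)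
    next
      case False
      then show ?thesis by (simp add: lookup_single when_def mform_zero)
    qed
    moreover have "mform N s (?\<delta> t) (\<lambda>v :: nat \<Rightarrow> nat \<Rightarrow> 'k. lookup (if j = 0 then 0 else var j :: (nat, 'k) mpoly) t)"
      by (rule mform_lookup_const) (auto simp: var_def lookup_single when_def split: if_splits)
    ultimately show ?thesis unfolding tay_gen_def lookup_add by (rule mform_add)
  qed
  have one: "mform N s (?\<delta> t) (\<lambda>v :: nat \<Rightarrow> nat \<Rightarrow> 'k. lookup (1 :: (nat, 'k) mpoly) t)" for t
    by (rule mform_lookup_const) (auto simp: lookup_one when_def split: if_splits)
  have pow: "mform N s (?\<delta> t) (\<lambda>v :: nat \<Rightarrow> nat \<Rightarrow> 'k. lookup (tay_gen (v i) j ^ n) t)" if "j \<le> N" for j n t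
  proof (induction n arbitrary: t)
    case 0
    then show ?case using one by simp
  next
    case (Suc n)
    then show ?case unfolding power_Suc by (intro mform_lookup_times var that)
  qed
  have prod: "mform N s (?\<delta> t) (\<lambda>v :: nat \<Rightarrow> nat \<Rightarrow> 'k. lookup (\<Prod>j\<in>A. tay_gen (v i) j ^ lookup T j) t)" if "finite A" "A \<subseteq> {..N}" for A T t
    using that
  proof (induction A arbitrary: t)
    case empty
    then show ?case using one by simp
  next
    case (insert j A)
    have "mform N s (?\<delta> t) (\<lambda>v :: nat \<Rightarrow> nat \<Rightarrow> 'k. lookup (tay_gen (v i) j ^ lookup T j * (\<Prod>j\<in>A. tay_gen (v i) j ^ lookup T j)) t)"
      by (rule mform_lookup_times) (use insert pow in auto)
    then show ?case using insert by simp
  qed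
  have "mform N s (?\<delta> t) (\<lambda>v :: nat \<Rightarrow> nat \<Rightarrow> 'k. \<Sum>T\<in>keys f. lookup f T * lookup (mev (tay_gen (v i)) T) t)"
    using assms(2) unfolding mev_def
    by (intro mform_sum mform_scale prod) (auto simp: carr_iff)
  moreover have "lookup (tay v f) t = (\<Sum>T\<in>keys f. lookup f T * lookup (mev (tay_gen v) T) t)" for v
    by (simp add: tay_def subst_eq lookup_sum lookup_const_mult)
  ultimately show ?thesis by simp
qed

section \<open>Interpolation of jets is an open condition\<close>

text \<open>The forms \<open>H\<close> stay fixed while the points move. Their jets at
  \<open>v\<close> form a square matrix that is invertible at \<open>v0\<close>; wherever it is
  invertible, suitable combinations of the same forms interpolate at \<open>v\<close>.\<close>

lemma jet_interpolator_open:
  fixes v0 :: "nat \<Rightarrow> nat \<Rightarrow> 'k::field"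
  assumes H: "jet_interpolator N r v0 D n H" and "r \<le> s"
  shows "\<exists>\<delta> \<Psi>. mform N s \<delta> \<Psi> \<and> \<Psi> v0 \<noteq> 0 \<and> (\<forall>v. \<Psi> v \<noteq> 0 \<longrightarrow> (\<exists>K. jet_interpolator N r v D n K))"
proof -
  define I where "I = {..<r} \<times> jets N D n"
  define R where "R = card I"
  have "finite I" by (simp add: I_def)
  then obtain \<iota> where "bij_betw \<iota> {0..<card I} I" using ex_bij_betw_nat_finite by blast
  then have \<iota>: "bij_betw \<iota> {0..<R} I" by (simp add: R_def)
  then have \<iota>I: "\<iota> a \<in> I" if "a < R" for a using that by (auto simp: bij_betw_def)
  have \<iota>_ex: "\<exists>a<R. \<iota> a = p" if "p \<in> I" for p
    using that unfolding bij_betw_imp_surj_on[OF \<iota>, symmetric] by auto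
  define h where "h b = H (fst (\<iota> b)) (snd (\<iota> b))" for b
  have h: "h b \<in> forms N D" if "b < R" for b
    using H \<iota>I[OF that] by (auto simp: h_def jet_interpolator_def I_def)
  define e where "e v a b = lookup (tay (v (fst (\<iota> a))) (h b)) (snd (\<iota> a))" for v :: "nat \<Rightarrow> nat \<Rightarrow> 'k" and a b
  define M where "M v = mat R R (\<lambda>(a, b). e v a b)" for v
  have M: "M v \<in> carrier_mat R R" for v by (simp add: M_def)
  define \<Psi> where "\<Psi> v = det (M v)" for v
  define \<delta> where "\<delta> k = (\<Sum>a\<in>{0..<R}. if k = fst (\<iota> a) then lookup (snd (\<iota> a)) 0 else 0)" for k
  have e_form: "mform N s (\<lambda>k. if k = fst (\<iota> a) then lookup (snd (\<iota> a)) 0 else 0) (\<lambda>v. e v a b)"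
    if "a < R" "b < R" for a b
    unfolding e_def using h[OF that(2)] \<iota>I[OF that(1)] assms(2)
    by (intro mform_lookup_tay) (auto simp: I_def forms_iff)
  have sum_form: "mform N s \<delta> (\<lambda>v. \<Sum>p\<in>{p. p permutes {0..<R}}. signof p * (\<Prod>a\<in>{0..<R}. e v a (p a)))"
    unfolding \<delta>_def
  proof (intro mform_sum mform_scale mform_prod e_form)
    fix p a assume "p \<in> {p. p permutes {0..<R}}" "a \<in> {0..<R}"
    then show "a < R" "p a < R" using permutes_in_image[of p "{0..<R}" a] by auto
  qed
  have \<Psi>_eq: "\<Psi> v = (\<Sum>p\<in>{p. p permutes {0..<R}}. signof p * (\<Prod>a\<in>{0..<R}. e v a (p a)))" for v
    unfolding \<Psi>_def det_def'[OF M]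
  proof (intro sum.cong refl arg_cong2[where f = "(*)"] prod.cong)
    fix p a assume "p \<in> {p. p permutes {0..<R}}" "a \<in> {0..<R}"
    then show "M v $$ (a, p a) = e v a (p a)"
      using permutes_in_image[of p "{0..<R}" a] by (auto simp: M_def)
  qed
  have 1: "mform N s \<delta> \<Psi>" using sum_form by (simp only: ext[OF \<Psi>_eq])
  have ord: "ordw (Suc n) (tay (v i) f)"
    if "f \<in> forms N D" "\<And>t. t \<in> jets N D n \<Longrightarrow> lookup (tay (v i) f) t = 0" for v :: "nat \<Rightarrow> nat \<Rightarrow> 'k" and i f
    unfolding ordw_def
  proof (intro ballI)
    fix t assume t: "t \<in> keys (tay (v i) f)"
    then have "t \<in> monomials N D" using tay_forms[OF that(1), of "v i"] by (auto simp: forms_iff_keys)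
    moreover have "t \<notin> jets N D n" using that(2)[of t] t by auto
    ultimately show "Suc n \<le> wt t" by (auto simp: jets_def)
  qed
  have 2: "\<Psi> v0 \<noteq> 0"
  proof
    \<comment> \<open>A kernel vector would be a nontrivial combination of the forms
      \<open>H\<close> whose jets vanish at all points, against
      \<open>jet_interpolator_independent\<close>.\<close>
    assume "\<Psi> v0 = 0"
    then obtain x where x: "x \<in> carrier_vec R" "x \<noteq> 0\<^sub>v R" "M v0 *\<^sub>v x = 0\<^sub>v R"
      using det_0_iff_vec_prod_zero_field[OF M] by (auto simp: \<Psi>_def)
    define c where "c i t = x $ (inv_into {0..<R} \<iota> (i, t))" for i t
    have c: "c (fst (\<iota> b)) (snd (\<iota> b)) = x $ b" if "b < R" for b
      using bij_betw_inv_into_left[OF \<iota>, of b] that by (simp add: c_def)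
    define S where "S = (\<Sum>(j, t)\<in>{..<r} \<times> jets N D n. single 0 (c j t) * H j t)"
    have S: "S = (\<Sum>b\<in>{0..<R}. single 0 (x $ b) * h b)"
      unfolding S_def I_def[symmetric] sum.reindex_bij_betw[OF \<iota>, symmetric]
      by (intro sum.cong) (auto simp: split_def c h_def)
    have S_forms: "S \<in> forms N D"
      unfolding S by (intro forms_sum forms_const_mult h) auto
    have "ordw (Suc n) (tay (v0 i) S)" if i: "i < r" for i
    proof (rule ord[OF S_forms])
      fix t assume "t \<in> jets N D n"
      then have "(i, t) \<in> I" using i by (simp add: I_def)
      from \<iota>_ex[OF this] obtain a where a: "a < R" "\<iota> a = (i, t)" by blast
      have "lookup (tay (v0 i) S) t = (\<Sum>b\<in>{0..<R}. x $ b * e v0 a b)"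
        by (simp add: S tay_sum tay_mult lookup_sum lookup_const_mult e_def a)
      also have "\<dots> = (M v0 *\<^sub>v x) $ a"
        using a x(1) by (simp add: M_def scalar_prod_def mult.commute)
      finally show "lookup (tay (v0 i) S) t = 0" using x(3) a by simp
    qed
    then have "c i t = 0" if "i < r" "t \<in> jets N D n" for i t
      using jet_interpolator_independent[OF H, of c i t] that unfolding S_def by blast
    then have "x $ b = 0" if "b < R" for b
      using c[OF that] \<iota>I[OF that] by (cases "\<iota> b") (auto simp: I_def)
    then have "x = 0\<^sub>v R" using x(1) by (intro eq_vecI) auto
    with x(2) show False by simp
  qed
  have 3: "\<exists>K. jet_interpolator N r v D n K" if nz: "\<Psi> v \<noteq> 0" for v
  proof -
    obtain B where B: "B \<in> carrier_mat R R" "M v * B = 1\<^sub>m R"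
      using det_non_zero_imp_unit[OF M, of v] nz by (auto simp: \<Psi>_def Units_def ring_mat_def)
    \<comment> \<open>The columns of the inverse matrix give dual forms, which even interpolate
      exactly up to order \<open>n\<close>.\<close>
    define K where "K i t = (\<Sum>b\<in>{0..<R}. single 0 (B $$ (b, inv_into {0..<R} \<iota> (i, t))) * h b)" for i t
    have K_forms: "K i t \<in> forms N D" for i t
      unfolding K_def by (intro forms_sum forms_const_mult h) auto
    have lookup_K: "lookup (tay (v j) (K i t)) u = (if (j, u) = (i, t) then 1 else 0)"
      if it: "(i, t) \<in> I" and ju: "(j, u) \<in> I" for i t j u
    proof -
      obtain a where a: "a < R" "\<iota> a = (i, t)" using \<iota>_ex[OF it] by blast
      obtain b where b: "b < R" "\<iota> b = (j, u)" using \<iota>_ex[OF ju] by blast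
      have inv: "inv_into {0..<R} \<iota> (i, t) = a"
        using bij_betw_inv_into_left[OF \<iota>, of a] a by simp
      have "lookup (tay (v j) (K i t)) u = (\<Sum>c\<in>{0..<R}. B $$ (c, a) * e v b c)"
        by (simp add: K_def inv tay_sum tay_mult lookup_sum lookup_const_mult e_def b)
      also have "\<dots> = (M v * B) $$ (b, a)"
        using a b B(1) by (simp add: M_def scalar_prod_def mult.commute)
      also have "\<dots> = (if b = a then 1 else 0)" using a b B(2) by simp
      also have "b = a \<longleftrightarrow> (j, u) = (i, t)"
        using a b bij_betw_inv_into_left[OF \<iota>] by (metis atLeastLessThan_iff le0)
      finally show ?thesis .
    qed
    have "jet_interpolator N r v D n K"
      unfolding jet_interpolator_def
    proof (intro allI impI ballI conjI)
      fix i t assume it: "i < r" "t \<in> jets N D n"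
      then have wt: "Suc (wt t) \<le> Suc n" by (simp add: jets_def)
      show "K i t \<in> forms N D" by (rule K_forms)
      have tf: "single t 1 \<in> forms N D"
        using it(2) by (intro forms_single) (simp add: jets_def)
      show "ordw (Suc (wt t)) (tay (v i) (K i t) - single t 1)"
        unfolding ordw_def
      proof (intro ballI)
        fix u assume u: "u \<in> keys (tay (v i) (K i t) - single t 1)"
        then have um: "u \<in> monomials N D"
          using forms_diff[OF tay_forms[OF K_forms] tf] by (auto simp: forms_iff_keys)
        have "lookup (tay (v i) (K i t) - single t 1) u = 0" if "u \<in> jets N D n"
          using lookup_K[of i t i u] it that by (auto simp: I_def lookup_minus lookup_single when_def)
        then have "u \<notin> jets N D n" using u by auto
        then show "Suc (wt t) \<le> wt u" using um wt by (auto simp: jets_def)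
      qed
      fix j assume j: "j < r" "j \<noteq> i"
      show "ordw (Suc (wt t)) (tay (v j) (K i t))"
        by (rule ordw_mono[OF ord[OF K_forms] wt]) (use lookup_K it j in \<open>auto simp: I_def\<close>)
    qed
    then show ?thesis by blast
  qed
  show ?thesis using 1 2 3 by (intro exI[of _ \<delta>] exI[of _ \<Psi>]) simp
qed

section \<open>Grids\<close>

text \<open>For nonzero \<open>c\<close> the part of lowest weight is a single term. Such leading
  terms multiply, so for products of linear forms they can be read off from the factors.\<close>

definition lead :: "nat monomial \<Rightarrow> 'k \<Rightarrow> (nat, 'k::comm_ring_1) mpoly \<Rightarrow> bool"
  where "lead t c f \<longleftrightarrow> ordw (Suc (wt t)) (f - single t c)"

lemma lead_ordw: "lead t c f \<Longrightarrow> ordw (wt t) f"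
  using ordw_add[of "wt t" "f - single t c" "single t c"] ordw_mono[of "Suc (wt t)" "f - single t c" "wt t"]
  by (simp add: lead_def ordw_single)

lemma lead_mult:
  assumes "lead t c f" "lead u d g"
  shows "lead (t + u) (c * d) (f * g)"
proof -
  have "f * g - single (t + u) (c * d) = (f - single t c) * g + single t c * (g - single u d)"
    by (simp add: algebra_simps mult_single)
  moreover have "ordw (Suc (wt (t + u))) ((f - single t c) * g)"
    using ordw_mult[OF assms(1)[unfolded lead_def] lead_ordw[OF assms(2)]] by (simp add: wt_add)
  moreover have "ordw (wt t) (single t c)" by (simp add: ordw_single)
  then have "ordw (Suc (wt (t + u))) (single t c * (g - single u d))"
    using ordw_mult[OF _ assms(2)[unfolded lead_def], of "wt t" "single t c"] by (simp add: wt_add)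
  ultimately show ?thesis by (simp add: lead_def ordw_add)
qed

lemma lead_single: "lead t c (single t c)"
  by (simp add: lead_def)

lemma lead_one: "lead 0 1 1"
  using lead_single[of 0 1] by simp

lemma lead_prod: "(\<And>a. a \<in> A \<Longrightarrow> lead (t a) (c a) (f a)) \<Longrightarrow> lead (\<Sum>a\<in>A. t a) (\<Prod>a\<in>A. c a) (\<Prod>a\<in>A. f a)"
  by (induction A rule: infinite_finite_induct) (auto intro: lead_mult lead_one)

lemma lead_power:
  assumes "lead t c f"
  shows "lead (\<Sum>j<n. t) (\<Prod>j<n. c) (f ^ n)"
proof -
  have "f ^ n = (\<Prod>j<n. f)" by simp
  then show ?thesis using assms by (simp only:) (rule lead_prod)
qed

lemma lead_lookup: "lead t c f \<Longrightarrow> lookup f t = c"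
  using ordw_lookup[of "Suc (wt t)" "f - single t c" t] by (simp add: lead_def lookup_minus)

lemma ordw_prod:
  fixes f :: "'a \<Rightarrow> (nat, 'k::comm_ring_1) mpoly"
  shows "(\<And>a. a \<in> A \<Longrightarrow> ordw (w a) (f a)) \<Longrightarrow> ordw (\<Sum>a\<in>A. w a) (\<Prod>a\<in>A. f a)"
  by (induction A rule: infinite_finite_induct) (auto intro: ordw_mult)

lemma wt_cong:
  assumes "\<And>i. i \<noteq> 0 \<Longrightarrow> lookup a i = lookup b i"
  shows "wt a = wt b"
proof -
  let ?A = "keys a \<union> keys b"
  have "wt a = (\<Sum>i\<in>?A. (if i = 0 then 0 else 1) * lookup a i)"
    "wt b = (\<Sum>i\<in>?A. (if i = 0 then 0 else 1) * lookup b i)"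
    unfolding wt_def by (rule wdeg_superset; auto)+
  moreover have "(\<Sum>i\<in>?A. (if i = 0 then 0 else 1) * lookup a i) = (\<Sum>i\<in>?A. (if i = 0 then 0 else 1) * lookup b i)"
    using assms by (intro sum.cong) auto
  ultimately show ?thesis by simp
qed

lemma monomial_eqI:
  fixes a b :: "nat monomial"
  assumes "mono_deg a = mono_deg b" "\<And>i. i \<noteq> 0 \<Longrightarrow> lookup a i = lookup b i"
  shows "a = b"
proof (rule poly_mapping_eqI)
  fix i
  have "lookup a 0 = lookup b 0"
    using assms(1) wt_cong[OF assms(2)] by (simp add: mono_deg_wt)
  then show "lookup a i = lookup b i" using assms(2)[of i] by (cases "i = 0") auto
qed

lemma wt_eq_sum: "keys t \<subseteq> {..N} \<Longrightarrow> wt t = (\<Sum>i\<in>{1..N}. lookup t i)"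
proof -
  assume "keys t \<subseteq> {..N}"
  then have "wt t = (\<Sum>i\<le>N. (if i = 0 then 0 else 1) * lookup t i)"
    unfolding wt_def by (intro wdeg_superset) auto
  also have "\<dots> = (\<Sum>i\<in>{1..N}. lookup t i)"
    by (intro sum.mono_neutral_cong_right) auto
  finally show ?thesis .
qed

definition lin :: "nat \<Rightarrow> 'k \<Rightarrow> (nat, 'k::comm_ring_1) mpoly"
  where "lin i c = var i - single 0 c * var 0"

lemma lin_forms: "i \<le> N \<Longrightarrow> lin i c \<in> forms N 1"
  unfolding lin_def by (intro forms_diff forms_const_mult forms_var) auto

lemma tay_lin:
  assumes "v 0 = 1" "0 < i"
  shows "tay v (lin i c) = var i + single (single 0 1) (v i - c)"
proof -
  have "tay v (lin i c) = tay_gen v i - single 0 c * tay_gen v 0"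
    by (simp only: lin_def tay_diff tay_mult tay_const tay_var)
  also have "tay_gen v i = single (single 0 1) (v i) + var i" using assms by (simp add: tay_gen_def)
  also have "single 0 c * tay_gen v 0 = single (single 0 1) c" using assms by (simp add: tay_gen_def mult_single)
  finally show ?thesis by (simp add: single_diff)
qed

lemma lead_lin:
  assumes "v 0 = 1" "0 < i"
  shows "lead (if c = v i then single i 1 else single 0 1) (if c = v i then 1 else v i - c) (tay v (lin i c))"
  unfolding tay_lin[of v i c, OF assms] using assms(2)
  by (auto simp: lead_def var_def ordw_single)

lemma ordw_lin_zero:
  assumes "v 0 = 1" "0 < i" "c = v i"
  shows "ordw 1 (tay v (lin i c))"
  unfolding tay_lin[of v i c, OF assms(1,2)] using assms by (simp add: var_def ordw_single)

lemma ordw_prod_zero: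
  fixes f :: "'a \<Rightarrow> (nat, 'k::comm_ring_1) mpoly"
  assumes "finite A" "a \<in> A" "ordw 1 (f a)"
  shows "ordw 1 (\<Prod>a\<in>A. f a)"
  using ordw_mult_right[OF assms(3), of "\<Prod>a\<in>A - {a}. f a"] prod.remove[OF assms(1,2), of f]
  by (simp add: mult.commute)

text \<open>For \<open>p\<close> in the grid \<open>S\<^sup>N\<close>, the product of the powers of the equations
  \<open>\<Prod>\<^sub>c (x\<^sub>i - c)\<close> of the grid with the Lagrange polynomial of \<open>p\<close>.\<close>

definition grid_form :: "'k set \<Rightarrow> nat \<Rightarrow> nat \<Rightarrow> (nat \<Rightarrow> 'k) \<Rightarrow> nat monomial \<Rightarrow> (nat, 'k::comm_ring_1) mpoly"
  where "grid_form S N D p t =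
    (\<Prod>i\<in>{1..N}. (\<Prod>j<lookup t i. \<Prod>c\<in>S. lin i c) * (\<Prod>c\<in>S - {p i}. lin i c)) *
      var 0 ^ (D - (\<Sum>i\<in>{1..N}. lookup t i * card S + (card S - 1)))"

text \<open>For a jet of weight w the grid equations take degree w times \<open>card S\<close> and
  the Lagrange factors take N (card S - 1), so \<open>D\<close> leaves room for all w up to
  \<open>n\<close>.\<close>

context
  fixes S :: "'k::field set" and N D n :: nat
  assumes S: "finite S" and D: "n * card S + N * (card S - 1) \<le> D"
begin

lemma grid_form_forms:
  assumes t: "t \<in> jets N D n" and p: "\<And>i. i \<in> {1..N} \<Longrightarrow> p i \<in> S"
  shows "grid_form S N D p t \<in> forms N D"
proof -
  have "(\<Prod>i\<in>{1..N}. (\<Prod>j<lookup t i. \<Prod>c\<in>S. lin i c) * (\<Prod>c\<in>S - {p i}. lin i c)) \<in>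
      forms N (\<Sum>i\<in>{1..N}. (\<Sum>j<lookup t i. \<Sum>c\<in>S. 1) + (\<Sum>c\<in>S - {p i}. 1))"
    by (intro forms_prod forms_mult lin_forms) auto
  also have "(\<Sum>i\<in>{1..N}. (\<Sum>j<lookup t i. \<Sum>c\<in>S. 1) + (\<Sum>c\<in>S - {p i}. 1)) =
      (\<Sum>i\<in>{1..N}. lookup t i * card S + (card S - 1))"
    using S p by (intro sum.cong) (auto simp: card_Diff_singleton)
  finally have 1: "(\<Prod>i\<in>{1..N}. (\<Prod>j<lookup t i. \<Prod>c\<in>S. lin i c) * (\<Prod>c\<in>S - {p i}. lin i c)) \<in>
      forms N (\<Sum>i\<in>{1..N}. lookup t i * card S + (card S - 1))" .
  have "keys t \<subseteq> {..N}" "wt t \<le> n" using t by (auto simp: jets_def monomials_def)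
  then have "(\<Sum>i\<in>{1..N}. lookup t i) \<le> n" using wt_eq_sum by simp
  then have "(\<Sum>i\<in>{1..N}. lookup t i) * card S \<le> n * card S" by simp
  moreover have "(\<Sum>i\<in>{1..N}. lookup t i * card S + (card S - 1)) = (\<Sum>i\<in>{1..N}. lookup t i) * card S + N * (card S - 1)"
    by (simp add: sum.distrib sum_distrib_right)
  ultimately have le: "(\<Sum>i\<in>{1..N}. lookup t i * card S + (card S - 1)) \<le> D"
    using D by linarith
  have "var 0 ^ (D - (\<Sum>i\<in>{1..N}. lookup t i * card S + (card S - 1))) \<in>
      forms N ((D - (\<Sum>i\<in>{1..N}. lookup t i * card S + (card S - 1))) * 1)"
    by (intro forms_power forms_var) simp
  from forms_mult[OF 1 this] show ?thesis
    unfolding grid_form_def using le by simp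
qed

text \<open>At \<open>p\<close> each full product over \<open>S\<close> has exactly one vanishing
  factor, with leading term x_i; all other factors lead with a nonzero multiple of x_0. This gives
  the exponents of x_1, ..., x_N, and comparing degrees gives that of x_0.\<close>

lemma grid_form_lead:
  assumes t: "t \<in> jets N D n" and p: "\<And>i. i \<in> {1..N} \<Longrightarrow> p i \<in> S" "p 0 = 1"
  shows "\<exists>C. C \<noteq> 0 \<and> lead t C (tay p (grid_form S N D p t))"
proof -
  let ?u = "\<lambda>i c. if c = p i then single i 1 else single 0 1" and ?a = "\<lambda>i c. if c = p i then 1 else p i - c"
  let ?E = "D - (\<Sum>i\<in>{1..N}. lookup t i * card S + (card S - 1))"
  define \<tau> :: "nat monomial" where "\<tau> = (\<Sum>i\<in>{1..N}. (\<Sum>j<lookup t i. \<Sum>c\<in>S. ?u i c) + (\<Sum>c\<in>S - {p i}. ?u i c)) + (\<Sum>j<?E. single 0 1)"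
  define C where "C = (\<Prod>i\<in>{1..N}. (\<Prod>j<lookup t i. \<Prod>c\<in>S. ?a i c) * (\<Prod>c\<in>S - {p i}. ?a i c)) * (\<Prod>j<?E. 1)"
  have var0: "tay p (var 0) = single (single 0 1) 1"
    using p(2) by (simp add: tay_var tay_gen_def)
  have lead: "lead \<tau> C (tay p (grid_form S N D p t))"
    unfolding grid_form_def tay_mult tay_prod tay_power var0 \<tau>_def C_def
    by (intro lead_mult lead_prod lead_power lead_lin lead_single p(2)) auto
  have "C \<noteq> 0"
    using S by (auto simp: C_def)
  then have "\<tau> \<in> keys (tay p (grid_form S N D p t))"
    using lead_lookup[OF lead] by (simp add: in_keys_iff)
  then have deg: "mono_deg \<tau> = D"
    using tay_forms[OF grid_form_forms[OF t p(1)], where v = p] by (auto simp: forms_iff homogeneous_def)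
  have tm: "keys t \<subseteq> {..N}" "mono_deg t = D" using t by (auto simp: jets_def monomials_def)
  have "\<tau> = t"
  proof (rule monomial_eqI)
    show "mono_deg \<tau> = mono_deg t" using deg tm by simp
    fix k :: nat assume k: "k \<noteq> 0"
    have u: "lookup (?u i c) k = (if c = p i \<and> i = k then 1 else 0)" for i c
      using k by (auto simp: lookup_single)
    have "lookup \<tau> k = (\<Sum>i\<in>{1..N}. (\<Sum>j<lookup t i. \<Sum>c\<in>S. if c = p i \<and> i = k then 1 else 0) +
        (\<Sum>c\<in>S - {p i}. if c = p i \<and> i = k then 1 else 0))"
      unfolding \<tau>_def lookup_add lookup_sum u using k by (simp add: lookup_single)
    also have "\<dots> = (\<Sum>i\<in>{1..N}. if i = k then lookup t k else 0)"
    proof (rule sum.cong[OF refl])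
      fix i assume i: "i \<in> {1..N}"
      have "(\<Sum>c\<in>S. if c = p i \<and> i = k then 1 else 0) = (if i = k then 1 else 0 :: nat)"
        using p(1)[OF i] S by (cases "i = k") auto
      moreover have "(\<Sum>c\<in>S - {p i}. if c = p i \<and> i = k then 1 else 0) = (0 :: nat)"
        by (intro sum.neutral) auto
      ultimately show "(\<Sum>j<lookup t i. \<Sum>c\<in>S. if c = p i \<and> i = k then 1 else 0) +
        (\<Sum>c\<in>S - {p i}. if c = p i \<and> i = k then 1 else 0) = (if i = k then lookup t k else 0)" by auto
    qed
    also have "\<dots> = lookup t k"
    proof (cases "k \<le> N")
      case True
      then show ?thesis using k by simp
    next
      case False
      then have "k \<notin> keys t" using tm(1) by auto
      then show ?thesis using False by (simp add: not_in_keys_iff_lookup_eq_zero)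
    qed
    finally show "lookup \<tau> k = lookup t k" .
  qed
  with lead \<open>C \<noteq> 0\<close> show ?thesis by blast
qed

text \<open>The grid equations vanish at \<open>q\<close> as well and account for the order
  \<open>wt t\<close>. The Lagrange factors of a coordinate in which \<open>q\<close> differs from
  \<open>p\<close> add one more.\<close>

lemma grid_form_other:
  assumes t: "t \<in> jets N D n" and q: "\<And>i. i \<in> {1..N} \<Longrightarrow> q i \<in> S" "q 0 = 1"
    and i: "i \<in> {1..N}" "q i \<noteq> p i"
  shows "ordw (Suc (wt t)) (tay q (grid_form S N D p t))"
proof -
  let ?A = "\<lambda>i. \<Prod>j<lookup t i. \<Prod>c\<in>S. tay q (lin i c)" and ?B = "\<lambda>i. \<Prod>c\<in>S - {p i}. tay q (lin i c)"
  have zero: "ordw 1 (\<Prod>c\<in>S. tay q (lin j c))" if j: "j \<in> {1..N}" for j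
    using j q by (intro ordw_prod_zero[OF S q(1)[OF j]] ordw_lin_zero) auto
  have "ordw (\<Sum>j<lookup t i. 1) (?A i)" if "i \<in> {1..N}" for i
    by (intro ordw_prod zero that)
  then have "ordw (lookup t i) (?A i)" if "i \<in> {1..N}" for i
    using that by simp
  then have "ordw (\<Sum>i\<in>{1..N}. lookup t i) (\<Prod>i\<in>{1..N}. ?A i)"
    by (intro ordw_prod)
  then have 1: "ordw (wt t) (\<Prod>i\<in>{1..N}. ?A i)"
    using t by (simp add: wt_eq_sum[of t N] jets_def monomials_def)
  have "ordw 1 (?B i)"
    using i q S by (intro ordw_prod_zero[of _ "q i"] ordw_lin_zero) auto
  then have "ordw 1 (\<Prod>i\<in>{1..N}. ?B i)"
    by (rule ordw_prod_zero[OF _ i(1), rotated]) simp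
  from ordw_mult[OF 1 this] have "ordw (Suc (wt t)) (\<Prod>i\<in>{1..N}. ?A i * ?B i)"
    by (simp add: prod.distrib)
  then show ?thesis
    unfolding grid_form_def tay_mult tay_prod tay_power by (subst mult.commute) (rule ordw_mult_right)
qed

lemma grid_jet_interpolator:
  "\<exists>(v :: nat \<Rightarrow> nat \<Rightarrow> 'k) H. (\<forall>i. v i 0 = 1) \<and> jet_interpolator N (card S ^ N) v D n H"
proof -
  define X where "X = {1..N} \<rightarrow>\<^sub>E S"
  have "finite X" "card X = card S ^ N"
    using S by (auto simp: X_def card_PiE intro: finite_PiE)
  then obtain e where e: "bij_betw e {0..<card S ^ N} X"
    using ex_bij_betw_nat_finite by metis
  define v where "v j i = (if i = 0 then 1 else e j i)" for j i
  have v0: "v j 0 = 1" for j by (simp add: v_def)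
  have vS: "v j i \<in> S" if "j < card S ^ N" "i \<in> {1..N}" for i j
  proof -
    have "e j \<in> X" using e that(1) by (auto simp: bij_betw_def)
    then show ?thesis using that(2) by (auto simp: X_def v_def PiE_def)
  qed
  have distinct: "\<exists>k\<in>{1..N}. v j k \<noteq> v i k" if "i < card S ^ N" "j < card S ^ N" "j \<noteq> i" for i j
  proof (rule ccontr)
    assume "\<not> (\<exists>k\<in>{1..N}. v j k \<noteq> v i k)"
    then have "e j k = e i k" if "k \<in> {1..N}" for k
      using that by (auto simp: v_def split: if_splits)
    moreover have "e i \<in> X" "e j \<in> X" using bij_betwE[OF e] that by auto
    ultimately have "e j = e i" unfolding X_def by (intro PiE_ext[of "e j" _ _ "e i"]) auto
    then show False using inj_onD[OF bij_betw_imp_inj_on[OF e], of j i] that by auto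
  qed
  have "\<exists>C. j < card S ^ N \<longrightarrow> t \<in> jets N D n \<longrightarrow> C \<noteq> 0 \<and> lead t C (tay (v j) (grid_form S N D (v j) t))" for j t
  proof (cases "j < card S ^ N \<and> t \<in> jets N D n")
    case True
    then have "\<exists>C. C \<noteq> 0 \<and> lead t C (tay (v j) (grid_form S N D (v j) t))"
      by (intro grid_form_lead) (auto simp: vS v0)
    then show ?thesis by (elim ex_forward) simp
  qed auto
  then obtain C where C: "\<And>j t. j < card S ^ N \<Longrightarrow> t \<in> jets N D n \<Longrightarrow> C j t \<noteq> 0 \<and> lead t (C j t) (tay (v j) (grid_form S N D (v j) t))"
    by metis
  \<comment> \<open>Dividing by the leading coefficient \<open>C j t\<close> makes the form start
    with \<open>t\<close> itself.\<close>
  have J: "jet_interpolator N (card S ^ N) v D n (\<lambda>j t. single 0 (inverse (C j t)) * grid_form S N D (v j) t)"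
    unfolding jet_interpolator_def
  proof (intro allI impI ballI conjI)
    fix i t assume it: "i < card S ^ N" "t \<in> jets N D n"
    show "single 0 (inverse (C i t)) * grid_form S N D (v i) t \<in> forms N D"
      using it vS by (intro forms_const_mult grid_form_forms) auto
    have "lead (0 + t) (inverse (C i t) * C i t) (single 0 (inverse (C i t)) * tay (v i) (grid_form S N D (v i) t))"
      using C[OF it] by (intro lead_mult lead_single) auto
    then show "ordw (Suc (wt t)) (tay (v i) (single 0 (inverse (C i t)) * grid_form S N D (v i) t) - single t 1)"
      using C[OF it] by (simp add: tay_mult lead_def)
    fix j assume j: "j < card S ^ N" "j \<noteq> i"
    from distinct[OF it(1) j] obtain k where "k \<in> {1..N}" "v j k \<noteq> v i k" by (rule bexE)
    then show "ordw (Suc (wt t)) (tay (v j) (single 0 (inverse (C i t)) * grid_form S N D (v i) t))"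
      unfolding tay_mult using it j vS v0 by (intro ordw_mult_right grid_form_other) auto
  qed
  with v0 show ?thesis by (intro exI conjI allI)
qed

end

section \<open>Numerical estimates\<close>

lemma real_choose: "real (x choose N) = (\<Prod>i<N. real x - real i) / fact N"
  by (simp add: binomial_gbinomial gbinomial_prod_rev atLeast0LessThan)

text \<open>The factors with index \<open>i\<close> and \<open>N - 1 - i\<close> are estimated together.\<close>

lemma power_mult_choose_le:
  fixes N m k :: nat
  assumes "N \<ge> 3" "k \<ge> 2 * m + 2"
  defines "M \<equiv> m + N - 1"
  shows "(k + 1) ^ N * (M choose N) \<le> (k * M) choose N"
proof (cases "m = 0")
  case True
  then have "M < N" using assms by (simp add: M_def)
  then show ?thesis by (simp add: binomial_eq_0)
next
  case m: False
  have M: "N \<le> M" "real M = real m + real N - 1" using assms m by (auto simp: M_def of_nat_diff)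
  define P where "P = (\<Prod>i<N. real (k * M) - real i)"
  define Q where "Q = (\<Prod>i<N. real M - real i)"
  have rev: "(\<Prod>i<N. x - real i) = (\<Prod>i<N. x - real (N - 1 - i))" for x
    by (rule prod.reindex_bij_witness[of _ "\<lambda>i. N - 1 - i" "\<lambda>i. N - 1 - i"]) auto
  have step: "((real k + 1) * (real k + 1)) * ((real M - real i) * (real M - real (N - 1 - i))) \<le>
      (real (k * M) - real i) * (real (k * M) - real (N - 1 - i))" if "i < N" for i
  proof -
    \<comment> \<open>The paired factors for \<open>k * M\<close> are \<open>a + W\<close> and
      \<open>b + W\<close>. It is enough that W is at least k \<sigma> / 2, because (a + k \<sigma>
      / 2) (b + k \<sigma> / 2) exceeds (k + 1)^2 a b by a nonnegative multiple of (a -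
      b)^2.\<close>
    define a b \<sigma> W where "a = real M - real i" and "b = real M - real (N - 1 - i)" and "\<sigma> = a + b" and "W = (real k - 1) * real M"
    have ab: "0 \<le> a" "0 \<le> b" using that M(1) by (auto simp: a_def b_def)
    have s: "\<sigma> = 2 * real m + real N - 1" using that M(2) by (simp add: \<sigma>_def a_def b_def of_nat_diff)
    \<comment> \<open>This is where \<open>k \<ge> 2 * m + 2\<close> enters: (2 m + 1) (N - 1)
      exceeds \<sigma> = 2 m + N - 1 by 2 m (N - 2), and 2 W = (k - 1) (\<sigma> + N - 1).\<close>
    have "(2 * real m + 1) * (real N - 1) \<le> (real k - 1) * (real N - 1)"
      using assms by (intro mult_right_mono) auto
    moreover have "2 * real m * (real N - 2) \<ge> 0" using assms by auto
    ultimately have "(real k - 1) * (real N - 1) \<ge> \<sigma>" by (simp add: s algebra_simps)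
    then have "k * \<sigma> \<le> 2 * W" by (simp add: W_def s M(2) algebra_simps)
    define c where "c = real k / 2"
    have k2: "real k = 2 * c" by (simp add: c_def)
    have W: "c * \<sigma> \<le> W" using \<open>k * \<sigma> \<le> 2 * W\<close> by (simp add: k2)
    have cs: "0 \<le> c * \<sigma>" using ab by (simp add: \<sigma>_def c_def)
    have "0 \<le> (c + c * c) * ((a - b) * (a - b))" by (rule mult_nonneg_nonneg) (auto simp: c_def)
    then have "((real k + 1) * (real k + 1)) * (a * b) \<le> (a + c * \<sigma>) * (b + c * \<sigma>)"
      unfolding k2 by (simp add: \<sigma>_def algebra_simps)
    also have "\<dots> \<le> (a + W) * (b + W)"
      using W cs ab by (intro mult_mono) auto
    also have "\<dots> = (real (k * M) - real i) * (real (k * M) - real (N - 1 - i))"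
      by (simp add: a_def b_def W_def algebra_simps)
    finally show ?thesis by (simp add: a_def b_def)
  qed
  \<comment> \<open>In the square every factor can be paired with its mirror image, so no middle
    index needs separate treatment.\<close>
  have "((real k + 1) ^ N * Q)\<^sup>2 = (\<Prod>i<N. ((real k + 1) * (real k + 1)) * ((real M - real i) * (real M - real (N - 1 - i))))"
    unfolding prod.distrib power2_eq_square using rev[of "real M"] by (simp add: Q_def ac_simps)
  also have "\<dots> \<le> (\<Prod>i<N. (real (k * M) - real i) * (real (k * M) - real (N - 1 - i)))"
  proof (intro prod_mono conjI)
    fix i assume i: "i \<in> {..<N}"
    then show "0 \<le> ((real k + 1) * (real k + 1)) * ((real M - real i) * (real M - real (N - 1 - i)))"
      using M(1) by (intro mult_nonneg_nonneg) auto
    show "((real k + 1) * (real k + 1)) * ((real M - real i) * (real M - real (N - 1 - i))) \<le>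
        (real (k * M) - real i) * (real (k * M) - real (N - 1 - i))"
      using step i by auto
  qed
  also have "\<dots> = P\<^sup>2"
    unfolding prod.distrib power2_eq_square using rev[of "real (k * M)"] by (simp add: P_def)
  finally have "((real k + 1) ^ N * Q)\<^sup>2 \<le> P\<^sup>2" .
  moreover have "M \<le> k * M" using assms by simp
  then have "0 \<le> P" unfolding P_def
  proof (intro prod_nonneg)
    fix i assume "i \<in> {..<N}"
    then have "i \<le> k * M" using M(1) \<open>M \<le> k * M\<close> unfolding lessThan_iff by linarith
    then show "0 \<le> real (k * M) - real i" by (simp only: diff_ge_0_iff_ge of_nat_le_iff)
  qed
  ultimately have "(real k + 1) ^ N * Q \<le> P" by (rule power2_le_imp_le)
  then have "(real k + 1) ^ N * (Q / fact N) \<le> P / fact N"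
    by (simp add: divide_right_mono)
  then have "real ((k + 1) ^ N * (M choose N)) \<le> real ((k * M) choose N)"
    by (simp add: real_choose P_def Q_def add.commute)
  then show ?thesis by (simp only: of_nat_le_iff)
qed

lemma nat_root_exists:
  assumes "N > 0"
  obtains k :: nat where "k ^ N \<le> s" "s < (k + 1) ^ N"
proof -
  have ex: "\<exists>j. s < j ^ N" using assms by (intro exI[of _ "Suc s"]) (metis lessI less_le_trans self_le_power zero_less_Suc One_nat_def Suc_leI)
  define j where "j = (LEAST j. s < j ^ N)"
  have j: "s < j ^ N" unfolding j_def by (rule LeastI_ex[OF ex])
  then have "j \<noteq> 0" using assms by (intro notI) (simp add: power_0_left)
  then obtain k where k: "j = Suc k" by (cases j) auto
  have "\<not> s < k ^ N" using not_less_Least[of k "\<lambda>j. s < j ^ N"] k by (simp add: j_def)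
  then show thesis using that[of k] j k by simp
qed

text \<open>Fekete's lemma. It makes the \<open>lim\<close> in \<open>waldschmidt\<close> an actual
  limit, so that a lower bound for all terms carries over to it.\<close>

lemma fekete_convergent:
  fixes a :: "nat \<Rightarrow> real"
  assumes sub: "\<And>m n. m \<ge> 1 \<Longrightarrow> n \<ge> 1 \<Longrightarrow> a (m + n) \<le> a m + a n" and nonneg: "\<And>n. 0 \<le> a n"
  shows "convergent (\<lambda>n. a n / real n)"
proof -
  define A where "A = (\<lambda>n. a n / real n) ` {1..}"
  have bdd: "bdd_below A" by (rule bdd_belowI[of _ 0]) (auto simp: A_def nonneg)
  have ne: "A \<noteq> {}" by (auto simp: A_def)
  have "(\<lambda>n. a n / real n) \<longlonglongrightarrow> Inf A"
  proof (rule LIMSEQ_I)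
    fix e :: real assume e: "e > 0"
    then have "Inf A < Inf A + e / 2" by simp
    then obtain x where "x \<in> A" "x < Inf A + e / 2" using cInf_lessD[OF ne] by blast
    then obtain n0 where n0: "n0 \<ge> 1" "a n0 / real n0 < Inf A + e / 2" by (auto simp: A_def)
    define B where "B = Max (a ` {1..n0})"
    \<comment> \<open>Splitting off \<open>n0\<close> repeatedly leaves an index between 1 and
      \<open>n0\<close>, where the value is at most \<open>B\<close>.\<close>
    have bound: "a n \<le> real n / real n0 * a n0 + B" if "n \<ge> 1" for n
      using that
    proof (induction n rule: less_induct)
      case (less n)
      show ?case
      proof (cases "n \<le> n0")
        case True
        then have "a n \<le> B" unfolding B_def using less.prems by (intro Max_ge) auto
        then show ?thesis using nonneg[of n0] by (simp add: add_increasing)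
      next
        case False
        then have "a n \<le> a n0 + a (n - n0)" using sub[of n0 "n - n0"] n0 by simp
        also have "\<dots> \<le> a n0 + (real (n - n0) / real n0 * a n0 + B)"
          using False n0 by (intro add_left_mono less.IH) auto
        also have "\<dots> = real n / real n0 * a n0 + B"
          using False n0 by (simp add: of_nat_diff diff_divide_distrib left_diff_distrib)
        finally show ?thesis .
      qed
    qed
    have "B \<ge> 0" using n0 nonneg[of 1] unfolding B_def by (intro order_trans[OF _ Max_ge]) auto
    obtain n1 :: nat where n1: "real n1 > 2 * B / e" using reals_Archimedean2 by blast
    show "\<exists>no. \<forall>n\<ge>no. norm (a n / real n - Inf A) < e"
    proof (intro exI[of _ "max 1 n1"] allI impI)
      fix n assume n: "n \<ge> max 1 n1"
      then have "Inf A \<le> a n / real n" by (intro cInf_lower bdd) (auto simp: A_def)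
      moreover have "a n / real n < Inf A + e"
      proof -
        have npos: "real n > 0" using n by simp
        have "a n / real n \<le> (real n / real n0 * a n0 + B) / real n"
          using bound[of n] n by (intro divide_right_mono) auto
        also have "\<dots> = a n0 / real n0 + B / real n"
          using npos by (simp add: add_divide_distrib)
        also have "B / real n < e / 2"
        proof -
          have "2 * B / e < real n" using n1 n by linarith
          then show ?thesis using e npos by (simp add: field_simps)
        qed
        finally show ?thesis using n0(2) by simp
      qed
      ultimately show "norm (a n / real n - Inf A) < e" by simp
    qed
  qed
  then show ?thesis by (rule convergentI)
qed

section \<open>Initial degrees of symbolic powers of ideals of points\<close>

context separated_points
begin

abbreviation "symb \<equiv> symbolic_power (coord_ring N) vI"

text \<open>Order \<open>m\<close> at a point means that the Taylor coefficients of weight up to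
  \<open>m - 1\<close> vanish, which is at most (m + N - 1 choose N) linear conditions.\<close>

lemma symbolic_form_exists:
  assumes "m > 0" "s * ((m + N - 1) choose N) < (d + N) choose N"
  shows "\<exists>f\<in>symb m. f \<noteq> 0 \<and> homogeneous d f"
proof -
  let ?E = "{..<s} \<times> jets N d (m - 1)" and ?T = "monomials N d"
  have "card ?E \<le> s * ((N + (m - 1)) choose N)"
    by (simp add: card_cartesian_product card_jets_le)
  also have "N + (m - 1) = m + N - 1" using assms(1) by simp
  also note assms(2)
  also have "(d + N) choose N = card ?T" by (simp add: card_monomials add.commute)
  finally have "card ?E < card ?T" .
  then obtain c where c: "\<exists>u\<in>?T. c u \<noteq> 0"
      "\<forall>e\<in>?E. (\<Sum>u\<in>?T. lookup (tay (v (fst e)) (single u 1)) (snd e) * c u) = 0"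
    using linear_system_solution[of ?E ?T "\<lambda>e u. lookup (tay (v (fst e)) (single u 1)) (snd e)"] by auto
  define f where "f = (\<Sum>u\<in>?T. single 0 (c u) * single u 1)"
  have f_forms: "f \<in> forms N d"
    unfolding f_def by (intro forms_sum forms_const_mult forms_single)
  have "ordw m (tay (v i) f)" if i: "i < s" for i
    unfolding ordw_def
  proof
    fix t assume t: "t \<in> keys (tay (v i) f)"
    show "m \<le> wt t"
    proof (rule ccontr)
      assume "\<not> m \<le> wt t"
      moreover have "t \<in> ?T" using t tay_forms[OF f_forms, of "v i"] by (auto simp: forms_iff_keys)
      ultimately have "(i, t) \<in> ?E" using i by (auto simp: jets_def)
      with c(2) have "(\<Sum>u\<in>?T. lookup (tay (v i) (single u 1)) t * c u) = 0" by fastforce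
      then have "lookup (tay (v i) f) t = 0"
        by (simp add: f_def tay_sum tay_mult lookup_sum lookup_const_mult mult.commute)
      then show False using t by (simp add: in_keys_iff)
    qed
  qed
  then have "f \<in> symb m" using f_forms by (simp add: symbolic_power_eq forms_iff)
  moreover have "f \<noteq> 0"
  proof
    assume "f = 0"
    obtain u where u: "u \<in> ?T" "c u \<noteq> 0" using c(1) by blast
    have "lookup f u = (\<Sum>x\<in>?T. if x = u then c u else 0)"
      unfolding f_def lookup_sum lookup_const_mult lookup_single by (intro sum.cong) (auto simp: when_def)
    then show False using u \<open>f = 0\<close> by simp
  qed
  ultimately show ?thesis using f_forms by (auto simp: forms_iff)
qed

lemma initial_degree_symbolic_le:
  assumes "m > 0" "s * ((m + N - 1) choose N) < (d + N) choose N"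
  shows "\<alpha> (symb m) \<le> d"
  unfolding initial_degree_def by (rule Least_le) (rule symbolic_form_exists[OF assms])

lemma initial_degree_symbolic_attained:
  assumes "m > 0" "N > 0"
  shows "\<exists>f\<in>symb m. f \<noteq> 0 \<and> homogeneous (\<alpha> (symb m)) f"
proof -
  \<comment> \<open>A degree equal to the number of conditions is large enough, since (d + N choose
    N) is at least d + 1.\<close>
  let ?d = "s * ((m + N - 1) choose N)"
  have "?d < ?d + 1" by simp
  also have "\<dots> \<le> (?d + 1) choose 1" by simp
  also have "\<dots> \<le> (?d + N) choose N"
  proof -
    obtain N' where N': "N = Suc N'" using assms(2) by (cases N) auto
    have "(?d + 1 + j) choose (1 + j) \<le> (?d + 1 + Suc j) choose (1 + Suc j)" for j by simp
    then have "(?d + 1 + 0) choose (1 + 0) \<le> (?d + 1 + N') choose (1 + N')"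
      by (rule lift_Suc_mono_le) simp
    then show ?thesis by (simp add: N')
  qed
  finally have "\<exists>d. \<exists>f\<in>symb m. f \<noteq> 0 \<and> homogeneous d f"
    using symbolic_form_exists[OF assms(1)] by blast
  then show ?thesis unfolding initial_degree_def by (rule LeastI_ex)
qed

lemma initial_degree_symbolic_add:
  assumes "m > 0" "n > 0" "N > 0"
  shows "\<alpha> (symb (m + n)) \<le> \<alpha> (symb m) + \<alpha> (symb n)"
proof -
  obtain f where f: "f \<in> symb m" "f \<noteq> 0" "homogeneous (\<alpha> (symb m)) f"
    using initial_degree_symbolic_attained[OF assms(1,3)] by blast
  obtain g where g: "g \<in> symb n" "g \<noteq> 0" "homogeneous (\<alpha> (symb n)) g"
    using initial_degree_symbolic_attained[OF assms(2,3)] by blast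
  have "f * g \<in> symb (m + n)"
    using f(1) g(1) by (auto simp: symbolic_power_eq tay_mult intro: ordw_mult)
  moreover have "f * g \<noteq> 0" "homogeneous (\<alpha> (symb m) + \<alpha> (symb n)) (f * g)"
    using f g by (auto intro: homogeneous_mult)
  ultimately show ?thesis
    unfolding initial_degree_def[of "symb (m + n)"] by (intro Least_le) blast
qed

lemma initial_degree_symbolic_ge:
  assumes "jet_interpolator N r v D n H" "n \<le> D" "r \<le> s" "q > 0" "N > 0" "n > 0"
  shows "r * q * n ^ (N - 1) \<le> \<alpha> (symb q) * D ^ (N - 1)"
proof -
  obtain f where f: "f \<in> symb q" "f \<noteq> 0" "homogeneous (\<alpha> (symb q)) f"
    using initial_degree_symbolic_attained[OF assms(4,5)] by blast
  have "f \<in> forms N (\<alpha> (symb q))" "\<And>i. i < r \<Longrightarrow> ordw q (tay (v i) f)"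
    using f assms(3) by (auto simp: symbolic_power_eq forms_iff)
  then show ?thesis
    using jet_interpolator_bound[OF assms(1,2) _ f(2)] assms by blast
qed

text \<open>One interpolator of fixed order \<open>n\<close> bounds the initial degrees of all
  symbolic powers by the same \<open>k - 1 / M\<close>.\<close>

theorem waldschmidt_ge:
  assumes "N \<ge> 3" "m \<ge> 1" "k \<ge> 2 * m + 2" "k ^ N \<le> s" "s < (k + 1) ^ N"
  defines "M \<equiv> m + N - 1"
  defines "n \<equiv> k * M * N * N"
  assumes H: "jet_interpolator N (k ^ N) v (k * (n + N)) n H"
  shows "waldschmidt N vI \<ge> (real (\<alpha> (symb m)) + real N - 1) / (real m + real N - 1)"
proof -
  have pos: "N > 0" "M > 0" "k > 0" "n > 0" "real M = real m + real N - 1" using assms(1-3) by (auto simp: M_def n_def of_nat_diff)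
  have "s * (M choose N) < (k + 1) ^ N * (M choose N)"
    using assms(2,5) by (intro mult_strict_right_mono) (auto simp: M_def)
  also have "\<dots> \<le> (k * M) choose N"
    unfolding M_def by (rule power_mult_choose_le) fact+
  finally have less: "s * (M choose N) < (k * M) choose N" .
  have "N \<le> k * M"
  proof -
    have "N \<le> M" using assms(2) by (simp add: M_def)
    also have "M \<le> k * M" using pos by simp
    finally show ?thesis .
  qed
  \<comment> \<open>In degree \<open>k * M - N\<close> there are exactly (k M choose N)
    monomials.\<close>
  then have "\<alpha> (symb m) \<le> k * M - N"
    using less assms(2) by (intro initial_degree_symbolic_le) (auto simp: M_def)
  then have "real (\<alpha> (symb m)) \<le> real (k * M - N)" by (rule of_nat_mono)
  then have "real (\<alpha> (symb m)) \<le> real k * real M - real N"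
    using \<open>N \<le> k * M\<close> by (simp add: of_nat_diff)
  then have "(real (\<alpha> (symb m)) + real N - 1) / real M \<le> (real k * real M - 1) / real M"
    by (intro divide_right_mono) auto
  also have "\<dots> = real k - 1 / real M" using pos by (simp add: field_simps)
  finally have target: "(real (\<alpha> (symb m)) + real N - 1) / real M \<le> real k - 1 / real M" .
  have lower: "real k - 1 / real M \<le> real (\<alpha> (symb q)) / real q" if "q > 0" for q
  proof -
    let ?D = "k * (n + N)"
    have nD: "n \<le> ?D" using pos by (simp add: trans_le_add1 add_mult_distrib2)
    have "real (k ^ N * q * n ^ (N - 1)) \<le> real (\<alpha> (symb q) * ?D ^ (N - 1))"
      by (intro of_nat_mono initial_degree_symbolic_ge[OF H nD assms(4) that pos(1,4)])
    then have 1: "real k ^ N * real q * real n ^ (N - 1) \<le> real (\<alpha> (symb q)) * (real k * real (n + N)) ^ (N - 1)"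
      by simp
    have kN: "real k ^ N = real k * real k ^ (N - 1)" using pos(1) by (cases N) auto
    have "real k ^ (N - 1) * (real k * real q * real n ^ (N - 1)) \<le> real k ^ (N - 1) * (real (\<alpha> (symb q)) * real (n + N) ^ (N - 1))"
      using 1 by (simp only: kN power_mult_distrib) (simp add: ac_simps)
    then have 2: "real k * real q * real n ^ (N - 1) \<le> real (\<alpha> (symb q)) * real (n + N) ^ (N - 1)"
      using pos by (simp add: mult_le_cancel_left)
    have nN: "real (n + N) > 0" using pos by simp
    have 3: "real k * (real n / real (n + N)) ^ (N - 1) \<le> real (\<alpha> (symb q)) / real q"
      using 2 that nN by (simp add: power_divide field_simps del: of_nat_add)
    \<comment> \<open>The loss against \<open>k\<close> is at most k (N - 1) N / (n + N), and
      \<open>n = k * M * N * N\<close> is chosen to push it below 1 / M.\<close>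
    have bern: "1 + real (N - 1) * (- (real N / real (n + N))) \<le> (1 + - (real N / real (n + N))) ^ (N - 1)"
      by (rule Bernoulli_inequality) (use nN in simp)
    have nN_eq: "1 + - (real N / real (n + N)) = real n / real (n + N)"
      using nN by (simp add: field_simps)
    have "real k - 1 / real M \<le> real k * (1 + real (N - 1) * (- (real N / real (n + N))))"
    proof -
      have "k * ((N - 1) * N) * M \<le> k * (N * N) * M" by (intro mult_le_mono) auto
      also have "\<dots> \<le> n + N" by (simp add: n_def ac_simps)
      finally have "real (k * ((N - 1) * N) * M) \<le> real (n + N)" by (rule of_nat_mono)
      then have le: "real k * (real (N - 1) * real N) * real M \<le> real (n + N)" by simp
      have aux: "x / y \<le> 1 / z" if "x * z \<le> y" "y > 0" "z > 0" for x y z :: real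
        using that by (simp add: field_simps)
      have "real k * (real (N - 1) * real N) / real (n + N) \<le> 1 / real M"
        by (rule aux[OF le nN]) (use pos in simp)
      then show ?thesis by (simp add: algebra_simps)
    qed
    also have "\<dots> \<le> real k * (real n / real (n + N)) ^ (N - 1)"
      using mult_left_mono[OF bern, of "real k"] unfolding nN_eq by simp
    also note 3
    finally show ?thesis .
  qed
  have "convergent (\<lambda>q. real (\<alpha> (symb q)) / real q)"
    using initial_degree_symbolic_add pos(1) by (intro fekete_convergent) (auto simp flip: of_nat_add)
  then have "(\<lambda>q. real (\<alpha> (symb q)) / real q) \<longlonglongrightarrow> waldschmidt N vI"
    unfolding waldschmidt_def convergent_LIMSEQ_iff .
  then have "real k - 1 / real M \<le> waldschmidt N vI"
    by (rule LIMSEQ_le_const) (use lower in \<open>auto intro!: exI[of _ 1]\<close>)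
  with target show ?thesis by (simp add: pos(5))
qed

end

section \<open>Distinct points of projective space\<close>

text \<open>Over a finite field, 1 plus the product of all x - a would be a nonconstant polynomial
  without roots.\<close>

lemma infinite_UNIV_alg_closed: "infinite (UNIV :: 'k::alg_closed_field set)"
proof
  assume fin: "finite (UNIV :: 'k set)"
  define q :: "'k poly" where "q = (\<Prod>a\<in>UNIV. [:- a, 1:])"
  have "degree q = card (UNIV :: 'k set)"
    unfolding q_def by (subst degree_prod_eq_sum_degree) auto
  moreover have "card (UNIV :: 'k set) > 0" using fin by (simp add: card_gt_0_iff)
  ultimately have "degree (q + 1) > 0" by (subst degree_add_eq_left) auto
  then obtain x where "poly (q + 1) x = 0" using alg_closed_imp_poly_has_root by blast
  moreover have "poly q x = 0" using fin by (simp add: q_def poly_prod prod_zero_iff)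
  ultimately show False by simp
qed

definition distinct_points :: "nat \<Rightarrow> nat \<Rightarrow> (nat \<Rightarrow> nat \<Rightarrow> 'k::field) \<Rightarrow> bool"
  where "distinct_points N s v \<longleftrightarrow> (\<forall>i<s. v i \<in> nonzero_vectors N) \<and>
    (\<forall>i<s. \<forall>j<s. i \<noteq> j \<longrightarrow> (\<forall>c. v i \<noteq> (\<lambda>k. c * v j k)))"

lemma nonzero_vector_coord:
  assumes "v \<in> nonzero_vectors N"
  obtains k where "k \<le> N" "v k \<noteq> 0"
  using assms by (auto simp: nonzero_vectors_def fun_eq_iff) (metis not_le)

lemma mpoly_eval_var [simp]: "mpoly_eval v (var i) = v i"
  by (simp add: var_def)

text \<open>Vectors that are not proportional have a nonzero 2 by 2 minor; as a linear form in the
  first vector it vanishes at the second.\<close>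

lemma separating_linear_form:
  assumes "distinct_points N s v" "i < s" "j < s" "i \<noteq> j"
  shows "\<exists>L\<in>forms N 1. mpoly_eval (v i) L \<noteq> 0 \<and> mpoly_eval (v j) L = 0"
proof -
  have vi: "v i \<in> nonzero_vectors N" and vj: "v j \<in> nonzero_vectors N"
    and neq: "v i \<noteq> (\<lambda>k. c * v j k)" for c
    using assms by (auto simp: distinct_points_def)
  obtain l where l: "l \<le> N" "v j l \<noteq> 0" by (rule nonzero_vector_coord[OF vj])
  have "\<exists>k\<le>N. v i k * v j l \<noteq> v i l * v j k"
  proof (rule ccontr)
    assume *: "\<not> (\<exists>k\<le>N. v i k * v j l \<noteq> v i l * v j k)"
    have "v i k = (v i l / v j l) * v j k" for k
    proof (cases "k \<le> N")
      case True
      then have "v i k * v j l = v i l * v j k" using * by blast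
      then show ?thesis using l by (simp add: field_simps)
    next
      case False
      then show ?thesis using vi vj by (simp add: nonzero_vectors_def)
    qed
    then show False using neq[of "v i l / v j l"] by blast
  qed
  then obtain k where k: "k \<le> N" "v i k * v j l \<noteq> v i l * v j k" by blast
  let ?L = "single 0 (v j l) * var k - single 0 (v j k) * var l"
  have "?L \<in> forms N 1" using k l by (intro forms_diff forms_const_mult forms_var)
  moreover have "mpoly_eval w ?L = v j l * w k - v j k * w l" for w
    by (simp add: mpoly_eval_diff mpoly_eval_mult)
  ultimately show ?thesis using k by (intro bexI[of _ ?L]) (auto simp: ac_simps)
qed

text \<open>Take the product of the s - 1 linear forms that separate the i-th point from the others,
  fill up the degree with a coordinate that is nonzero at this point, and normalize. So evaluation
  at the points is surjective from degree \<open>s\<close> on.\<close>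

lemma dual_forms:
  assumes v: "distinct_points N s v" and d: "s \<le> d"
  obtains G where "\<And>i. i < s \<Longrightarrow> G i \<in> forms N d"
    "\<And>i j. i < s \<Longrightarrow> j < s \<Longrightarrow> mpoly_eval (v j) (G i) = (if i = j then 1 else 0)"
proof -
  have "\<exists>G. i < s \<longrightarrow> G \<in> forms N d \<and> (\<forall>j<s. mpoly_eval (v j) G = (if i = j then 1 else 0))" for i
  proof (cases "i < s")
    case i: True
    have "\<exists>L. j < s \<and> j \<noteq> i \<longrightarrow> L \<in> forms N 1 \<and> mpoly_eval (v i) L \<noteq> 0 \<and> mpoly_eval (v j) L = 0" for j
      using separating_linear_form[OF v i, of j] by blast
    then obtain L where L: "\<And>j. j < s \<Longrightarrow> j \<noteq> i \<Longrightarrow> L j \<in> forms N 1 \<and> mpoly_eval (v i) (L j) \<noteq> 0 \<and> mpoly_eval (v j) (L j) = 0"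
      by metis
    have "v i \<in> nonzero_vectors N" using v i by (simp add: distinct_points_def)
    then obtain k where k: "k \<le> N" "v i k \<noteq> 0" by (rule nonzero_vector_coord)
    define A where "A = {..<s} - {i}"
    define G0 where "G0 = (\<Prod>j\<in>A. L j) * var k ^ (d - card A)"
    have card: "card A \<le> d" using d i by (simp add: A_def)
    have "G0 \<in> forms N ((\<Sum>j\<in>A. 1) + (d - card A) * 1)"
      unfolding G0_def using L k by (intro forms_mult forms_prod forms_power forms_var) (auto simp: A_def)
    then have G0: "G0 \<in> forms N d" using card by simp
    have nz: "mpoly_eval (v i) G0 \<noteq> 0"
      using L k by (auto simp: G0_def mpoly_eval_mult mpoly_eval_prod mpoly_eval_power A_def)
    have z: "mpoly_eval (v j) G0 = 0" if "j < s" "j \<noteq> i" for j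
    proof -
      have "(\<Prod>l\<in>A. mpoly_eval (v j) (L l)) = 0"
        using L[OF that] that by (intro prod_zero bexI[of _ j]) (auto simp: A_def)
      then show ?thesis by (simp add: G0_def mpoly_eval_mult mpoly_eval_prod)
    qed
    show ?thesis
      using G0 nz z by (intro exI[of _ "single 0 (inverse (mpoly_eval (v i) G0)) * G0"])
        (auto intro: forms_const_mult simp: mpoly_eval_mult)
  qed auto
  then obtain G where "\<And>i. i < s \<Longrightarrow> G i \<in> forms N d \<and> (\<forall>j<s. mpoly_eval (v j) (G i) = (if i = j then 1 else 0))"
    by metis
  then show thesis by (intro that[of G]) auto
qed

lemma separated_points_of_distinct:
  assumes v: "distinct_points N s v" and "\<And>i. i < s \<Longrightarrow> v i 0 = 1"
  shows "separated_points N s v"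
proof
  obtain G where G: "\<And>i. i < s \<Longrightarrow> G i \<in> forms N s"
    "\<And>i j. i < s \<Longrightarrow> j < s \<Longrightarrow> mpoly_eval (v j) (G i) = (if i = j then 1 else 0)"
    using dual_forms[OF v order_refl] by metis
  show "\<exists>G\<in>carr N. G \<notin> point_prime N (v i) \<and> (\<forall>j<s. j \<noteq> i \<longrightarrow> G \<in> point_prime N (v j))" if i: "i < s" for i
  proof (intro bexI[of _ "G i"] conjI allI impI)
    have hom: "homogeneous s (G i)" and carr: "G i \<in> carr N" using G(1)[OF i] by (auto simp: forms_iff)
    show "G i \<in> carr N" by (rule carr)
    show "G i \<notin> point_prime N (v i)"
      unfolding point_prime_def using G(2)[OF i i] ordw_1_tay[OF hom, of "v i"] by simp
    show "G i \<in> point_prime N (v j)" if "j < s" "j \<noteq> i" for j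
      unfolding point_prime_def using G(2)[OF i that(1)] that(2) carr ordw_1_tay[OF hom, of "v j"] by simp
  qed
qed (use assms in auto)

lemma van_ideal_scale:
  assumes "\<And>i. i < s \<Longrightarrow> c i \<noteq> 0"
  shows "van_ideal N s (\<lambda>i k. c i * v i k) = van_ideal N s v"
proof -
  have "(\<forall>i<s. mpoly_eval (\<lambda>k. c i * v i k) f = 0) \<longleftrightarrow> (\<forall>i<s. mpoly_eval (v i) f = 0)" if "homogeneous d f" for f d
    using assms by (auto simp: mpoly_eval_scale[OF that])
  then have "{f \<in> carr N. (\<exists>d. homogeneous d f) \<and> (\<forall>i<s. mpoly_eval (\<lambda>k. c i * v i k) f = 0)} =
      {f \<in> carr N. (\<exists>d. homogeneous d f) \<and> (\<forall>i<s. mpoly_eval (v i) f = 0)}"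
    by (intro Collect_cong conj_cong refl) auto
  then show ?thesis unfolding van_ideal_def by simp
qed

lemma defining_ideal_eq_van_ideal:
  fixes X :: "(nat \<Rightarrow> 'k::field) set set"
  assumes X: "X \<subseteq> proj_space N" "finite X" "card X = s"
  obtains v where "distinct_points N s v" "defining_ideal N X = van_ideal N s v"
proof -
  define rel :: "((nat \<Rightarrow> 'k) \<times> (nat \<Rightarrow> 'k)) set" where
    "rel = {(v, w). v \<in> nonzero_vectors N \<and> w \<in> nonzero_vectors N \<and> (\<exists>c. c \<noteq> 0 \<and> w = (\<lambda>i. c * v i))}"
  obtain e where e: "bij_betw e {0..<s} X" using ex_bij_betw_nat_finite[OF X(2)] X(3) by blast
  then have eX: "e i \<in> X" if "i < s" for i using bij_betwE[OF e] that by auto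
  have "\<exists>w. i < s \<longrightarrow> w \<in> nonzero_vectors N \<and> e i = rel `` {w}" for i
    using eX[of i] X(1) by (auto simp: proj_space_def rel_def[symmetric] quotient_def)
  then obtain v where v: "\<And>i. i < s \<Longrightarrow> v i \<in> nonzero_vectors N" "\<And>i. i < s \<Longrightarrow> e i = rel `` {v i}" by metis
  have mem: "w \<in> e i \<longleftrightarrow> (\<exists>c. c \<noteq> 0 \<and> w = (\<lambda>k. c * v i k))" if i: "i < s" for i w
  proof
    assume "w \<in> e i"
    then show "\<exists>c. c \<noteq> 0 \<and> w = (\<lambda>k. c * v i k)" using v(2)[OF i] by (auto simp: rel_def)
  next
    assume "\<exists>c. c \<noteq> 0 \<and> w = (\<lambda>k. c * v i k)"
    then obtain c where c: "c \<noteq> 0" "w = (\<lambda>k. c * v i k)" by blast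
    then have "w \<in> nonzero_vectors N"
      using v(1)[OF i] by (auto simp: nonzero_vectors_def fun_eq_iff)
    then show "w \<in> e i" using c v[OF i] by (auto simp: rel_def)
  qed
  have "v i \<noteq> (\<lambda>k. c * v j k)" if ij: "i < s" "j < s" "i \<noteq> j" for i j c
  proof
    assume eq: "v i = (\<lambda>k. c * v j k)"
    then have c: "c \<noteq> 0" using v(1)[OF ij(1)] by (auto simp: nonzero_vectors_def)
    have "v i = (\<lambda>k. c * v j k) \<Longrightarrow> w \<in> e i \<longleftrightarrow> w \<in> e j" for w
    proof -
      have "w = (\<lambda>k. a * v i k) \<longleftrightarrow> w = (\<lambda>k. (a * c) * v j k)" for a
        unfolding eq by (simp add: mult.assoc)
      moreover have "w = (\<lambda>k. b * v j k) \<longleftrightarrow> w = (\<lambda>k. (b / c) * v i k)" for b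
        unfolding eq using c by (simp add: field_simps)
      ultimately show ?thesis
        unfolding mem[OF ij(1)] mem[OF ij(2)] using c by (metis divide_eq_0_iff mult_eq_0_iff)
    qed
    then have "e i = e j" using eq by blast
    then show False using inj_onD[OF bij_betw_imp_inj_on[OF e], of i j] ij by auto
  qed
  with v(1) have dist: "distinct_points N s v" by (auto simp: distinct_points_def)
  have "(\<forall>P\<in>X. \<forall>w\<in>P. mpoly_eval w f = 0) \<longleftrightarrow> (\<forall>i<s. mpoly_eval (v i) f = 0)" if f: "homogeneous d f" for f d
  proof
    assume *: "\<forall>P\<in>X. \<forall>w\<in>P. mpoly_eval w f = 0"
    have "v i \<in> e i" if "i < s" for i
      unfolding mem[OF that] by (rule exI[of _ 1]) simp
    then show "\<forall>i<s. mpoly_eval (v i) f = 0" using * eX by blast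
  next
    assume *: "\<forall>i<s. mpoly_eval (v i) f = 0"
    show "\<forall>P\<in>X. \<forall>w\<in>P. mpoly_eval w f = 0"
    proof (intro ballI)
      fix P w assume P: "P \<in> X" "w \<in> P"
      then obtain i where i: "i < s" "P = e i"
        using bij_betw_imp_surj_on[OF e] by auto
      then obtain c where "w = (\<lambda>k. c * v i k)" using P mem by blast
      then show "mpoly_eval w f = 0" using mpoly_eval_scale[OF f, of c "v i"] * i by simp
    qed
  qed
  then have "{f \<in> carr N. (\<exists>d. homogeneous d f) \<and> (\<forall>P\<in>X. \<forall>w\<in>P. mpoly_eval w f = 0)} =
      {f \<in> carr N. (\<exists>d. homogeneous d f) \<and> (\<forall>i<s. mpoly_eval (v i) f = 0)}"
    by (intro Collect_cong conj_cong refl) auto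
  then have "defining_ideal N X = van_ideal N s v"
    unfolding defining_ideal_def van_ideal_def by simp
  with dist show thesis by (rule that)
qed

section \<open>Hilbert functions and frames\<close>

lemma vector_space_mpoly: "vector_space (mpoly_scale :: 'k::field \<Rightarrow> ('v, 'k) mpoly \<Rightarrow> _)"
  by unfold_locales (simp_all add: mpoly_scale_def distrib_left distrib_right single_add mult_single flip: mult.assoc)

lemma graded_part_van_ideal:
  "graded_part (van_ideal N s v) d = {f \<in> forms N d. \<forall>i<s. mpoly_eval (v i) f = 0}"
proof (intro Set.set_eqI iffI)
  fix f assume f: "f \<in> graded_part (van_ideal N s v) d"
  then show "f \<in> {f \<in> forms N d. \<forall>i<s. mpoly_eval (v i) f = 0}"
    using coord_ideal_closed(1)[OF ideal_van_ideal] van_ideal_eval[of f N s v d]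
    by (auto simp: graded_part_def)
next
  fix f assume "f \<in> {f \<in> forms N d. \<forall>i<s. mpoly_eval (v i) f = 0}"
  then show "f \<in> graded_part (van_ideal N s v) d"
    by (auto simp: graded_part_def intro: van_ideal_gen)
qed

text \<open>The type argument fixes the field of scalars, which \<open>N\<close> and
  \<open>d\<close> do not determine.\<close>

locale form_space =
  fixes N :: nat and d :: nat and field_type :: "'k::field itself"
begin

sublocale vs: vector_space "mpoly_scale :: 'k \<Rightarrow> (nat, 'k) mpoly \<Rightarrow> _"
  by (rule vector_space_mpoly)

abbreviation Fd :: "(nat, 'k) mpoly set" where "Fd \<equiv> forms N d"

lemma form_expansion: "f \<in> Fd \<Longrightarrow> f = (\<Sum>t\<in>keys f. mpoly_scale (lookup f t) (single t 1))"
  by (simp add: mpoly_scale_def mult_single flip: poly_mapping_sum_single)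

lemma forms_finite_span: "Fd \<subseteq> vs.span ((\<lambda>t. single t 1) ` monomials N d)"
proof
  fix f assume f: "f \<in> Fd"
  have "mpoly_scale (lookup f t) (single t 1) \<in> vs.span ((\<lambda>t. single t 1) ` monomials N d)" if "t \<in> keys f" for t
    using f that by (intro vs.span_scale vs.span_base) (auto simp: forms_iff_keys)
  then have "(\<Sum>t\<in>keys f. mpoly_scale (lookup f t) (single t 1)) \<in> vs.span ((\<lambda>t. single t 1) ` monomials N d)"
    by (rule vs.span_sum)
  then show "f \<in> vs.span ((\<lambda>t. single t 1) ` monomials N d)"
    by (simp only: form_expansion[OF f, symmetric])
qed

lemma subspace_graded_part:
  assumes J: "ideal J (coord_ring N)"
  shows "vs.subspace (graded_part J d)"
  unfolding vs.subspace_def graded_part_def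
  using coord_ideal_closed[OF J]
  by (auto simp: mpoly_scale_def intro: homogeneous_add homogeneous_const_mult)

lemma basis_extension:
  assumes "V \<subseteq> Fd"
  obtains B C where "B \<subseteq> V" "V \<subseteq> vs.span B" "B \<inter> C = {}" "B \<union> C \<subseteq> Fd" "vs.independent (B \<union> C)"
    "Fd \<subseteq> vs.span (B \<union> C)" "finite (B \<union> C)" "vs.dim V = card B" "vs.dim Fd = card B + card C"
proof -
  obtain B where B: "B \<subseteq> V" "vs.independent B" "V \<subseteq> vs.span B" by (rule vs.maximal_independent_subset)
  obtain B' where B': "B \<subseteq> B'" "B' \<subseteq> Fd" "vs.independent B'" "Fd \<subseteq> vs.span B'"
    using vs.maximal_independent_subset_extend[of B Fd] B assms by blast
  have fin: "finite B'"
    using vs.independent_span_bound[of "(\<lambda>t. single t 1) ` monomials N d" B'] B' forms_finite_span by auto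
  have B'_eq: "B \<union> (B' - B) = B'" using B'(1) by blast
  have "finite B" using B'(1) fin by (rule finite_subset)
  then have "card (B \<union> (B' - B)) = card B + card (B' - B)"
    using fin by (intro card_Un_disjoint) auto
  moreover have "vs.dim Fd = card B'" "vs.dim V = card B"
    using vs.basis_card_eq_dim[OF B'(2,4,3)] vs.basis_card_eq_dim[OF B(1,3,2)] by auto
  ultimately show thesis
    using B B' fin by (intro that[of B "B' - B"]) (simp_all only: B'_eq, auto)
qed

text \<open>A basis of the forms that vanish at the points becomes a basis of all forms when the
  \<open>s\<close> dual forms are added.\<close>

lemma hilbert_function_van_ideal:
  fixes v :: "nat \<Rightarrow> nat \<Rightarrow> 'k"
  assumes v: "distinct_points N s v" and d: "s \<le> d"
  shows "hilbert_function N (van_ideal N s v) d = s"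
proof -
  let ?V = "graded_part (van_ideal N s v) d"
  obtain G where G: "\<And>i. i < s \<Longrightarrow> G i \<in> Fd"
    "\<And>i j. i < s \<Longrightarrow> j < s \<Longrightarrow> mpoly_eval (v j) (G i) = (if i = j then 1 else 0)"
    using dual_forms[OF v d] by blast
  have V: "?V \<subseteq> Fd" by (auto simp: graded_part_van_ideal)
  obtain B where B: "B \<subseteq> ?V" "?V \<subseteq> vs.span B" "vs.independent B" "finite B" "vs.dim ?V = card B"
    using basis_extension[OF V] vs.independent_mono by (metis finite_Un sup_ge1)
  let ?E = "G ` {..<s}"
  have inj: "inj_on G {..<s}"
  proof (rule inj_onI)
    fix i j assume "i \<in> {..<s}" "j \<in> {..<s}" "G i = G j"
    then show "i = j" using G(2)[of i j] G(2)[of j j] by (simp split: if_splits)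
  qed
  have B0: "mpoly_eval (v j) b = 0" if "b \<in> B" "j < s" for b j
    using B(1) that by (auto simp: graded_part_van_ideal)
  have disj: "B \<inter> ?E = {}"
  proof (rule ccontr)
    assume "B \<inter> ?E \<noteq> {}"
    then obtain i where "i < s" "G i \<in> B" by blast
    then show False using B0[of "G i" i] G(2)[of i i] by simp
  qed
  have ind: "vs.independent (B \<union> ?E)"
  proof (rule vs.independent_if_scalars_zero)
    show "finite (B \<union> ?E)" using B by simp
    fix c x assume sum0: "(\<Sum>x\<in>B \<union> ?E. mpoly_scale (c x) x) = 0" and x: "x \<in> B \<union> ?E"
    have split: "(\<Sum>x\<in>B \<union> ?E. mpoly_scale (c x) x) = (\<Sum>b\<in>B. mpoly_scale (c b) b) + (\<Sum>i<s. mpoly_scale (c (G i)) (G i))"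
      using B(4) disj by (simp add: sum.union_disjoint sum.reindex[OF inj])
    have cG: "c (G j) = 0" if j: "j < s" for j
    proof -
      have "0 = mpoly_eval (v j) ((\<Sum>b\<in>B. mpoly_scale (c b) b) + (\<Sum>i<s. mpoly_scale (c (G i)) (G i)))"
        using sum0 split by simp
      also have "\<dots> = (\<Sum>b\<in>B. c b * mpoly_eval (v j) b) + (\<Sum>i<s. c (G i) * mpoly_eval (v j) (G i))"
        by (simp add: mpoly_eval_add mpoly_eval_sum mpoly_eval_mult mpoly_scale_def)
      also have "(\<Sum>b\<in>B. c b * mpoly_eval (v j) b) = 0"
        using B0[OF _ j] by (intro sum.neutral) auto
      also have "(\<Sum>i<s. c (G i) * mpoly_eval (v j) (G i)) = (\<Sum>i<s. if i = j then c (G j) else 0)"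
        using G(2)[OF _ j] by (intro sum.cong) auto
      finally show ?thesis using j by simp
    qed
    then have "(\<Sum>b\<in>B. mpoly_scale (c b) b) = 0"
      using sum0 split by (simp add: mpoly_scale_def)
    then have "c b = 0" if "b \<in> B" for b
      using vs.independentD[OF B(3,4) subset_refl, of c b] that by blast
    with cG x show "c x = 0" by auto
  qed
  have span: "Fd \<subseteq> vs.span (B \<union> ?E)"
  proof
    fix f assume f: "f \<in> Fd"
    let ?g = "\<Sum>i<s. mpoly_scale (mpoly_eval (v i) f) (G i)"
    have g: "?g \<in> Fd" using G(1) by (auto simp: mpoly_scale_def intro!: forms_sum forms_const_mult)
    have "mpoly_eval (v j) ?g = mpoly_eval (v j) f" if j: "j < s" for j
    proof -
      have "mpoly_eval (v j) ?g = (\<Sum>i<s. if i = j then mpoly_eval (v j) f else 0)"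
        unfolding mpoly_eval_sum mpoly_scale_def mpoly_eval_mult using G(2)[OF _ j] by (intro sum.cong) auto
      then show ?thesis using j by simp
    qed
    then have "f - ?g \<in> ?V"
      using forms_diff[OF f g] by (simp add: graded_part_van_ideal mpoly_eval_diff)
    then have "f - ?g \<in> vs.span (B \<union> ?E)"
      using B(2) vs.span_mono[of B "B \<union> ?E"] by blast
    moreover have "?g \<in> vs.span (B \<union> ?E)"
      by (intro vs.span_sum vs.span_scale vs.span_base) auto
    ultimately have "(f - ?g) + ?g \<in> vs.span (B \<union> ?E)" by (rule vs.span_add)
    then show "f \<in> vs.span (B \<union> ?E)" by simp
  qed
  have "B \<union> ?E \<subseteq> Fd" using B(1) V G(1) by auto
  then have "vs.dim Fd = card (B \<union> ?E)" using vs.basis_card_eq_dim[OF _ span ind] by simp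
  also have "\<dots> = card B + s" using B(4) disj card_image[OF inj] by (simp add: card_Un_disjoint)
  finally show ?thesis by (simp add: hilbert_function_def B(5))
qed

text \<open>A basis of the graded piece is extended by \<open>C\<close> to a basis of all forms; the
  coordinates along \<open>C\<close> are the functionals of a frame.\<close>

lemma frame_exists:
  fixes J :: "(nat, 'k) mpoly set"
  assumes J: "ideal J (coord_ring N)" and H: "hilbert_function N J d = s"
  shows "\<exists>l. frame N s d J l"
proof -
  let ?V = "graded_part J d"
  have V: "?V \<subseteq> Fd" using coord_ideal_closed(1)[OF J] by (auto simp: graded_part_def)
  obtain B C where BC: "B \<subseteq> ?V" "?V \<subseteq> vs.span B" "B \<inter> C = {}" "B \<union> C \<subseteq> Fd" "vs.independent (B \<union> C)"
    "Fd \<subseteq> vs.span (B \<union> C)" "finite (B \<union> C)" "vs.dim ?V = card B" "vs.dim Fd = card B + card C"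
    by (rule basis_extension[OF V])
  then have "card C = s" using H by (simp add: hilbert_function_def)
  then obtain b where b: "bij_betw b {0..<s} C" using ex_bij_betw_nat_finite[of C] BC(7) by auto
  define l where "l i t = vs.representation (B \<union> C) (single t 1) (b i)" for i t
  have l: "(\<Sum>t\<in>keys f. lookup f t * l i t) = vs.representation (B \<union> C) f (b i)" if f: "f \<in> Fd" for f i
  proof -
    have mono: "single t 1 \<in> vs.span (B \<union> C)" if "t \<in> keys f" for t
      using f that BC(6) by (auto simp: forms_iff_keys intro!: forms_single)
    have "vs.representation (B \<union> C) (\<Sum>t\<in>keys f. mpoly_scale (lookup f t) (single t 1)) =
        (\<lambda>b. \<Sum>t\<in>keys f. lookup f t * vs.representation (B \<union> C) (single t 1) b)"
      using mono by (simp add: vs.representation_sum[OF BC(5)] vs.representation_scale[OF BC(5)] vs.span_scale)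
    then show ?thesis using form_expansion[OF f] by (simp add: l_def)
  qed
  have "f \<in> ?V \<longleftrightarrow> (\<forall>i<s. (\<Sum>t\<in>keys f. lookup f t * l i t) = 0)" if f: "f \<in> Fd" for f
  proof
    assume "f \<in> ?V"
    then have "f \<in> vs.span B" using BC(2) by blast
    then have "vs.representation (B \<union> C) f = vs.representation B f"
      by (intro vs.representation_extend[OF BC(5)]) auto
    moreover have "b i \<notin> B" if "i < s" for i
      using bij_betwE[OF b] that BC(3) by auto
    ultimately show "\<forall>i<s. (\<Sum>t\<in>keys f. lookup f t * l i t) = 0"
      using vs.representation_ne_zero[of B f] by (auto simp: l[OF f])
  next
    assume "\<forall>i<s. (\<Sum>t\<in>keys f. lookup f t * l i t) = 0"
    then have "vs.representation (B \<union> C) f c = 0" if "c \<in> C" for c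
      using that bij_betw_imp_surj_on[OF b] by (auto simp: l[OF f])
    moreover have "f = (\<Sum>x\<in>B \<union> C. mpoly_scale (vs.representation (B \<union> C) f x) x)"
      using vs.sum_representation_eq[OF BC(5) _ BC(7) subset_refl, of f] f BC(6) by auto
    moreover have "\<dots> = (\<Sum>x\<in>B. mpoly_scale (vs.representation (B \<union> C) f x) x) + (\<Sum>x\<in>C. mpoly_scale (vs.representation (B \<union> C) f x) x)"
      using BC(3,7) by (intro sum.union_disjoint) auto
    ultimately have "f = (\<Sum>x\<in>B. mpoly_scale (vs.representation (B \<union> C) f x) x)"
      by (simp add: mpoly_scale_def)
    also have "\<dots> \<in> ?V"
      using BC(1) subspace_graded_part[OF J] by (intro vs.subspace_sum vs.subspace_scale) auto
    finally show "f \<in> ?V" .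
  qed
  then have "?V = {f \<in> Fd. \<forall>i<s. (\<Sum>t\<in>keys f. lookup f t * l i t) = 0}"
    using V by blast
  with H show ?thesis unfolding frame_def by blast
qed

end

abbreviation evf :: "(nat \<Rightarrow> nat \<Rightarrow> 'k::field) \<Rightarrow> nat \<Rightarrow> nat monomial \<Rightarrow> 'k"
  where "evf v \<equiv> \<lambda>i. mev (v i)"

lemma frame_van_ideal:
  assumes "distinct_points N s v" "s \<le> d"
  shows "frame N s d (van_ideal N s v) (evf v)"
  unfolding frame_def graded_part_van_ideal mpoly_eval_eq
  using form_space.hilbert_function_van_ideal[OF assms] by simp

lemma van_ideal_in_hilb:
  fixes v :: "nat \<Rightarrow> nat \<Rightarrow> 'k::field"
  assumes v: "distinct_points N s v"
  shows "van_ideal N s v \<in> hilb N s"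
proof -
  note ring = cring.axioms(1)[OF cring_coord_ring]
  let ?I = "van_ideal N s v"
  have "?I = Idl\<^bsub>coord_ring N\<^esub> (\<Union>d. graded_part ?I d)"
  proof
    have sub: "(\<Union>d. graded_part ?I d) \<subseteq> ?I" by (auto simp: graded_part_def)
    show "Idl\<^bsub>coord_ring N\<^esub> (\<Union>d. graded_part ?I d) \<subseteq> ?I"
      by (rule ring.genideal_minimal[OF ring ideal_van_ideal sub])
    have carr: "(\<Union>d. graded_part ?I d) \<subseteq> carr N" using sub coord_ideal_closed(1)[OF ideal_van_ideal] by blast
    have "{f \<in> carr N. (\<exists>d. homogeneous d f) \<and> (\<forall>i<s. mpoly_eval (v i) f = 0)} \<subseteq> (\<Union>d. graded_part ?I d)"
      by (auto simp: graded_part_van_ideal forms_iff)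
    also have "\<dots> \<subseteq> Idl\<^bsub>coord_ring N\<^esub> (\<Union>d. graded_part ?I d)"
      by (rule ring.genideal_self[OF ring carr])
    finally show "?I \<subseteq> Idl\<^bsub>coord_ring N\<^esub> (\<Union>d. graded_part ?I d)"
      unfolding van_ideal_def[of N s v]
      by (rule ring.genideal_minimal[OF ring ring.genideal_ideal[OF ring carr[unfolded van_ideal_def]]])
  qed
  then have 1: "homogeneous_ideal N ?I"
    unfolding homogeneous_ideal_def using ideal_van_ideal by blast
  have 2: "saturated N ?I"
    unfolding saturated_def
  proof (intro ballI impI)
    fix f :: "(nat, 'k) mpoly" assume f: "f \<in> carr N" and *: "\<forall>i\<le>N. single (single i 1) 1 * f \<in> ?I"
    \<comment> \<open>Some coordinate does not vanish at the point, so primality cancels it.\<close>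
    have "f \<in> point_prime N (v j)" if j: "j < s" for j
    proof -
      have "v j \<in> nonzero_vectors N" using v j by (simp add: distinct_points_def)
      then obtain k where k: "k \<le> N" "v j k \<noteq> 0" by (rule nonzero_vector_coord)
      have "var k * f \<in> point_prime N (v j)"
        using * k(1) j by (auto simp: van_ideal_eq var_def)
      moreover have "var k \<notin> point_prime N (v j)"
        using ordw_1_tay[of 1 "var k" "v j"] forms_var[OF k(1)] k(2) by (auto simp: point_prime_def forms_iff)
      ultimately show ?thesis
        using primeideal.I_prime[OF primeideal_point, of "var k" N f "v j"] f carr_var[OF k(1)] by auto
    qed
    then show "f \<in> ?I" using f by (simp add: van_ideal_eq)
  qed
  show ?thesis
    unfolding hilb_def using 1 2 form_space.hilbert_function_van_ideal[OF v] by blast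
qed

section \<open>Pluecker coordinates\<close>

text \<open>The functionals of any frame vanish on all forms that vanish at the points, so they are
  combinations of the evaluations. The factor is the determinant of the coefficients
  \<open>L i (G k)\<close>.\<close>

lemma pluecker_frame:
  assumes v: "distinct_points N s v" and d: "s \<le> d" and l: "frame N s d (van_ideal N s v) l"
  obtains a where "\<And>ts. length ts = s \<Longrightarrow> set ts \<subseteq> monomials N d \<Longrightarrow> pluecker s l ts = a * pluecker s (evf v) ts"
proof -
  obtain G where G: "\<And>i. i < s \<Longrightarrow> G i \<in> forms N d"
    "\<And>i j. i < s \<Longrightarrow> j < s \<Longrightarrow> mpoly_eval (v j) (G i) = (if i = j then 1 else 0)"
    using dual_forms[OF v d] by blast
  define L where "L i f = (\<Sum>t\<in>monomials N d. lookup f t * l i t)" for i f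
  have L_eq: "L i f = (\<Sum>t\<in>keys f. lookup f t * l i t)" if "f \<in> forms N d" for i f
    unfolding L_def using that
    by (intro sum.mono_neutral_right) (auto simp: forms_iff_keys not_in_keys_iff_lookup_eq_zero)
  have lin: "l i t = (\<Sum>k<s. L i (G k) * mev (v k) t)" if i: "i < s" and t: "t \<in> monomials N d" for i t
  proof -
    define f where "f = single t 1 - (\<Sum>k<s. single 0 (mev (v k) t) * G k)"
    have f: "f \<in> forms N d"
      unfolding f_def using t G(1) by (auto intro!: forms_diff forms_sum forms_const_mult forms_single)
    have "mpoly_eval (v j) f = 0" if j: "j < s" for j
    proof -
      have "mpoly_eval (v j) (\<Sum>k<s. single 0 (mev (v k) t) * G k) = (\<Sum>k<s. if k = j then mev (v j) t else 0)"
        unfolding mpoly_eval_sum mpoly_eval_mult using G(2)[OF _ j] by (intro sum.cong) auto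
      then show ?thesis using j by (simp add: f_def mpoly_eval_diff)
    qed
    then have "f \<in> graded_part (van_ideal N s v) d" using f by (simp add: graded_part_van_ideal)
    then have "L i f = 0" using l i L_eq[OF f] by (simp add: frame_def)
    moreover have "L i f = L i (single t 1) - (\<Sum>k<s. L i (single 0 (mev (v k) t) * G k))"
    proof -
      have "L i (f - (\<Sum>k<s. g k)) = L i f - (\<Sum>k<s. L i (g k))" for f :: "(nat, 'a) mpoly" and g
        by (simp add: L_def lookup_minus lookup_sum left_diff_distrib sum_subtractf sum_distrib_right)
          (rule sum.swap)
      then show ?thesis by (simp add: f_def)
    qed
    moreover have "L i (single t 1) = (\<Sum>u\<in>monomials N d. if u = t then l i t else 0)"
      unfolding L_def by (intro sum.cong) (auto simp: lookup_single)
    then have "L i (single t 1) = l i t" using t by simp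
    moreover have "L i (single 0 (mev (v k) t) * G k) = L i (G k) * mev (v k) t" for k
      unfolding L_def lookup_const_mult sum_distrib_right by (intro sum.cong) simp_all
    ultimately show ?thesis by simp
  qed
  have "pluecker s l ts = det (mat s s (\<lambda>(i, k). L i (G k))) * pluecker s (evf v) ts"
    if ts: "length ts = s" "set ts \<subseteq> monomials N d" for ts
  proof -
    have "mat s s (\<lambda>(i, j). l i (ts ! j)) = mat s s (\<lambda>(i, k). L i (G k)) * mat s s (\<lambda>(i, j). mev (v i) (ts ! j))"
    proof (rule eq_matI)
      fix i j assume "i < dim_row (mat s s (\<lambda>(i, k). L i (G k)) * mat s s (\<lambda>(i, j). mev (v i) (ts ! j)))"
        "j < dim_col (mat s s (\<lambda>(i, k). L i (G k)) * mat s s (\<lambda>(i, j). mev (v i) (ts ! j)))"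
      then have ij: "i < s" "j < s" by auto
      then have "ts ! j \<in> monomials N d" using ts nth_mem by blast
      then show "mat s s (\<lambda>(i, j). l i (ts ! j)) $$ (i, j) =
          (mat s s (\<lambda>(i, k). L i (G k)) * mat s s (\<lambda>(i, j). mev (v i) (ts ! j))) $$ (i, j)"
        using ij lin[OF ij(1)] by (simp add: scalar_prod_def atLeast0LessThan)
    qed auto
    then show ?thesis unfolding pluecker_def by (simp add: det_mult[of _ s])
  qed
  then show thesis by (rule that)
qed

text \<open>By homogeneity of \<open>F\<close>, proportional Pluecker coordinates change its value
  by one factor only. So evaluation at the points may replace the unspecified frame.\<close>

lemma hilb_basic_open_iff:
  assumes v: "distinct_points N s v" and d: "s \<le> d"
    and F: "F \<in> carrier (pluecker_ring N s d)" "homogeneous e F"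
  shows "van_ideal N s v \<in> hilb_basic_open N s d F \<longleftrightarrow> mpoly_eval (pluecker s (evf v)) F \<noteq> 0"
proof
  assume "mpoly_eval (pluecker s (evf v)) F \<noteq> 0"
  then show "van_ideal N s v \<in> hilb_basic_open N s d F"
    unfolding hilb_basic_open_def using van_ideal_in_hilb[OF v] frame_van_ideal[OF v d] by blast
next
  assume "van_ideal N s v \<in> hilb_basic_open N s d F"
  then obtain l where l: "frame N s d (van_ideal N s v) l" "mpoly_eval (pluecker s l) F \<noteq> 0"
    unfolding hilb_basic_open_def by blast
  obtain a where a: "\<And>ts. length ts = s \<Longrightarrow> set ts \<subseteq> monomials N d \<Longrightarrow> pluecker s l ts = a * pluecker s (evf v) ts"
    using pluecker_frame[OF v d l(1)] by blast
  have "mev (pluecker s l) t = mev (\<lambda>ts. a * pluecker s (evf v) ts) t" if "t \<in> keys F" for t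
    using F(1) that a by (intro mev_cong) (auto simp: pluecker_ring_def mpoly_ring_def)
  then have "mpoly_eval (pluecker s l) F = mpoly_eval (\<lambda>ts. a * pluecker s (evf v) ts) F"
    unfolding mpoly_eval_eq by (intro sum.cong) auto
  also have "\<dots> = a ^ e * mpoly_eval (pluecker s (evf v)) F"
    by (rule mpoly_eval_scale[OF F(2)])
  finally show "mpoly_eval (pluecker s (evf v)) F \<noteq> 0" using l(2) by auto
qed

text \<open>Permuting the monomials over fixed points shows multihomogeneity in the points.
  Permuting the points over fixed monomials gives the alternating sum of
  \<open>pluecker_alternating\<close>.\<close>

lemma pluecker_rows: "pluecker s l ts = (\<Sum>p\<in>{p. p permutes {0..<s}}. signof p * (\<Prod>i<s. l i (ts ! p i)))"
  and pluecker_cols: "pluecker s l ts = (\<Sum>p\<in>{p. p permutes {0..<s}}. signof p * (\<Prod>j<s. l (p j) (ts ! j)))"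
proof -
  let ?M = "mat s s (\<lambda>(i, j). l i (ts ! j))"
  have M: "?M \<in> carrier_mat s s" by simp
  have eq: "(\<Prod>i\<in>{0..<s}. ?M $$ (i, p i)) = (\<Prod>i<s. l i (ts ! p i))"
    "(\<Prod>j<s. ?M $$ (p j, j)) = (\<Prod>j<s. l (p j) (ts ! j))" if "p permutes {0..<s}" for p
    using permutes_in_image[OF that] by (auto simp: atLeast0LessThan intro!: prod.cong)
  show "pluecker s l ts = (\<Sum>p\<in>{p. p permutes {0..<s}}. signof p * (\<Prod>i<s. l i (ts ! p i)))"
    unfolding pluecker_def det_def'[OF M] using eq(1) by (intro sum.cong) auto
  show "pluecker s l ts = (\<Sum>p\<in>{p. p permutes {0..<s}}. signof p * (\<Prod>j<s. l (p j) (ts ! j)))"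
    unfolding pluecker_def det_col[OF M] using eq(2) by (intro sum.cong) auto
qed

lemma mform_pluecker:
  assumes "length ts = s" "set ts \<subseteq> monomials N d"
  shows "mform N s (\<lambda>_. d) (\<lambda>v. pluecker s (evf v) ts)"
proof -
  have "mform N s (\<lambda>_. d) (\<lambda>v. \<Sum>p\<in>{p. p permutes {0..<s}}. signof p * (\<Prod>i<s. mev (v i) (ts ! p i)))"
  proof (intro mform_sum mform_monomial)
    fix p i assume "p \<in> {p. p permutes {0..<s}}" "i < s"
    then have "p i < length ts" using permutes_in_image[of p "{0..<s}" i] assms(1) by auto
    then show "ts ! p i \<in> monomials N d" using assms(2) nth_mem by blast
  qed
  then show ?thesis by (simp only: pluecker_rows)
qed

lemma mform_mev_comp:
  assumes "\<And>a. a \<in> keys t \<Longrightarrow> mform N s \<delta> (\<lambda>v. g v a)"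
  shows "mform N s (\<lambda>i. \<Sum>a\<in>keys t. lookup t a * \<delta> i) (\<lambda>v. mev (g v) t)"
  unfolding mev_def by (intro mform_prod mform_power assms)

lemma mform_pluecker_form:
  assumes F: "F \<in> carrier (pluecker_ring N s d)" "homogeneous e F"
  shows "mform N s (\<lambda>_. e * d) (\<lambda>v. mpoly_eval (pluecker s (evf v)) F)"
  unfolding mpoly_eval_eq
proof (intro mform_sum mform_scale)
  fix t assume t: "t \<in> keys F"
  have "mform N s (\<lambda>i. \<Sum>ts\<in>keys t. lookup t ts * d) (\<lambda>v. mev (pluecker s (evf v)) t)"
  proof (intro mform_mev_comp mform_pluecker)
    fix ts assume ts: "ts \<in> keys t"
    have "keys t \<subseteq> {ts. length ts = s \<and> set ts \<subseteq> monomials N d}"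
      using F(1) t by (simp add: pluecker_ring_def mpoly_ring_def)
    then show "length ts = s" "set ts \<subseteq> monomials N d" using ts by auto
  qed
  moreover have "(\<Sum>ts\<in>keys t. lookup t ts * d) = e * d"
    using F(2) t by (simp add: homogeneous_def mono_deg_def flip: sum_distrib_right)
  ultimately show "mform N s (\<lambda>_. e * d) (\<lambda>v. mev (pluecker s (evf v)) t)" by simp
qed

text \<open>The product of the coefficient matrix of the dual forms with the evaluation matrix is
  the identity. Expanding its determinant multilinearly, as for Cauchy-Binet, exhibits a nonzero
  maximal minor.\<close>

lemma pluecker_nonzero:
  assumes v: "distinct_points N s v" and d: "s \<le> d"
  obtains us where "length us = s" "set us \<subseteq> monomials N d" "pluecker s (evf v) us \<noteq> 0"
proof -
  obtain G where G: "\<And>i. i < s \<Longrightarrow> G i \<in> forms N d"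
    "\<And>i j. i < s \<Longrightarrow> j < s \<Longrightarrow> mpoly_eval (v j) (G i) = (if i = j then 1 else 0)"
    using dual_forms[OF v d] by blast
  obtain e where e: "bij_betw e {0..<card (monomials N d)} (monomials N d)"
    using ex_bij_betw_nat_finite[OF finite_monomials] by blast
  define S where "S = {0..<card (monomials N d)}"
  define w where "w k = vec s (\<lambda>j. mev (v j) (e k))" for k
  define a where "a i k = lookup (G i) (e k) \<cdot>\<^sub>v w k" for i k
  let ?Fs = "{f. (\<forall>i\<in>{0..<s}. f i \<in> S) \<and> (\<forall>i. i \<notin> {0..<s} \<longrightarrow> f i = i)}"
  have w: "w k \<in> carrier_vec s" for k by (simp add: w_def)
  have "mat\<^sub>r s s (\<lambda>i. finsum_vec TYPE('a) s (a i) S) = 1\<^sub>m s"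
  proof (rule eq_matI)
    fix i j assume "i < dim_row (1\<^sub>m s :: 'a mat)" "j < dim_col (1\<^sub>m s :: 'a mat)"
    then have ij: "i < s" "j < s" by auto
    have "finsum_vec TYPE('a) s (a i) S $ j = (\<Sum>k\<in>S. a i k $ j)"
      by (rule index_finsum_vec) (use ij in \<open>auto simp: S_def a_def w_def\<close>)
    also have "\<dots> = (\<Sum>k\<in>S. lookup (G i) (e k) * mev (v j) (e k))"
      using ij by (simp add: a_def w_def)
    also have "\<dots> = (\<Sum>u\<in>monomials N d. lookup (G i) u * mev (v j) u)"
      unfolding S_def by (rule sum.reindex_bij_betw[OF e])
    also have "\<dots> = mpoly_eval (v j) (G i)"
      unfolding mpoly_eval_eq using G(1)[OF ij(1)]
      by (intro sum.mono_neutral_right) (auto simp: forms_iff_keys not_in_keys_iff_lookup_eq_zero)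
    finally show "mat\<^sub>r s s (\<lambda>i. finsum_vec TYPE('a) s (a i) S) $$ (i, j) = 1\<^sub>m s $$ (i, j)"
      using ij G(2)[OF ij] by simp
  qed auto
  then have "1 = det (mat\<^sub>r s s (\<lambda>i. finsum_vec TYPE('a) s (a i) S))" by simp
  also have "\<dots> = (\<Sum>f\<in>?Fs. det (mat\<^sub>r s s (\<lambda>i. a i (f i))))"
    by (rule det_linear_rows_sum) (auto simp: S_def a_def w_def)
  also have "\<dots> = (\<Sum>f\<in>?Fs. (\<Prod>i\<in>{0..<s}. lookup (G i) (e (f i))) * det (mat\<^sub>r s s (\<lambda>i. w (f i))))"
    unfolding a_def by (intro sum.cong refl det_rows_mul) (auto simp: w)
  finally have sum1: "1 = (\<Sum>f\<in>?Fs. (\<Prod>i\<in>{0..<s}. lookup (G i) (e (f i))) * det (mat\<^sub>r s s (\<lambda>i. w (f i))))" .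
  have "\<exists>f\<in>?Fs. det (mat\<^sub>r s s (\<lambda>i. w (f i))) \<noteq> 0"
  proof (rule ccontr)
    assume "\<not> (\<exists>f\<in>?Fs. det (mat\<^sub>r s s (\<lambda>i. w (f i))) \<noteq> 0)"
    then have "(\<Sum>f\<in>?Fs. (\<Prod>i\<in>{0..<s}. lookup (G i) (e (f i))) * det (mat\<^sub>r s s (\<lambda>i. w (f i)))) = 0"
      by (intro sum.neutral) auto
    with sum1 show False by simp
  qed
  then obtain f where f: "f \<in> ?Fs" "det (mat\<^sub>r s s (\<lambda>i. w (f i))) \<noteq> 0" by blast
  define us where "us = map (\<lambda>i. e (f i)) [0..<s]"
  have "e (f i) \<in> monomials N d" if "i < s" for i
  proof -
    have "f i \<in> {0..<card (monomials N d)}" using f(1) that by (simp add: S_def)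
    then show ?thesis using bij_betwE[OF e] by blast
  qed
  then have us: "length us = s" "set us \<subseteq> monomials N d" by (auto simp: us_def)
  have "mat s s (\<lambda>(i, j). mev (v i) (us ! j)) = transpose_mat (mat\<^sub>r s s (\<lambda>i. w (f i)))"
    by (rule eq_matI) (auto simp: us_def w_def)
  then have "pluecker s (evf v) us = det (mat\<^sub>r s s (\<lambda>i. w (f i)))"
    unfolding pluecker_def by (simp add: det_transpose[of _ s])
  with f(2) have "pluecker s (evf v) us \<noteq> 0" by simp
  with us show thesis by (rule that)
qed

text \<open>For a monomial with exponents \<open>T i\<close> the alternating sum is, up to
  \<open>c\<close>, a single Pluecker coordinate in degree \<open>e + d\<close>, that of the list of
  all \<open>T i + us ! i\<close>.\<close>

lemma pluecker_alternating:
  assumes "mform N s (\<lambda>_. e) \<Phi>" and us: "length us = s" "set us \<subseteq> monomials N d"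
  shows "\<exists>F\<in>carrier (pluecker_ring N s (e + d)). homogeneous 1 F \<and>
    (\<forall>v. mpoly_eval (pluecker s (evf v)) F =
      (\<Sum>p\<in>{p. p permutes {0..<s}}. signof p * (\<Phi> (\<lambda>i. v (p i)) * (\<Prod>j<s. mev (v (p j)) (us ! j)))))"
  using assms(1)
proof (induction rule: mform.induct)
  case mform_zero
  then show ?case by (intro bexI[of _ 0]) (auto simp: pluecker_ring_def mpoly_ring_def)
next
  case (mform_monomial T c)
  define ts where "ts = map (\<lambda>i. T i + us ! i) [0..<s]"
  have "T i + us ! i \<in> monomials N (e + d)" if "i < s" for i
    using mform_monomial that us nth_mem by (intro monomials_add) auto
  then have ts: "length ts = s" "set ts \<subseteq> monomials N (e + d)" by (auto simp: ts_def)
  have "mpoly_eval (pluecker s (evf v)) (single (single ts 1) c) =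
      (\<Sum>p\<in>{p. p permutes {0..<s}}. signof p * (c * (\<Prod>j<s. mev (v (p j)) (T j)) * (\<Prod>j<s. mev (v (p j)) (us ! j))))"
    for v
  proof -
    have "mpoly_eval (pluecker s (evf v)) (single (single ts 1) c) = c * pluecker s (evf v) ts" by simp
    also have "pluecker s (evf v) ts = (\<Sum>p\<in>{p. p permutes {0..<s}}. signof p * (\<Prod>j<s. mev (v (p j)) (T j + us ! j)))"
      unfolding pluecker_cols using ts by (intro sum.cong arg_cong2[where f = "(*)"] prod.cong) (auto simp: ts_def)
    also have "c * \<dots> = (\<Sum>p\<in>{p. p permutes {0..<s}}. signof p * (c * (\<Prod>j<s. mev (v (p j)) (T j)) * (\<Prod>j<s. mev (v (p j)) (us ! j))))"
      by (simp add: sum_distrib_left mev_add prod.distrib ac_simps)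
    finally show ?thesis .
  qed
  then show ?case
    using ts by (intro bexI[of _ "single (single ts 1) c"])
      (auto simp: pluecker_ring_def mpoly_ring_def homogeneous_single)
next
  case (mform_add f g)
  then obtain F G where F: "F \<in> carrier (pluecker_ring N s (e + d))" "homogeneous 1 F"
      "\<And>v. mpoly_eval (pluecker s (evf v)) F =
        (\<Sum>p\<in>{p. p permutes {0..<s}}. signof p * (f (\<lambda>i. v (p i)) * (\<Prod>j<s. mev (v (p j)) (us ! j))))"
    and G: "G \<in> carrier (pluecker_ring N s (e + d))" "homogeneous 1 G"
      "\<And>v. mpoly_eval (pluecker s (evf v)) G =
        (\<Sum>p\<in>{p. p permutes {0..<s}}. signof p * (g (\<lambda>i. v (p i)) * (\<Prod>j<s. mev (v (p j)) (us ! j))))"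
    by blast
  have "F + G \<in> carrier (pluecker_ring N s (e + d))"
    using F(1) G(1) keys_add[of F G] by (simp add: pluecker_ring_def mpoly_ring_def) blast
  then show ?case
    using homogeneous_add[OF F(2) G(2)]
    by (intro bexI[of _ "F + G"]) (simp_all add: mpoly_eval_add F(3) G(3) distrib_right distrib_left sum.distrib)
qed

text \<open>A symmetric function becomes alternating when multiplied by a Pluecker coordinate.\<close>

lemma pluecker_symmetric:
  assumes \<Phi>: "mform N s (\<lambda>_. e) \<Phi>" "\<And>p v. p permutes {..<s} \<Longrightarrow> \<Phi> (\<lambda>i. v (p i)) = \<Phi> v"
    and us: "length us = s" "set us \<subseteq> monomials N d"
  obtains F where "F \<in> carrier (pluecker_ring N s (e + d))" "homogeneous 1 F"
    "\<And>v. mpoly_eval (pluecker s (evf v)) F = \<Phi> v * pluecker s (evf v) us"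
proof -
  obtain F where F: "F \<in> carrier (pluecker_ring N s (e + d))" "homogeneous 1 F"
    "\<And>v. mpoly_eval (pluecker s (evf v)) F =
      (\<Sum>p\<in>{p. p permutes {0..<s}}. signof p * (\<Phi> (\<lambda>i. v (p i)) * (\<Prod>j<s. mev (v (p j)) (us ! j))))"
    using pluecker_alternating[OF \<Phi>(1) us] by blast
  have "mpoly_eval (pluecker s (evf v)) F = \<Phi> v * pluecker s (evf v) us" for v
  proof -
    have "pluecker s (evf v) us = (\<Sum>p\<in>{p. p permutes {0..<s}}. signof p * (\<Prod>j<s. mev (v (p j)) (us ! j)))"
      by (rule pluecker_cols)
    moreover have "mpoly_eval (pluecker s (evf v)) F =
        (\<Sum>p\<in>{p. p permutes {0..<s}}. \<Phi> v * (signof p * (\<Prod>j<s. mev (v (p j)) (us ! j))))"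
      unfolding F(3) using \<Phi>(2)[of _ v] by (intro sum.cong) (auto simp: atLeast0LessThan)
    ultimately show ?thesis by (simp add: sum_distrib_left)
  qed
  with F(1,2) show thesis by (rule that)
qed

section \<open>Open subsets of the Hilbert scheme\<close>

text \<open>The constant 1 never vanishes, so its basic open set in degree \<open>d\<close> contains
  every ideal with a frame there, and each closed point has a frame in large degree.\<close>

lemma topspace_hilb_topology:
  assumes "s > 0"
  shows "topspace (hilb_topology N s) = (hilb N s :: (nat, 'k::field) mpoly set set)"
proof -
  have "\<exists>d F. J \<in> hilb_basic_open N s d F \<and> s \<le> d \<and> F \<in> carrier (pluecker_ring N s d) \<and> (\<exists>e. homogeneous e F)"
    if J: "J \<in> hilb N s" for J :: "(nat, 'k) mpoly set"
  proof -
    obtain d0 where d0: "\<forall>d\<ge>d0. hilbert_function N J d = s" and "homogeneous_ideal N J"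
      using J by (auto simp: hilb_def)
    then obtain l where "frame N s (max d0 s) J l"
      using form_space.frame_exists[of J N "max d0 s" s] by (auto simp: homogeneous_ideal_def)
    then have "J \<in> hilb_basic_open N s (max d0 s) 1"
      unfolding hilb_basic_open_def using J by auto
    moreover have "1 \<in> carrier (pluecker_ring N s (max d0 s))"
      by (simp add: pluecker_ring_def mpoly_ring_def)
    ultimately show ?thesis
      using homogeneous_one by (intro exI[of _ "max d0 s"] exI[of _ 1]) auto
  qed
  then have "J \<in> \<Union> {hilb_basic_open N s d F | d F. s \<le> d \<and> F \<in> carrier (pluecker_ring N s d) \<and> (\<exists>e. homogeneous e F)}"
    if "J \<in> hilb N s" for J :: "(nat, 'k) mpoly set"
    using that by (simp only: Union_iff mem_Collect_eq bex_simps) metis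
  then have "hilb N s \<subseteq> \<Union> {hilb_basic_open N s d F | d F :: (nat monomial list, 'k) mpoly.
      s \<le> d \<and> F \<in> carrier (pluecker_ring N s d) \<and> (\<exists>e. homogeneous e F)}"
    by (rule subsetI)
  moreover have "\<Union> {hilb_basic_open N s d F | d F :: (nat monomial list, 'k) mpoly. P d F} \<subseteq> hilb N s" for P
    by (rule Union_least) (auto simp: hilb_basic_open_def)
  ultimately show ?thesis
    unfolding hilb_topology_def topology_generated_by_topspace by (intro equalityI)
qed

lemma openin_hilb_basic_open:
  assumes "s \<le> d" "F \<in> carrier (pluecker_ring N s d)" "homogeneous e F"
  shows "openin (hilb_topology N s) (hilb_basic_open N s d F)"
  unfolding hilb_topology_def using assms
  by (intro topology_generated_by_Basis CollectI exI[of _ d] exI[of _ F]) auto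

text \<open>On tuples of points a basic open set is given by a nonvanishing multihomogeneous
  function. Intersections become products, and for a union one member suffices.\<close>

lemma open_nonvanishing_form:
  fixes v :: "nat \<Rightarrow> nat \<Rightarrow> 'k::field"
  assumes "openin (hilb_topology N s) V" "distinct_points N s v" "van_ideal N s v \<in> V"
  shows "\<exists>e f. mform N s (\<lambda>_. e) f \<and> f v \<noteq> 0 \<and> (\<forall>w. distinct_points N s w \<longrightarrow> f w \<noteq> 0 \<longrightarrow> van_ideal N s w \<in> V)"
proof -
  have "generate_topology_on {hilb_basic_open N s d F | d F :: (nat monomial list, 'k) mpoly.
      s \<le> d \<and> F \<in> carrier (pluecker_ring N s d) \<and> (\<exists>e. homogeneous e F)} V"
    using assms(1) unfolding hilb_topology_def openin_topology_generated_by_iff .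
  then show ?thesis
    using assms(3)
  proof (induction rule: generate_topology_on.induct)
    case (Int A B)
    then obtain e f e' f' where
      f: "mform N s (\<lambda>_. e) f" "f v \<noteq> 0" "\<forall>w. distinct_points N s w \<longrightarrow> f w \<noteq> 0 \<longrightarrow> van_ideal N s w \<in> A" and
      f': "mform N s (\<lambda>_. e') f'" "f' v \<noteq> 0" "\<forall>w. distinct_points N s w \<longrightarrow> f' w \<noteq> 0 \<longrightarrow> van_ideal N s w \<in> B"
      by blast
    have "mform N s (\<lambda>_. e + e') (\<lambda>v. f v * f' v)" by (rule mform_mult[OF f(1) f'(1)])
    with f f' show ?case by (intro exI[of _ "e + e'"] exI[of _ "\<lambda>v. f v * f' v"]) auto
  next
    case (UN K)
    then obtain k where k: "k \<in> K" "van_ideal N s v \<in> k" by blast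
    from UN.IH[OF this] obtain e f where
      "mform N s (\<lambda>_. e) f" "f v \<noteq> 0" "\<forall>w. distinct_points N s w \<longrightarrow> f w \<noteq> 0 \<longrightarrow> van_ideal N s w \<in> k" by blast
    with k(1) show ?case by (intro exI[of _ e] exI[of _ f]) auto
  next
    case (Basis S)
    then obtain d F e where S: "S = hilb_basic_open N s d F" and
      F: "s \<le> d" "F \<in> carrier (pluecker_ring N s d)" "homogeneous e F" by blast
    show ?case
    proof (intro exI conjI allI impI)
      show "mform N s (\<lambda>_. e * d) (\<lambda>v. mpoly_eval (pluecker s (evf v)) F)"
        by (rule mform_pluecker_form[OF F(2,3)])
      show "mpoly_eval (pluecker s (evf v)) F \<noteq> 0"
        using Basis.prems hilb_basic_open_iff[OF assms(2) F] S by blast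
      show "van_ideal N s w \<in> S" if "distinct_points N s w" "mpoly_eval (pluecker s (evf w)) F \<noteq> 0" for w
        using that hilb_basic_open_iff[OF that(1) F] S by blast
    qed
  qed auto
qed

text \<open>After pulling out the scalar two rows are equal; this also covers
  \<open>c = 0\<close>.\<close>

lemma pluecker_proportional:
  assumes "i < s" "j < s" "i \<noteq> j" "v i = (\<lambda>k. c * v j k)" and us: "length us = s" "set us \<subseteq> monomials N d"
  shows "pluecker s (evf v) us = (0 :: 'k::field)"
proof -
  define y where "y = v(i := v j)"
  have v: "v = (\<lambda>l k. (if l = i then c else 1) * y l k)"
    using assms(3,4) by (auto simp: y_def fun_eq_iff)
  have "pluecker s (evf y) us = 0"
    unfolding pluecker_def
  proof (rule det_identical_rows[of _ s i j])
    show "row (mat s s (\<lambda>(i, k). mev (y i) (us ! k))) i = row (mat s s (\<lambda>(i, k). mev (y i) (us ! k))) j"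
      using assms(1-3) by (intro eq_vecI) (auto simp: y_def)
  qed (use assms in auto)
  moreover have "pluecker s (evf v) us = (\<Prod>l<s. (if l = i then c else 1) ^ d) * pluecker s (evf y) us"
    by (subst v) (rule mform_scale_points[OF mform_pluecker[OF us]])
  ultimately show ?thesis by simp
qed

text \<open>Proportional points would make the coordinate vanish. A zero vector counts as
  proportional, with factor 0, to another point, which exists because
  \<open>s \<ge> 2\<close>.\<close>

lemma distinct_points_of_pluecker:
  assumes "s \<ge> 2" and us: "length us = s" "set us \<subseteq> monomials N d"
    and nz: "pluecker s (evf v) us \<noteq> (0 :: 'k::field)" and v: "\<And>i k. i < s \<Longrightarrow> N < k \<Longrightarrow> v i k = 0"
  shows "distinct_points N s v"
  unfolding distinct_points_def
proof (intro conjI allI impI)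
  show *: "v i \<noteq> (\<lambda>k. c * v j k)" if "i < s" "j < s" "i \<noteq> j" for i j c
    using pluecker_proportional[OF that _ us, of v c] nz by blast
  fix i assume i: "i < s"
  define j where "j = (if i = 0 then 1 else 0 :: nat)"
  then have j: "j < s" "i \<noteq> j" using assms(1) by auto
  have "v i \<noteq> (\<lambda>_. 0)" using *[OF i j, of 0] by auto
  then show "v i \<in> nonzero_vectors N" using v[OF i] by (simp add: nonzero_vectors_def)
qed

text \<open>\<open>nonzero_vectors N\<close> demands zeros beyond the coordinate \<open>N\<close>,
  which points found on a line need not have; functions in \<open>mform N\<close> do not see these
  coordinates.\<close>

definition truncate_points :: "nat \<Rightarrow> (nat \<Rightarrow> nat \<Rightarrow> 'k::zero) \<Rightarrow> nat \<Rightarrow> nat \<Rightarrow> 'k"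
  where "truncate_points N v = (\<lambda>i k. if k \<le> N then v i k else 0)"

lemma mform_truncate_points:
  assumes "mform N s \<delta> f"
  shows "f (truncate_points N v) = f v"
  using assms
proof (induction rule: mform.induct)
  case (mform_monomial T c)
  have "mev (truncate_points N v i) (T i) = mev (v i) (T i)" if "i < s" for i
    using mform_monomial[OF that] by (intro mev_cong) (auto simp: truncate_points_def monomials_def)
  then show ?case by simp
qed auto

lemma symmetric_form_exists:
  fixes \<Psi> :: "(nat \<Rightarrow> nat \<Rightarrow> 'k::field) \<Rightarrow> 'k"
  assumes "infinite (UNIV :: 'k set)" and \<Psi>: "mform N s \<delta> \<Psi>" "\<Psi> v0 \<noteq> 0" and v0: "\<And>i. v0 i 0 = 1"
  shows "\<exists>e \<Phi>. mform N s (\<lambda>_. e) \<Phi> \<and> (\<forall>p v. p permutes {..<s} \<longrightarrow> \<Phi> (\<lambda>i. v (p i)) = \<Phi> v) \<and> (\<exists>w. \<Phi> w \<noteq> 0) \<and>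
    (\<forall>v. \<Phi> v \<noteq> 0 \<longrightarrow> \<Psi> v \<noteq> 0 \<and> (\<forall>i<s. v i 0 \<noteq> 0))"
proof -
  \<comment> \<open>The exponents \<open>E - \<delta> i\<close> of x_0 equalize the degrees, so that
    points may be permuted. The summand 1 keeps them positive, so that nonvanishing also forces the
    coordinate x_0 of every point to be nonzero.\<close>
  define E where "E = 1 + (\<Sum>i<s. \<delta> i)"
  have \<delta>: "\<delta> i < E" if "i < s" for i
    using member_le_sum[of i "{..<s}" \<delta>] that by (simp add: E_def)
  define \<Psi>' where "\<Psi>' v = \<Psi> v * (1 * (\<Prod>i<s. mev (v i) (single 0 (E - \<delta> i))))" for v
  have "mform N s (\<lambda>i. \<delta> i + (E - \<delta> i)) \<Psi>'"
    unfolding \<Psi>'_def[abs_def]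
    by (intro mform_mult[OF \<Psi>(1)] mform_monomial) (auto simp: monomials_def)
  then have \<Psi>'_form: "mform N s (\<lambda>_. E) \<Psi>'"
    by (rule mform_cong) (use \<delta> in \<open>auto simp: less_imp_le\<close>)
  define Ps where "Ps = {p. p permutes {..<s}}"
  have fin: "finite Ps" by (simp add: Ps_def finite_permutations)
  \<comment> \<open>The product over all relabellings is symmetric, and the identity is one of them,
    so its nonvanishing implies that of \<open>\<Psi>'\<close>.\<close>
  define \<Phi> where "\<Phi> v = (\<Prod>p\<in>Ps. \<Psi>' (\<lambda>i. v (p i)))" for v
  have forms: "mform N s (\<lambda>_. E) (\<lambda>v. \<Psi>' (\<lambda>i. v (p i)))" if "p \<in> Ps" for p
    using mform_permute[OF \<Psi>'_form] that by (simp add: Ps_def)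
  have 1: "mform N s (\<lambda>_. \<Sum>p\<in>Ps. E) \<Phi>"
    unfolding \<Phi>_def[abs_def] by (intro mform_prod forms)
  have 2: "\<Phi> (\<lambda>i. v (q i)) = \<Phi> v" if q: "q permutes {..<s}" for q v
    unfolding \<Phi>_def Ps_def
    by (rule prod.reindex_bij_witness[of _ "\<lambda>p i. Hilbert_Choice.inv q (p i)" "\<lambda>p i. q (p i)"])
      (use q permutes_inverses[OF q] permutes_compose[of _ "{..<s}" q] permutes_compose[OF _ permutes_inv[OF q]]
       in \<open>auto simp: comp_def\<close>)
  have "\<Psi>' v0 \<noteq> 0" using \<Psi>(2) v0 by (simp add: \<Psi>'_def)
  then have ex: "\<exists>v. \<Psi>' (\<lambda>i. v (p i)) \<noteq> 0" if "p \<in> Ps" for p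
    using permutes_inverses(2)[of p "{..<s}"] that
    by (intro exI[of _ "\<lambda>i. v0 (Hilbert_Choice.inv p i)"]) (simp add: Ps_def)
  have 3: "\<exists>w. \<Phi> w \<noteq> 0"
    unfolding \<Phi>_def
    by (rule mform_prod_nonzero[OF assms(1) fin, of N s "\<lambda>_ _. E"]) (use forms ex in auto)
  have 4: "\<Psi>' v \<noteq> 0" if nz: "\<Phi> v \<noteq> 0" for v
  proof
    assume "\<Psi>' v = 0"
    then have "\<Phi> v = 0"
      unfolding \<Phi>_def using fin permutes_id[of "{..<s}"]
      by (intro prod_zero bexI[of _ id]) (auto simp: Ps_def)
    with nz show False by simp
  qed
  have 5: "\<Psi> v \<noteq> 0" if "\<Phi> v \<noteq> 0" for v using 4[OF that] by (auto simp: \<Psi>'_def)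
  have 6: "v i 0 \<noteq> 0" if "\<Phi> v \<noteq> 0" "i < s" for v i
    using 4[OF that(1)] \<delta>[OF that(2)] that(2) by (auto simp: \<Psi>'_def power_0_left)
  show ?thesis using 1 2 3 5 6 by blast
qed

theorem theorem2p9:
  fixes N m s :: nat
  assumes "N \<ge> 3" and "m \<ge> 1" and "s \<ge> (2 * m + 2) ^ N"
  shows "holds_for_general_points N s
    (\<lambda>X :: (nat \<Rightarrow> 'k::alg_closed_field) set set.
      waldschmidt N (defining_ideal N X) \<ge>
        (real (\<alpha> (symbolic_power (coord_ring N) (defining_ideal N X) m)) + real N - 1)
          / (real m + real N - 1))"
proof -
  define Q :: "(nat, 'k) mpoly set \<Rightarrow> bool" where "Q I \<longleftrightarrow> waldschmidt N I \<ge>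
      (real (\<alpha> (symbolic_power (coord_ring N) I m)) + real N - 1) / (real m + real N - 1)" for I
  define T :: "(nat, 'k) mpoly set topology" where "T = hilb_topology N s"
  have N: "N > 0" using assms(1) by simp
  obtain k where k: "k ^ N \<le> s" "s < (k + 1) ^ N" by (rule nat_root_exists[OF N])
  have "(2 * m + 2) ^ N < (k + 1) ^ N" using assms(3) k(2) by linarith
  then have k2: "2 * m + 2 \<le> k" using power_less_imp_less_base[of "2 * m + 2" N "k + 1"] by simp
  have "2 ^ 1 \<le> (2 * m + 2) ^ N"
    using N by (intro order_trans[OF power_increasing[of 1 N "2::nat"] power_mono]) auto
  then have s2: "s \<ge> 2" using assms(3) by simp
  have inf: "infinite (UNIV :: 'k set)" by (rule infinite_UNIV_alg_closed)
  define n where "n = k * (m + N - 1) * N * N"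
  obtain S :: "'k set" where S: "finite S" "card S = k"
    using infinite_arbitrarily_large[OF inf, of k] by blast
  \<comment> \<open>The degree needed on the grid is rounded up to a multiple of \<open>k\<close>,
    so that a power of \<open>k\<close> cancels in the final bound.\<close>
  have "n * card S + N * (card S - 1) \<le> n * k + N * k" unfolding S(2) by (intro add_mono mult_le_mono) auto
  then have "n * card S + N * (card S - 1) \<le> k * (n + N)" by (simp add: algebra_simps)
  from grid_jet_interpolator[OF S(1) this] obtain v0 :: "nat \<Rightarrow> nat \<Rightarrow> 'k" and H0 where
    v0: "\<And>i. v0 i 0 = 1" and H0: "jet_interpolator N (k ^ N) v0 (k * (n + N)) n H0"
    unfolding S(2) by blast
  obtain \<delta> \<Psi> where \<Psi>: "mform N s \<delta> \<Psi>" "\<Psi> v0 \<noteq> 0"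
    "\<And>v. \<Psi> v \<noteq> 0 \<Longrightarrow> \<exists>K. jet_interpolator N (k ^ N) v (k * (n + N)) n K"
    using jet_interpolator_open[OF H0 k(1)] by blast
  obtain e \<Phi> w0 where \<Phi>: "mform N s (\<lambda>_. e) \<Phi>" "\<And>p v. p permutes {..<s} \<Longrightarrow> \<Phi> (\<lambda>i. v (p i)) = \<Phi> v" "\<Phi> w0 \<noteq> 0"
    "\<And>v. \<Phi> v \<noteq> 0 \<Longrightarrow> \<Psi> v \<noteq> 0" "\<And>v i. \<Phi> v \<noteq> 0 \<Longrightarrow> i < s \<Longrightarrow> v i 0 \<noteq> 0"
    using symmetric_form_exists[OF inf \<Psi>(1,2) v0] by blast
  have good: "Q (van_ideal N s y)" if y: "distinct_points N s y" "\<Phi> y \<noteq> 0" for y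
  proof -
    \<comment> \<open>Scaling every point to first coordinate 1, as \<open>separated_points\<close>
      requires, changes neither the ideal nor the nonvanishing of \<Phi>.\<close>
    define z where "z i = (\<lambda>l. inverse (y i 0) * y i l)" for i
    have nz: "inverse (y i 0) \<noteq> 0" if "i < s" for i using \<Phi>(5)[OF y(2) that] by simp
    have z0: "z i 0 = 1" if "i < s" for i using nz[OF that] by (simp add: z_def)
    have "van_ideal N s z = van_ideal N s y"
      unfolding z_def by (rule van_ideal_scale) (rule nz)
    moreover have "distinct_points N s z"
      unfolding distinct_points_def
    proof (intro conjI allI impI)
      fix i assume i: "i < s"
      then have "y i \<in> nonzero_vectors N" using y(1) by (simp add: distinct_points_def)
      then show "z i \<in> nonzero_vectors N" using nz[OF i] by (auto simp: nonzero_vectors_def z_def fun_eq_iff)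
      fix j c assume j: "j < s" "i \<noteq> j"
      show "z i \<noteq> (\<lambda>l. c * z j l)"
      proof
        assume eq: "z i = (\<lambda>l. c * z j l)"
        have "y i = (\<lambda>l. (y i 0 * c * inverse (y j 0)) * y j l)"
        proof
          fix l
          have "y i l = y i 0 * z i l" using nz[OF i] by (simp add: z_def)
          then show "y i l = (y i 0 * c * inverse (y j 0)) * y j l" unfolding eq by (simp add: z_def)
        qed
        then show False using y(1) i j by (auto simp: distinct_points_def)
      qed
    qed
    moreover have "\<Phi> z \<noteq> 0"
    proof -
      have "\<Phi> z = (\<Prod>i<s. inverse (y i 0) ^ e) * \<Phi> y"
        unfolding z_def by (rule mform_scale_points[OF \<Phi>(1)])
      then show ?thesis using y(2) nz by simp
    qed
    then obtain K where "jet_interpolator N (k ^ N) z (k * (n + N)) n K" using \<Psi>(3) \<Phi>(4) by blast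
    ultimately show ?thesis
      using separated_points.waldschmidt_ge[OF separated_points_of_distinct assms(1,2) k2 k, of z K] z0
      by (simp add: Q_def n_def)
  qed
  define B where "B = {van_ideal N s v | v. distinct_points N s v \<and> \<not> Q (van_ideal N s v)}"
  define U where "U = topspace T - T closure_of B"
  have top: "topspace T = hilb N s" unfolding T_def using s2 by (intro topspace_hilb_topology) simp
  have openU: "openin T U" unfolding U_def by (intro openin_diff) auto
  have "T closure_of U = topspace T"
    unfolding dense_intersects_open
  proof (intro allI impI)
    fix V assume "openin T V \<and> V \<noteq> {}"
    then have V: "openin T V" "V \<noteq> {}" by auto
    show "U \<inter> V \<noteq> {}"
    proof (cases "V \<inter> B = {}")
      case True
      then have "V \<inter> T closure_of B = {}" using openin_Int_closure_of_eq_empty[OF V(1)] by blast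
      then have "V \<subseteq> U" using openin_subset[OF V(1)] by (auto simp: U_def)
      then show ?thesis using V(2) by blast
    next
      case False
      then obtain v where v: "distinct_points N s v" "van_ideal N s v \<in> V" by (auto simp: B_def)
      obtain d f where f: "mform N s (\<lambda>_. d) f" "f v \<noteq> 0"
        "\<And>w. distinct_points N s w \<Longrightarrow> f w \<noteq> 0 \<Longrightarrow> van_ideal N s w \<in> V"
        using open_nonvanishing_form[OF V(1)[unfolded T_def] v] by blast
      obtain us where us: "length us = s" "set us \<subseteq> monomials N s" "pluecker s (evf v) us \<noteq> 0"
        using pluecker_nonzero[OF v(1) order_refl] by blast
      \<comment> \<open>The Pluecker coordinate is a factor so that the common point of nonvanishing
        is again a tuple of distinct points.\<close>
      let ?g = "\<lambda>v. f v * pluecker s (evf v) us"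
      have g: "mform N s (\<lambda>_. d + s) ?g" by (rule mform_mult[OF f(1) mform_pluecker[OF us(1,2)]])
      have gv: "?g v \<noteq> 0" using f(2) us(3) by simp
      obtain x where "?g (\<lambda>i j. v i j + x * (w0 i j - v i j)) \<noteq> 0" "\<Phi> (\<lambda>i j. v i j + x * (w0 i j - v i j)) \<noteq> 0"
        by (rule mform_common_nonzero[OF inf g \<Phi>(1) gv \<Phi>(3)])
      then obtain z where z: "?g z \<noteq> 0" "\<Phi> z \<noteq> 0" by blast
      define z' where "z' = truncate_points N z"
      have z': "f z' \<noteq> 0" "pluecker s (evf z') us \<noteq> 0" "\<Phi> z' \<noteq> 0"
        using z mform_truncate_points[OF f(1), of z] mform_truncate_points[OF \<Phi>(1), of z]
          mform_truncate_points[OF mform_pluecker[OF us(1,2)], of z] by (auto simp: z'_def)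
      have dist: "distinct_points N s z'"
        by (rule distinct_points_of_pluecker[OF s2 us(1,2) z'(2)]) (simp add: z'_def truncate_points_def)
      obtain F where F: "F \<in> carrier (pluecker_ring N s (e + s))" "homogeneous 1 F"
        "\<And>v. mpoly_eval (pluecker s (evf v)) F = \<Phi> v * pluecker s (evf v) us"
        using pluecker_symmetric[OF \<Phi>(1,2) us(1,2)] by metis
      \<comment> \<open>An open neighbourhood of the new set of points that contains no bad sets,
        hence misses the closure of \<open>B\<close>.\<close>
      define W where "W = hilb_basic_open N s (e + s) F"
      have W: "openin T W" unfolding T_def W_def using F(1,2) by (intro openin_hilb_basic_open) auto
      have mem_W: "van_ideal N s y \<in> W \<longleftrightarrow> \<Phi> y * pluecker s (evf y) us \<noteq> 0" if "distinct_points N s y" for y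
        unfolding W_def using hilb_basic_open_iff[OF that _ F(1,2)] F(3)[of y] by simp
      have "W \<inter> B = {}"
      proof (rule ccontr)
        assume "W \<inter> B \<noteq> {}"
        then obtain y where y: "distinct_points N s y" "\<not> Q (van_ideal N s y)" "van_ideal N s y \<in> W"
          by (auto simp: B_def)
        then show False using good[OF y(1)] mem_W[OF y(1)] by auto
      qed
      then have "W \<inter> T closure_of B = {}" using openin_Int_closure_of_eq_empty[OF W] by blast
      moreover have "van_ideal N s z' \<in> W" using mem_W[OF dist] z' by simp
      moreover have "van_ideal N s z' \<in> V" using f(3)[OF dist] z' by simp
      ultimately show ?thesis using openin_subset[OF V(1)] by (auto simp: U_def)
    qed
  qed
  moreover have "Q (defining_ideal N X)"
    if X: "X \<subseteq> proj_space N" "finite X" "card X = s" "defining_ideal N X \<in> U" for X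
  proof (rule ccontr)
    assume bad: "\<not> Q (defining_ideal N X)"
    obtain v where v: "distinct_points N s v" "defining_ideal N X = van_ideal N s v"
      by (rule defining_ideal_eq_van_ideal[OF X(1-3)])
    then have "defining_ideal N X \<in> B" using bad unfolding B_def by auto
    moreover have "defining_ideal N X \<in> topspace T" using X(4) by (simp add: U_def)
    ultimately have "defining_ideal N X \<in> T closure_of B" by (auto simp: in_closure_of)
    then show False using X(4) by (simp add: U_def)
  qed
  ultimately show ?thesis
    unfolding holds_for_general_points_def Q_def[symmetric] T_def[symmetric] top[symmetric] using openU by blast
qed

end
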